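(* Let $u$ be the solution of the heat problem, $U$ its spatially discrete finite element approximation, $\omega(t)=\mathcal R U(t)$ the elliptic reconstruction of $U(t)$, $e:=U-u$ the semidiscrete error and $\epsilon:=\omega-U$ the elliptic error. Then, for each $t\in[0,T]$, $$\|e(t)\|^2+\int_0^t\|e(s)\|_a^2\,ds\le\|e(0)\|^2+\int_0^t\Bigl(\|\epsilon(s)\|_a^2+2\langle P_0f(s)-f(s),e(s)\rangle\Bigr)ds.$$
   Context: $\Omega\subset\mathbb R^d$ is a bounded polyhedral domain. $\langle f,g\rangle=\int_\Omega fg$ and $\|f\|=\langle f,f\rangle^{1/2}$ are the $L_2(\Omega)$ inner product and norm; $\langle\cdot,\cdot\rangle$ also denotes the $H^{-1}(\Omega)$–$H^1_0(\Omega)$ duality. $a(\phi,\psi)=\langle\nabla\phi,\nabla\psi\rangle$, $\|\phi\|_a=a(\phi,\phi)^{1/2}$ on $H^1_0(\Omega)$. Heat problem: given $T>0$, $u_0\in L_2(\Omega)$, $f\in L_2(0,T;L_2(\Omega))$, the solution $u\in L_2(0,T;H^1_0(\Omega))$ with $\partial_tu\in L_2(0,T;H^{-1}(\Omega))$ satisfies $\langle\partial_tu(t),\phi\rangle+a(u(t),\phi)=\langle f(t),\phi\rangle$ for all $\phi\in H^1_0(\Omega)$ and (almost) all $t\in(0,T]$, and $u(0)=u_0$. Semidiscrete scheme: $\mathcal T$ is a conforming simplicial triangulation of $\Omega$, $p\ge1$ an integer, $\mathbb V=\{\Phi\in H^1_0(\Omega):\Phi|_K\in\mathbb P^p\ \forall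 K\in\mathcal T\}$ with $\mathbb P^p$ the polynomials of degree at most $p$. $U:[0,T]\to\mathbb V$ satisfies $\langle\partial_tU,\Phi\rangle+a(U,\Phi)=\langle f,\Phi\rangle$ for all $\Phi\in\mathbb V$, with $U(0)=U^0\in\mathbb V$ a given projection or interpolation of $u_0$ onto $\mathbb V$. The discrete Laplacian $A:\mathbb V\to\mathbb V$ is defined by $\langle AV,\Phi\rangle=a(V,\Phi)$ for all $\Phi\in\mathbb V$; $P_0:L_2(\Omega)\to\mathbb V$ is the $L_2(\Omega)$-projection. The elliptic reconstruction operator $\mathcal R:\mathbb V\to H^1_0(\Omega)$ is defined by: $\mathcal RV\in H_0^1(\Omega)$ satisfies $a(\mathcal RV,\phi)=\langle AV,\phi\rangle$ for all $\phi\in H^1_0(\Omega)$. *)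

theory Defs
  imports "HOL-Analysis.Analysis"
begin

text \<open>Elements of \<open>L\<^sub>2(\<Omega>)\<close>, \<open>H\<^sup>1(\<Omega>)\<close> etc. are represented by functions on the whole
  space, of which only the a.e.-class on \<open>\<Omega>\<close> matters; the norms below are thus seminorms on
  functions. The value type is a Euclidean space so that the same notions serve for scalar
  functions and for gradients.\<close>

definition L2 :: "'a::euclidean_space set \<Rightarrow> ('a \<Rightarrow> 'b::euclidean_space) set" where
  "L2 \<Omega> = {v \<in> borel_measurable (lebesgue_on \<Omega>). integrable (lebesgue_on \<Omega>) (\<lambda>x. (norm (v x))\<^sup>2)}"

definition L2_inner ::
    "'a::euclidean_space set \<Rightarrow> ('a \<Rightarrow> 'b::euclidean_space) \<Rightarrow> ('a \<Rightarrow> 'b) \<Rightarrow> real" where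
  "L2_inner \<Omega> v w = (LINT x|lebesgue_on \<Omega>. v x \<bullet> w x)"

definition L2_norm :: "'a::euclidean_space set \<Rightarrow> ('a \<Rightarrow> 'b::euclidean_space) \<Rightarrow> real" where
  "L2_norm \<Omega> v = sqrt (L2_inner \<Omega> v v)"

primrec Ck :: "nat \<Rightarrow> ('a::euclidean_space \<Rightarrow> real) \<Rightarrow> bool" where
  "Ck 0 \<phi> \<longleftrightarrow> continuous_on UNIV \<phi>"
| "Ck (Suc k) \<phi> \<longleftrightarrow> (\<forall>x. \<phi> differentiable (at x)) \<and>
     (\<forall>b\<in>Basis. Ck k (\<lambda>x. frechet_derivative \<phi> (at x) b))"

definition test_functions :: "'a::euclidean_space set \<Rightarrow> ('a \<Rightarrow> real) set" where
  "test_functions \<Omega> = {\<phi>. (\<forall>k. Ck k \<phi>) \<and> compact (closure {x. \<phi> x \<noteq> 0}) \<and> closure {x. \<phi> x \<noteq> 0} \<subseteq> \<Omega>}"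

definition weak_gradient ::
    "'a::euclidean_space set \<Rightarrow> ('a \<Rightarrow> real) \<Rightarrow> ('a \<Rightarrow> 'a) \<Rightarrow> bool" where
  "weak_gradient \<Omega> v G \<longleftrightarrow> (\<forall>\<phi>\<in>test_functions \<Omega>. \<forall>b\<in>Basis.
     L2_inner \<Omega> v (\<lambda>x. frechet_derivative \<phi> (at x) b) = - L2_inner \<Omega> (\<lambda>x. G x \<bullet> b) \<phi>)"

definition H1 :: "'a::euclidean_space set \<Rightarrow> ('a \<Rightarrow> real) set" where
  "H1 \<Omega> = {v \<in> L2 \<Omega>. \<exists>G\<in>L2 \<Omega>. weak_gradient \<Omega> v G}"

text \<open>The weak gradient is unique a.e., so the choice of representative is immaterial.\<close>

definition grad :: "'a::euclidean_space set \<Rightarrow> ('a \<Rightarrow> real) \<Rightarrow> ('a \<Rightarrow> 'a)" where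
  "grad \<Omega> v = (SOME G. G \<in> L2 \<Omega> \<and> weak_gradient \<Omega> v G)"

definition energy :: "'a::euclidean_space set \<Rightarrow> ('a \<Rightarrow> real) \<Rightarrow> ('a \<Rightarrow> real) \<Rightarrow> real" where
  "energy \<Omega> v w = L2_inner \<Omega> (grad \<Omega> v) (grad \<Omega> w)"

definition energy_norm :: "'a::euclidean_space set \<Rightarrow> ('a \<Rightarrow> real) \<Rightarrow> real" where
  "energy_norm \<Omega> v = sqrt (energy \<Omega> v v)"

definition H1_norm :: "'a::euclidean_space set \<Rightarrow> ('a \<Rightarrow> real) \<Rightarrow> real" where
  "H1_norm \<Omega> v = sqrt ((L2_norm \<Omega> v)\<^sup>2 + (energy_norm \<Omega> v)\<^sup>2)"

text \<open>Closure of the test functions in \<open>H\<^sup>1(\<Omega>)\<close>.\<close>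

definition H10 :: "'a::euclidean_space set \<Rightarrow> ('a \<Rightarrow> real) set" where
  "H10 \<Omega> = {v \<in> H1 \<Omega>. \<forall>\<epsilon>>0. \<exists>\<phi>\<in>test_functions \<Omega>. H1_norm \<Omega> (\<lambda>x. v x - \<phi> x) < \<epsilon>}"

definition Hm1 :: "'a::euclidean_space set \<Rightarrow> (('a \<Rightarrow> real) \<Rightarrow> real) set" where
  "Hm1 \<Omega> = {F. (\<forall>v\<in>H10 \<Omega>. \<forall>w\<in>H10 \<Omega>. F (\<lambda>x. v x + w x) = F v + F w) \<and>
     (\<forall>v\<in>H10 \<Omega>. \<forall>c. F (\<lambda>x. c * v x) = c * F v) \<and>
     (\<exists>C. \<forall>v\<in>H10 \<Omega>. \<bar>F v\<bar> \<le> C * H1_norm \<Omega> v)}"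

definition Hm1_norm :: "'a::euclidean_space set \<Rightarrow> (('a \<Rightarrow> real) \<Rightarrow> real) \<Rightarrow> real" where
  "Hm1_norm \<Omega> F = (SUP v \<in> {v \<in> H10 \<Omega>. H1_norm \<Omega> v \<le> 1}. \<bar>F v\<bar>)"

text \<open>The Bochner space \<open>L\<^sub>2(0,T;X)\<close> for a space \<open>X\<close> (carrier \<open>X\<close>, norm \<open>N\<close>) of functions or of
  functionals: strong measurability means a.e. approximability by simple functions.
  Its elements are represented by functions whose values need to lie in \<open>X\<close> only for a.e. time.\<close>

definition strongly_measurable ::
    "real \<Rightarrow> 'x::minus set \<Rightarrow> ('x \<Rightarrow> real) \<Rightarrow> (real \<Rightarrow> 'x) \<Rightarrow> bool" where
  "strongly_measurable T X N g \<longleftrightarrow> (AE t in lebesgue_on {0<..<T}. g t \<in> X) \<and>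
     (\<exists>s. (\<forall>n. simple_function (lebesgue_on {0<..<T}) (s n) \<and> s n ` {0<..<T} \<subseteq> X) \<and>
       (AE t in lebesgue_on {0<..<T}. (\<lambda>n::nat. N (g t - s n t)) \<longlonglongrightarrow> 0))"

definition Bochner_L2 :: "real \<Rightarrow> 'x::minus set \<Rightarrow> ('x \<Rightarrow> real) \<Rightarrow> (real \<Rightarrow> 'x) set" where
  "Bochner_L2 T X N = {g. strongly_measurable T X N g \<and>
     integrable (lebesgue_on {0<..<T}) (\<lambda>t. (N (g t))\<^sup>2)}"

text \<open>The weak time derivative \<open>g'\<close> of \<open>g\<close>, where \<open>L\<^sub>2(\<Omega>)\<close> is embedded in \<open>H\<^sup>-\<^sup>1(\<Omega>)\<close>
  by \<open>v \<mapsto> \<langle>v, \<cdot>\<rangle>\<close>: the identity \<open>\<integral> \<eta>' g = - \<integral> \<eta> g'\<close> in \<open>H\<^sup>-\<^sup>1(\<Omega>)\<close>, evaluated at \<open>\<phi>\<close>.\<close>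

definition weak_time_derivative ::
    "'a::euclidean_space set \<Rightarrow> real \<Rightarrow> (real \<Rightarrow> 'a \<Rightarrow> real) \<Rightarrow> (real \<Rightarrow> ('a \<Rightarrow> real) \<Rightarrow> real) \<Rightarrow> bool" where
  "weak_time_derivative \<Omega> T g g' \<longleftrightarrow> (\<forall>\<eta>\<in>test_functions {0<..<T}. \<forall>\<phi>\<in>H10 \<Omega>.
     (LINT t|lebesgue_on {0<..<T}. deriv \<eta> t * L2_inner \<Omega> (g t) \<phi>)
       = - (LINT t|lebesgue_on {0<..<T}. \<eta> t * g' t \<phi>))"

definition continuous_L2 ::
    "'a::euclidean_space set \<Rightarrow> real \<Rightarrow> (real \<Rightarrow> 'a \<Rightarrow> real) \<Rightarrow> bool" where
  "continuous_L2 \<Omega> T g \<longleftrightarrow> (\<forall>t\<in>{0..T}. g t \<in> L2 \<Omega> \<and>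
     ((\<lambda>s. L2_norm \<Omega> (g s - g t)) \<longlongrightarrow> 0) (at t within {0..T}))"

text \<open>As usual, \<open>u\<close> is the representative that is continuous on \<open>[0,T]\<close> with values in
  \<open>L\<^sub>2(\<Omega>)\<close>; this is what gives a meaning to \<open>u(0) = u\<^sub>0\<close> and to \<open>u(t)\<close> for every \<open>t\<close>.\<close>

definition heat_solution ::
    "'a::euclidean_space set \<Rightarrow> real \<Rightarrow> ('a \<Rightarrow> real) \<Rightarrow> (real \<Rightarrow> 'a \<Rightarrow> real) \<Rightarrow> (real \<Rightarrow> 'a \<Rightarrow> real) \<Rightarrow> bool"
  where
  "heat_solution \<Omega> T u0 f u \<longleftrightarrow>
     u \<in> Bochner_L2 T (H10 \<Omega>) (H1_norm \<Omega>) \<and>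
     continuous_L2 \<Omega> T u \<and>
     (AE x in lebesgue_on \<Omega>. u 0 x = u0 x) \<and>
     (\<exists>u'\<in>Bochner_L2 T (Hm1 \<Omega>) (Hm1_norm \<Omega>). weak_time_derivative \<Omega> T u u' \<and>
       (AE t in lebesgue_on {0<..<T}. \<forall>\<phi>\<in>H10 \<Omega>.
          u' t \<phi> + energy \<Omega> (u t) \<phi> = L2_inner \<Omega> (f t) \<phi>))"

definition polyhedral_domain :: "'a::euclidean_space set \<Rightarrow> bool" where
  "polyhedral_domain \<Omega> \<longleftrightarrow> connected \<Omega> \<and> \<Omega> \<noteq> {} \<and>
     (\<exists>F. finite F \<and> (\<forall>P\<in>F. polytope P) \<and> \<Omega> = interior (\<Union>F))"

text \<open>Conformity, i.e. that any two simplices meet in a common face, is part of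
  \<^const>\<open>triangulation\<close>.\<close>

definition conforming_triangulation ::
    "'a::euclidean_space set \<Rightarrow> 'a set set \<Rightarrow> bool" where
  "conforming_triangulation \<Omega> \<T> \<longleftrightarrow> triangulation \<T> \<and>
     (\<forall>K\<in>\<T>. int DIM('a) simplex K) \<and> \<Union>\<T> = closure \<Omega>"

definition polynomials :: "nat \<Rightarrow> ('a::euclidean_space \<Rightarrow> real) set" where
  "polynomials p = {q. \<exists>c. \<forall>x. q x =
     (\<Sum>\<alpha> | \<alpha> \<in> Basis \<rightarrow>\<^sub>E (UNIV :: nat set) \<and> (\<Sum>b\<in>Basis. \<alpha> b) \<le> p. c \<alpha> * (\<Prod>b\<in>Basis. (x \<bullet> b) ^ \<alpha> b))}"

definition fe_space ::
    "'a::euclidean_space set \<Rightarrow> 'a set set \<Rightarrow> nat \<Rightarrow> ('a \<Rightarrow> real) set" where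
  "fe_space \<Omega> \<T> p = {\<Phi> \<in> H10 \<Omega>. \<forall>K\<in>\<T>. \<exists>q\<in>polynomials p.
     AE x in lebesgue_on \<Omega>. x \<in> K \<longrightarrow> \<Phi> x = q x}"

text \<open>The time derivative of the semidiscrete solution is the weak one, with values in the
  finite-dimensional space \<open>V\<close>; since \<open>f\<close> is only square integrable in time, the equation
  holds for a.e. time.\<close>

definition semidiscrete_solution ::
    "'a::euclidean_space set \<Rightarrow> real \<Rightarrow> ('a \<Rightarrow> real) set \<Rightarrow> ('a \<Rightarrow> real) \<Rightarrow>
      (real \<Rightarrow> 'a \<Rightarrow> real) \<Rightarrow> (real \<Rightarrow> 'a \<Rightarrow> real) \<Rightarrow> bool" where
  "semidiscrete_solution \<Omega> T V U0 f U \<longleftrightarrow>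
     (\<forall>t\<in>{0..T}. U t \<in> V) \<and>
     continuous_L2 \<Omega> T U \<and>
     (AE x in lebesgue_on \<Omega>. U 0 x = U0 x) \<and>
     (\<exists>U'\<in>Bochner_L2 T V (L2_norm \<Omega>). weak_time_derivative \<Omega> T U (\<lambda>t. L2_inner \<Omega> (U' t)) \<and>
       (AE t in lebesgue_on {0<..<T}. \<forall>\<Phi>\<in>V.
          L2_inner \<Omega> (U' t) \<Phi> + energy \<Omega> (U t) \<Phi> = L2_inner \<Omega> (f t) \<Phi>))"

text \<open>The following operators are determined by their defining equations only up to equality
  a.e. on \<open>\<Omega>\<close>, hence they are specified by predicates.\<close>

definition discrete_laplacian ::
    "'a::euclidean_space set \<Rightarrow> ('a \<Rightarrow> real) set \<Rightarrow> (('a \<Rightarrow> real) \<Rightarrow> 'a \<Rightarrow> real) \<Rightarrow> bool" where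
  "discrete_laplacian \<Omega> V A \<longleftrightarrow>
     (\<forall>W\<in>V. A W \<in> V \<and> (\<forall>\<Phi>\<in>V. L2_inner \<Omega> (A W) \<Phi> = energy \<Omega> W \<Phi>))"

definition L2_projection ::
    "'a::euclidean_space set \<Rightarrow> ('a \<Rightarrow> real) set \<Rightarrow> (('a \<Rightarrow> real) \<Rightarrow> 'a \<Rightarrow> real) \<Rightarrow> bool" where
  "L2_projection \<Omega> V P \<longleftrightarrow>
     (\<forall>v\<in>L2 \<Omega>. P v \<in> V \<and> (\<forall>\<Phi>\<in>V. L2_inner \<Omega> (P v) \<Phi> = L2_inner \<Omega> v \<Phi>))"

definition elliptic_reconstruction ::
    "'a::euclidean_space set \<Rightarrow> ('a \<Rightarrow> real) set \<Rightarrow> (('a \<Rightarrow> real) \<Rightarrow> 'a \<Rightarrow> real) \<Rightarrow>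
      (('a \<Rightarrow> real) \<Rightarrow> 'a \<Rightarrow> real) \<Rightarrow> bool" where
  "elliptic_reconstruction \<Omega> V A R \<longleftrightarrow>
     (\<forall>W\<in>V. R W \<in> H10 \<Omega> \<and> (\<forall>\<phi>\<in>H10 \<Omega>. energy \<Omega> (R W) \<phi> = L2_inner \<Omega> (A W) \<phi>))"

end

theory Submission
  imports Defs
begin

text \<open>With the discrete Laplacian, the scheme holds against every test function in the form
  \<open>\<langle>\<partial>\<^sub>t U, \<phi>\<rangle> + a(\<omega>, \<phi>) = \<langle>P\<^sub>0 f, \<phi>\<rangle>\<close>; subtracting the heat equation gives
  \<open>\<langle>\<partial>\<^sub>t e, \<phi>\<rangle> = q(\<phi>) := \<langle>P\<^sub>0 f - f, \<phi>\<rangle> - a(\<epsilon> + e, \<phi>)\<close>, and the choice \<open>\<phi> = e\<close> yields the estimate.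
  What needs a proof is that \<open>\<parallel>e\<parallel>\<^sup>2\<close> grows at most by the integral of \<open>2 q(e)\<close>. For fixed \<open>\<phi>\<close>, the scalar function
  \<open>\<langle>e, \<phi>\<rangle>\<close> is the integral of \<open>q(\<phi>)\<close>. Taking \<open>\<phi> = e(t)\<close>, convexity gives for almost every \<open>t\<close>
  and every \<open>h > 0\<close> that
  \<open>\<parallel>e(t)\<parallel>\<^sup>2 - \<parallel>e(t - h)\<parallel>\<^sup>2 \<le> 2 \<langle>e(t) - e(t - h), e(t)\<rangle> = 2 \<integral> q\<^sub>r(e(t)) dr\<close>,
  the integral being over \<open>[t - h, t]\<close>. Divide by \<open>h\<close>, integrate over \<open>t\<close> and let \<open>h\<close> tend to 0:
  the left-hand side telescopes because \<open>\<parallel>e\<parallel>\<^sup>2\<close> is continuous, and the right-hand side is handled by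
  Lebesgue differentiation and dominated convergence. Only scalar integrals occur.\<close>

section \<open>Smooth functions, bump functions and the du Bois-Reymond lemma\<close>

text \<open>Three obstacles shape the proof. The Lebesgue points of \<open>q r v\<close> depend on
  \<open>v\<close>, while the test function \<open>e t\<close> moves with t; so differentiation is
  used only for v in a countable set, the values of the simple functions approximating e, and
  \<open>e t\<close> is replaced by a nearby value at a cost controlled by
  \<open>\<gamma> r\<close>. The averages over [t - h, t] that bound the difference quotients come
  with no integrable majorant uniform in h; so they are absorbed into a primitive, the remaining
  integrand is nonnegative, and a Fatou argument with one-sided limits suffices. Finally,
  \<open>A\<close>, \<open>P0\<close> and \<open>R\<close> are given by equations up to null sets
  and need not be linear as maps of functions; so regularity in time of the reconstruction and of
  \<open>P0 (f t)\<close> comes from estimates of differences, for \<open>R\<close> with constants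
  from a finite orthonormal family that generates \<open>V\<close> a.e. The smooth bumps and steps
  serve two ends: uniqueness of weak gradients, hence bilinearity of the energy, and the passage
  from weak time derivatives to increments of scalar functions.\<close>

lemma Ck_SucI:
  assumes "\<And>x. (\<phi> has_derivative D x) (at x)" "\<And>b. b \<in> Basis \<Longrightarrow> Ck k (\<lambda>x. D x b)"
  shows "Ck (Suc k) \<phi>"
proof -
  have "frechet_derivative \<phi> (at x) = D x" for x
    using assms(1) frechet_derivative_at by metis
  then show ?thesis
    using assms by (auto simp: differentiable_def)
qed

lemma Ck_SucD: "Ck (Suc k) \<phi> \<Longrightarrow> Ck k \<phi>"
proof (induction k arbitrary: \<phi>)
  case 0
  then show ?case
    by (auto intro!: differentiable_imp_continuous_on simp: differentiable_on_def
        intro: differentiable_at_withinI)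
qed auto

lemma Ck_has_derivative:
  "Ck (Suc k) \<phi> \<Longrightarrow> (\<phi> has_derivative frechet_derivative \<phi> (at x)) (at x)"
  by (simp add: frechet_derivative_works)

lemma Ck_const: "Ck k (\<lambda>x. c)"
  by (induction k arbitrary: c) (auto intro!: Ck_SucI[of _ "\<lambda>x y. 0"])

lemma Ck_inner: "Ck k (\<lambda>x. x \<bullet> c)"
proof (cases k)
  case (Suc n)
  have "Ck (Suc n) (\<lambda>x. x \<bullet> c)"
    by (rule Ck_SucI[of _ "\<lambda>x y. y \<bullet> c"]) (auto intro!: derivative_eq_intros Ck_const)
  with Suc show ?thesis by simp
qed (auto intro!: continuous_intros)

lemma Ck_add: "Ck k \<phi> \<Longrightarrow> Ck k \<psi> \<Longrightarrow> Ck k (\<lambda>x. \<phi> x + \<psi> x)"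
proof (induction k arbitrary: \<phi> \<psi>)
  case (Suc k)
  show ?case
  proof (rule Ck_SucI)
    show "((\<lambda>x. \<phi> x + \<psi> x) has_derivative
        (\<lambda>y. frechet_derivative \<phi> (at x) y + frechet_derivative \<psi> (at x) y)) (at x)" for x
      using Suc.prems by (intro has_derivative_add Ck_has_derivative)
  qed (use Suc in auto)
qed (auto intro: continuous_intros)

lemma Ck_mult: "Ck k \<phi> \<Longrightarrow> Ck k \<psi> \<Longrightarrow> Ck k (\<lambda>x. \<phi> x * \<psi> x)"
proof (induction k arbitrary: \<phi> \<psi>)
  case (Suc k)
  show ?case
  proof (rule Ck_SucI)
    show "((\<lambda>x. \<phi> x * \<psi> x) has_derivative
        (\<lambda>y. \<phi> x * frechet_derivative \<psi> (at x) y + frechet_derivative \<phi> (at x) y * \<psi> x)) (at x)" for x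
      using Suc.prems by (intro has_derivative_mult Ck_has_derivative)
    show "Ck k (\<lambda>x. \<phi> x * frechet_derivative \<psi> (at x) b + frechet_derivative \<phi> (at x) b * \<psi> x)"
      if "b \<in> Basis" for b
      using Suc that Ck_SucD[OF Suc.prems(1)] Ck_SucD[OF Suc.prems(2)]
      by (intro Ck_add Suc.IH) auto
  qed
qed (auto intro: continuous_intros)

lemma Ck_diff: "Ck k \<phi> \<Longrightarrow> Ck k \<psi> \<Longrightarrow> Ck k (\<lambda>x. \<phi> x - \<psi> x)"
  using Ck_add[of k \<phi> "\<lambda>x. (- 1) * \<psi> x"] Ck_mult[OF Ck_const, of k \<psi> "-1"] by simp

lemma Ck_prod: "(\<And>i. i \<in> I \<Longrightarrow> Ck k (\<phi> i)) \<Longrightarrow> Ck k (\<lambda>x. \<Prod>i\<in>I. \<phi> i x)"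
  by (induction I rule: infinite_finite_induct) (auto intro: Ck_const Ck_mult)

text \<open>The induction on k needs an outer function whose derivative is again covered by the
  hypothesis, hence a whole sequence of successive derivatives and an arbitrary index n.\<close>

lemma Ck_compose_family:
  assumes "\<And>n x. (g n has_real_derivative g (Suc n) x) (at x)"
    and "\<And>k. Ck k \<phi>"
  shows "Ck k (\<lambda>x. g n (\<phi> x))"
proof (induction k arbitrary: n)
  case 0
  have "isCont (g n) y" for y
    using assms(1) DERIV_isCont by blast
  then show ?case
    using assms(2)[of 0] by (auto intro: continuous_on_compose2 continuous_at_imp_continuous_on)
next
  case (Suc k)
  show ?case
  proof (rule Ck_SucI)
    show "((\<lambda>x. g n (\<phi> x)) has_derivative
        (\<lambda>y. frechet_derivative \<phi> (at x) y * g (Suc n) (\<phi> x))) (at x)" for x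
      using has_derivative_compose[OF Ck_has_derivative[OF assms(2)], of "g n" "(*) (g (Suc n) (\<phi> x))" x]
        assms(1) by (simp add: has_field_derivative_def mult.commute)
    show "Ck k (\<lambda>x. frechet_derivative \<phi> (at x) b * g (Suc n) (\<phi> x))" if "b \<in> Basis" for b
      using Suc assms(2)[of "Suc k"] that by (intro Ck_mult) auto
  qed
qed

section \<open>Flat functions and bump functions of boxes\<close>

definition flat :: "real poly \<Rightarrow> real \<Rightarrow> real" where
  "flat P x = (if x > 0 then poly P (1 / x) * exp (- 1 / x) else 0)"

lemma poly_times_exp_minus_tendsto_0: "((\<lambda>y::real. poly P y * exp (- y)) \<longlongrightarrow> 0) at_top"
proof -
  have "((\<lambda>y. \<Sum>i\<le>degree P. coeff P i * (y ^ i / exp y)) \<longlongrightarrow> 0) at_top"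
    by (rule tendsto_null_sum) (intro tendsto_mult_right_zero tendsto_power_div_exp_0)
  then show ?thesis
    by (simp add: poly_altdef sum_distrib_right exp_minus divide_inverse mult.assoc)
qed

text \<open>In y = 1/x the function is P(y) exp(-y), and dy/dx = -y^2, so the derivative is y^2 (P -
  P')(y) exp(-y). The classical exp(-1/x) carries a polynomial factor precisely to make the class
  closed under differentiation.\<close>

lemma flat_has_derivative:
  "(flat P has_real_derivative flat (monom 1 2 * (P - pderiv P)) x) (at x)"
proof -
  consider "x > 0" | "x < 0" | "x = 0" by linarith
  then show ?thesis
  proof cases
    case 1
    have "((\<lambda>x. poly P (1 / x) * exp (- 1 / x)) has_real_derivative
        flat (monom 1 2 * (P - pderiv P)) x) (at x)"
      using 1 unfolding flat_def
      by (auto intro!: derivative_eq_intros DERIV_chain2[OF poly_DERIV]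
          simp: poly_monom power2_eq_square field_simps)
    then show ?thesis
      by (rule has_field_derivative_transform_within_open[of _ _ _ "{0<..}"])
        (use 1 in \<open>auto simp: flat_def\<close>)
  next
    case 2
    have "((\<lambda>x. 0) has_real_derivative flat (monom 1 2 * (P - pderiv P)) x) (at x)"
      using 2 by (simp add: flat_def)
    then show ?thesis
      by (rule has_field_derivative_transform_within_open[of _ _ _ "{..<0}"])
        (use 2 in \<open>auto simp: flat_def\<close>)
  next
    case 3
    have "((\<lambda>h. flat P h / h) \<longlongrightarrow> 0) (at_right 0)"
    proof (rule Lim_transform_eventually)
      \<comment> \<open>\<open>pCons 0 P\<close> is y times P, so with y = 1/h this is the
        difference quotient of \<open>flat P\<close> at 0.\<close>
      show "((\<lambda>h. poly (pCons 0 P) (inverse h) * exp (- inverse h)) \<longlongrightarrow> 0) (at_right (0::real))"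
        by (rule filterlim_compose[OF poly_times_exp_minus_tendsto_0 filterlim_inverse_at_top_right])
      show "\<forall>\<^sub>F h in at_right 0. poly (pCons 0 P) (inverse h) * exp (- inverse h) = flat P h / h"
        using eventually_at_right_less[of 0]
        by eventually_elim (auto simp: flat_def field_simps)
    qed
    moreover have "((\<lambda>h. flat P h / h) \<longlongrightarrow> 0) (at_left 0)"
    proof (rule Lim_transform_eventually)
      show "((\<lambda>h. 0) \<longlongrightarrow> 0) (at_left (0::real))" by simp
      show "\<forall>\<^sub>F h in at_left 0. 0 = flat P h / h"
        unfolding eventually_at_filter by (auto simp: flat_def)
    qed
    ultimately have "((\<lambda>h. flat P h / h) \<longlongrightarrow> 0) (at 0)"
      by (simp add: filterlim_split_at)
    then show ?thesis
      using 3 by (simp add: DERIV_def flat_def)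
  qed
qed

lemma Ck_flat:
  assumes "\<And>k. Ck k \<phi>"
  shows "Ck k (\<lambda>x. flat P (\<phi> x))"
proof -
  define Q where "Q n = ((\<lambda>P. monom 1 2 * (P - pderiv P)) ^^ n) P" for n :: nat
  show ?thesis
    using Ck_compose_family[of "\<lambda>n. flat (Q n)" \<phi> k 0, OF _ assms] flat_has_derivative
    by (auto simp: Q_def)
qed

text \<open>For a nonempty box and n > 0, the argument of \<open>flat 1\<close> is positive exactly
  strictly between two opposite faces. The factor n sharpens the bump towards the indicator of the
  box without moving its support.\<close>

definition box_bump :: "'a::euclidean_space \<Rightarrow> 'a \<Rightarrow> nat \<Rightarrow> 'a \<Rightarrow> real" where
  "box_bump a b n x = (\<Prod>i\<in>Basis. flat 1 (real n * ((x \<bullet> i - a \<bullet> i) * (b \<bullet> i - x \<bullet> i))))"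

lemma Ck_box_bump: "Ck k (box_bump a b n)"
  unfolding box_bump_def
  by (intro Ck_prod Ck_flat Ck_mult Ck_diff Ck_inner Ck_const)

lemma box_bump_bounds: "0 \<le> box_bump a b n x" "box_bump a b n x \<le> 1"
  by (auto simp: box_bump_def flat_def intro!: prod_nonneg prod_le_1)

text \<open>Nonemptiness excludes an edge with a \<bullet> i > b \<bullet> i, for which both factors
  could be negative and their product positive.\<close>

lemma box_bump_eq_0:
  assumes "x \<notin> box a b" "box a b \<noteq> {}"
  shows "box_bump a b n x = 0"
proof -
  obtain i where i: "i \<in> Basis" "x \<bullet> i \<le> a \<bullet> i \<or> b \<bullet> i \<le> x \<bullet> i"
    using assms(1) by (auto simp: mem_box not_less)
  have "a \<bullet> i < b \<bullet> i"
    using assms(2) i(1) by (auto simp: box_ne_empty)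
  then have "(x \<bullet> i - a \<bullet> i) * (b \<bullet> i - x \<bullet> i) \<le> 0"
    using i(2) by (auto simp: mult_le_0_iff)
  then have "flat 1 (real n * ((x \<bullet> i - a \<bullet> i) * (b \<bullet> i - x \<bullet> i))) = 0"
    by (simp add: flat_def not_less mult_nonneg_nonpos)
  with i(1) show ?thesis
    by (auto simp: box_bump_def prod_zero_iff)
qed

lemma box_bump_pos:
  assumes "x \<in> box a b" "n > 0"
  shows "box_bump a b n x > 0"
  using assms by (auto simp: box_bump_def flat_def mem_box intro!: prod_pos)

text \<open>Inside the box each factor is exp(-1/(n c)) with a fixed c > 0 and tends to 1; outside,
  every member of the sequence vanishes.\<close>

lemma box_bump_tendsto:
  assumes "box a b \<noteq> {}"
  shows "(\<lambda>n. box_bump a b n x) \<longlonglongrightarrow> indicator (box a b) x"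
proof (cases "x \<in> box a b")
  case True
  have "(\<lambda>n. flat 1 (real n * ((x \<bullet> i - a \<bullet> i) * (b \<bullet> i - x \<bullet> i)))) \<longlonglongrightarrow> 1"
    if "i \<in> Basis" for i
  proof -
    define c where "c = (x \<bullet> i - a \<bullet> i) * (b \<bullet> i - x \<bullet> i)"
    have c: "c > 0" using True that by (auto simp: c_def mem_box)
    have "(\<lambda>n. exp (- (1 / c) * (1 / real n))) \<longlonglongrightarrow> exp (- (1 / c) * 0)"
      by (intro tendsto_intros lim_1_over_n)
    moreover have "\<forall>\<^sub>F n in sequentially. exp (- (1 / c) * (1 / real n)) = flat 1 (real n * c)"
      using eventually_gt_at_top[of "0::nat"] by eventually_elim (use c in \<open>auto simp: flat_def field_simps\<close>)
    ultimately show ?thesis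
      unfolding c_def[symmetric] using Lim_transform_eventually by fastforce
  qed
  then have "(\<lambda>n. box_bump a b n x) \<longlonglongrightarrow> (\<Prod>i\<in>(Basis::'a set). 1)"
    unfolding box_bump_def by (intro tendsto_prod) auto
  with True show ?thesis by simp
qed (simp add: box_bump_eq_0 assms)

section \<open>Test functions and their supports\<close>

lemma test_functionsI:
  assumes "\<And>k. Ck k \<phi>" "compact K" "K \<subseteq> \<Omega>" "\<And>x. x \<notin> K \<Longrightarrow> \<phi> x = 0"
  shows "\<phi> \<in> test_functions \<Omega>"
proof -
  have "closure {x. \<phi> x \<noteq> 0} \<subseteq> K"
    using assms by (intro closure_minimal) (auto intro: compact_imp_closed)
  moreover have "compact (closure {x. \<phi> x \<noteq> 0})"
    using calculation assms(2) by (metis closed_closure compact_Int_closed inf.absorb2)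
  ultimately show ?thesis
    using assms by (auto simp: test_functions_def)
qed

lemma box_bump_test_function:
  assumes "box a b \<noteq> {}" "cbox a b \<subseteq> \<Omega>"
  shows "box_bump a b n \<in> test_functions \<Omega>"
  using assms box_subset_cbox
  by (intro test_functionsI[of _ "cbox a b"] Ck_box_bump box_bump_eq_0) auto

text \<open>The derivative vanishes off the support because its complement is open and the function
  is constantly 0 there. One compact set serves for both, as integration by parts requires.\<close>

lemma test_functionsE:
  assumes "\<phi> \<in> test_functions \<Omega>"
  obtains K where "compact K" "K \<subseteq> \<Omega>" "\<And>x. x \<notin> K \<Longrightarrow> \<phi> x = 0"
    "\<And>x v. x \<notin> K \<Longrightarrow> frechet_derivative \<phi> (at x) v = 0"
proof
  let ?K = "closure {x. \<phi> x \<noteq> 0}"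
  show "compact ?K" "?K \<subseteq> \<Omega>"
    using assms by (auto simp: test_functions_def)
  show 0: "\<phi> x = 0" if "x \<notin> ?K" for x
    using that closure_subset[of "{x. \<phi> x \<noteq> 0}"] by auto
  show "frechet_derivative \<phi> (at x) v = 0" if "x \<notin> ?K" for x v
  proof -
    have "(\<phi> has_derivative (\<lambda>_. 0)) (at x)"
    proof (rule has_derivative_transform_within_open[OF has_derivative_const])
      show "open (- ?K)" by (intro open_Compl closed_closure)
      show "x \<in> - ?K" using that by simp
      show "0 = \<phi> y" if "y \<in> - ?K" for y using 0[of y] that by simp
    qed
    then show ?thesis
      using frechet_derivative_at by metis
  qed
qed

lemma test_function_Ck: "\<phi> \<in> test_functions \<Omega> \<Longrightarrow> Ck k \<phi>"
  by (simp add: test_functions_def)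

lemma test_function_has_derivative:
  "\<phi> \<in> test_functions \<Omega> \<Longrightarrow> (\<phi> has_derivative frechet_derivative \<phi> (at x)) (at x)"
  by (rule Ck_has_derivative[OF test_function_Ck])

lemma test_function_continuous: "\<phi> \<in> test_functions \<Omega> \<Longrightarrow> continuous_on S \<phi>"
  using test_function_Ck[of \<phi> \<Omega> 0] by (auto intro: continuous_on_subset)

lemma test_function_continuous_derivative:
  assumes "\<phi> \<in> test_functions \<Omega>" "b \<in> Basis"
  shows "continuous_on S (\<lambda>x. frechet_derivative \<phi> (at x) b)"
  using test_function_Ck[of \<phi> \<Omega> 1] assms by (auto intro: continuous_on_subset)

section \<open>Compactly supported integrands and integration by parts\<close>

lemma bounded_of_compact_support:
  fixes g :: "'a::euclidean_space \<Rightarrow> real"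
  assumes "continuous_on UNIV g" "compact K" "\<And>x. x \<notin> K \<Longrightarrow> g x = 0"
  obtains M where "M \<ge> 0" "\<And>x. \<bar>g x\<bar> \<le> M"
proof -
  have "bounded (g ` K)"
    using assms by (meson compact_continuous_image compact_imp_bounded continuous_on_subset top_greatest)
  then obtain M where "\<And>x. x \<in> K \<Longrightarrow> \<bar>g x\<bar> \<le> M"
    by (auto simp: bounded_iff)
  then have "\<bar>g x\<bar> \<le> max M 0" for x
    using assms(3)[of x] by (cases "x \<in> K") (auto simp: le_max_iff_disj)
  then show ?thesis using that[of "max M 0"] by auto
qed

lemma integrable_of_compact_support:
  fixes g :: "'a::euclidean_space \<Rightarrow> real"
  assumes "continuous_on UNIV g" "compact K" "\<And>x. x \<notin> K \<Longrightarrow> g x = 0"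
  shows "integrable lborel g"
proof -
  have "integrable lborel (\<lambda>x. indicator K x *\<^sub>R g x)"
    by (rule borel_integrable_compact) (use assms in \<open>auto intro: continuous_on_subset\<close>)
  moreover have "(\<lambda>x. indicator K x *\<^sub>R g x) = g"
    using assms(3) by (auto simp: indicator_def fun_eq_iff)
  ultimately show ?thesis by simp
qed


text \<open>By translation invariance the difference quotients of \<open>g\<close> have integral 0.\<close>

lemma integral_directional_derivative_eq_0:
  fixes g :: "'a::euclidean_space \<Rightarrow> real"
  assumes deriv: "\<And>x. (g has_derivative D x) (at x)"
    and cont: "continuous_on UNIV (\<lambda>x. D x b)" and b: "b \<in> Basis"
    and K: "compact K" "\<And>x. x \<notin> K \<Longrightarrow> g x = 0" "\<And>x. x \<notin> K \<Longrightarrow> D x b = 0"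
  shows "integral\<^sup>L lborel (\<lambda>x. D x b) = 0"
proof -
  have contg: "continuous_on UNIV g"
    using deriv has_derivative_continuous continuous_at_imp_continuous_on by blast
  obtain M where M: "M \<ge> 0" "\<And>x. \<bar>D x b\<bar> \<le> M"
    using bounded_of_compact_support[OF cont K(1,3)] by metis
  obtain r where r: "\<And>x. x \<in> K \<Longrightarrow> norm x \<le> r"
    using compact_imp_bounded[OF K(1)] by (auto simp: bounded_iff)
  define h where "h n = inverse (real (Suc n))" for n
  have h: "0 < h n" "h n \<le> 1" for n
    by (auto simp: h_def field_simps)
  have dline: "((\<lambda>t. g (x + t *\<^sub>R b)) has_real_derivative D (x + t *\<^sub>R b) b) (at t)" for x t
  proof -
    have "((\<lambda>t. g (x + t *\<^sub>R b)) has_derivative (\<lambda>s. D (x + t *\<^sub>R b) (s *\<^sub>R b))) (at t)"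
      by (rule has_derivative_compose[OF _ deriv]) (auto intro!: derivative_eq_intros)
    moreover have "D (x + t *\<^sub>R b) (s *\<^sub>R b) = D (x + t *\<^sub>R b) b * s" for s
      using linear_scale[OF has_derivative_linear[OF deriv]] by simp
    ultimately show ?thesis
      by (simp add: has_field_derivative_def)
  qed
  define s where "s n x = (g (x + h n *\<^sub>R b) - g x) / h n" for n x
  have intg: "integrable lborel g"
    by (rule integrable_of_compact_support[OF contg K(1,2)])
  have trans: "integrable lborel (\<lambda>x. g (x + c)) \<and> integral\<^sup>L lborel (\<lambda>x. g (x + c)) = integral\<^sup>L lborel g" for c
  proof -
    have [measurable]: "g \<in> borel_measurable borel"
      using contg by (rule borel_measurable_continuous_onI)
    have "integrable lborel (\<lambda>x. g (c + x))"
      using integrable_distr[of "(+) c" lborel borel g] intg by (simp add: lborel_distr_plus)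
    moreover have "integral\<^sup>L lborel (\<lambda>x. g (c + x)) = integral\<^sup>L lborel g"
      using integral_distr[of "(+) c" lborel borel g] by (simp add: lborel_distr_plus)
    ultimately show ?thesis by (simp add: add.commute)
  qed
  have "integral\<^sup>L lborel (s n) = 0" for n
    using trans[of "h n *\<^sub>R b"] intg unfolding s_def by simp
  \<comment> \<open>The mean value theorem bounds each quotient by M. Since \<open>h n\<close> \<le>
    1 and b has norm 1, all quotients vanish outside the ball of radius r + 1, which gives the
    integrable majorant.\<close>
  moreover have "(\<lambda>n. integral\<^sup>L lborel (s n)) \<longlonglongrightarrow> integral\<^sup>L lborel (\<lambda>x. D x b)"
  proof (rule integral_dominated_convergence[where w = "\<lambda>x. M * indicator (cball 0 (r + 1)) x"])
    show "(\<lambda>x. D x b) \<in> borel_measurable lborel"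
      using borel_measurable_continuous_onI[OF cont] by simp
    have [measurable]: "g \<in> borel_measurable borel"
      using contg by (rule borel_measurable_continuous_onI)
    show "s n \<in> borel_measurable lborel" for n
      unfolding s_def by measurable
    show "integrable lborel (\<lambda>x. M * indicator (cball 0 (r + 1)) x)"
      by (intro integrable_mult_right integrable_real_indicator emeasure_bounded_finite) auto
    show "AE x in lborel. (\<lambda>n. s n x) \<longlonglongrightarrow> D x b"
    proof (rule AE_I2)
      fix x
      have "((\<lambda>t. (g (x + t *\<^sub>R b) - g x) / t) \<longlongrightarrow> D x b) (at 0)"
        using dline[of x 0] by (simp add: DERIV_def)
      moreover have "filterlim h (at 0) sequentially"
        unfolding filterlim_at using h(1) LIMSEQ_inverse_real_of_nat
        by (auto simp: h_def[abs_def] intro!: always_eventually)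
      ultimately show "(\<lambda>n. s n x) \<longlonglongrightarrow> D x b"
        unfolding s_def by (rule filterlim_compose)
    qed
    show "AE x in lborel. norm (s n x) \<le> M * indicator (cball 0 (r + 1)) x" for n
    proof (rule AE_I2)
      fix x
      obtain z where z: "g (x + h n *\<^sub>R b) - g (x + 0 *\<^sub>R b) = (h n - 0) * D (x + z *\<^sub>R b) b"
        using MVT2[OF h(1)[of n], of "\<lambda>t. g (x + t *\<^sub>R b)" "\<lambda>t. D (x + t *\<^sub>R b) b"] dline by blast
      show "norm (s n x) \<le> M * indicator (cball 0 (r + 1)) x"
      proof (cases "x \<in> cball 0 (r + 1)")
        case True
        then show ?thesis
          using z M(2)[of "x + z *\<^sub>R b"] h(1)[of n] by (simp add: s_def)
      next
        case False
        have "x + t *\<^sub>R b \<notin> K" if "0 \<le> t" "t \<le> 1" for t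
        proof
          assume "x + t *\<^sub>R b \<in> K"
          then have "norm (x + t *\<^sub>R b) \<le> r" by (rule r)
          moreover have "norm x \<le> norm (x + t *\<^sub>R b) + norm (t *\<^sub>R b)"
            by (metis add_diff_cancel norm_triangle_ineq4)
          ultimately show False
            using False that b by simp
        qed
        from this[of 0] this[of "h n"] show ?thesis
          using h[of n] M(1) by (simp add: s_def K(2))
      qed
    qed
  qed
  ultimately show ?thesis
    by (simp add: LIMSEQ_const_iff)
qed

lemma integrable_lebesgue_onI:
  fixes g :: "'a::euclidean_space \<Rightarrow> real"
  assumes "integrable lebesgue g" "S \<in> sets lebesgue"
  shows "integrable (lebesgue_on S) g"
  using integrable_mult_indicator[OF assms(2,1)] assms(2) by (subst integrable_restrict_space) auto

lemma integrable_lebesgue_on_subset: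
  fixes g :: "'a::euclidean_space \<Rightarrow> 'b::euclidean_space"
  assumes "integrable (lebesgue_on S) g" "U \<subseteq> S" "U \<in> sets lebesgue" "S \<in> sets lebesgue"
  shows "integrable (lebesgue_on U) g"
proof -
  have "integrable lebesgue (\<lambda>x. indicator U x *\<^sub>R (if x \<in> S then g x else 0))"
    using assms
    by (intro integrable_mult_indicator) (auto simp: Lebesgue_Measure.integrable_restrict_UNIV)
  moreover have "(\<lambda>x. indicator U x *\<^sub>R (if x \<in> S then g x else 0)) = (\<lambda>x. if x \<in> U then g x else 0)"
    using assms(2) by (auto simp: indicator_def fun_eq_iff)
  ultimately show ?thesis
    using assms(3) by (simp add: Lebesgue_Measure.integrable_restrict_UNIV)
qed

lemma integrable_lebesgue_on_compact_support:
  fixes g :: "'a::euclidean_space \<Rightarrow> real"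
  assumes "continuous_on UNIV g" "compact K" "\<And>x. x \<notin> K \<Longrightarrow> g x = 0" "S \<in> sets lebesgue"
  shows "integrable (lebesgue_on S) g"
proof -
  have "integrable lborel g"
    by (rule integrable_of_compact_support[OF assms(1-3)])
  then have "integrable lebesgue g"
    by (simp add: integrable_completion)
  then show ?thesis
    using assms(4) by (rule integrable_lebesgue_onI)
qed

lemma integral_lebesgue_on_compact_support:
  fixes g :: "'a::euclidean_space \<Rightarrow> real"
  assumes "continuous_on UNIV g" "K \<subseteq> S" "\<And>x. x \<notin> K \<Longrightarrow> g x = 0" "S \<in> sets lebesgue"
  shows "integral\<^sup>L (lebesgue_on S) g = integral\<^sup>L lborel g"
proof -
  have "(\<lambda>x. if x \<in> S then g x else 0) = g"
    by (rule ext) (use assms(2,3) in auto)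
  then have "integral\<^sup>L (lebesgue_on S) g = integral\<^sup>L lebesgue g"
    using Lebesgue_Measure.integral_restrict_UNIV[OF assms(4), of g] by simp
  then show ?thesis
    using borel_measurable_continuous_onI[OF assms(1)] by (simp add: integral_completion)
qed

text \<open>The b-derivative of the product of \<phi> and \<psi> has integral 0 over the whole
  space; since the support of \<phi> lies in \<Omega>, integrating over \<Omega> gives the same
  value.\<close>

lemma integral_by_parts_test_functions:
  assumes "\<phi> \<in> test_functions \<Omega>" "\<psi> \<in> test_functions \<Omega>" "b \<in> Basis" "\<Omega> \<in> sets lebesgue"
  shows "L2_inner \<Omega> \<phi> (\<lambda>x. frechet_derivative \<psi> (at x) b)
    = - L2_inner \<Omega> (\<lambda>x. frechet_derivative \<phi> (at x) b) \<psi>"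
proof -
  obtain K where K: "compact K" "K \<subseteq> \<Omega>" "\<And>x. x \<notin> K \<Longrightarrow> \<phi> x = 0"
    "\<And>x v. x \<notin> K \<Longrightarrow> frechet_derivative \<phi> (at x) v = 0"
    using test_functionsE[OF assms(1)] by metis
  note cont = test_function_continuous[OF assms(1)] test_function_continuous[OF assms(2)]
    test_function_continuous_derivative[OF assms(1,3)] test_function_continuous_derivative[OF assms(2,3)]
  let ?D = "\<lambda>x. \<phi> x * frechet_derivative \<psi> (at x) b + frechet_derivative \<phi> (at x) b * \<psi> x"
  have "integral\<^sup>L lborel ?D = 0"
  proof (rule integral_directional_derivative_eq_0[of "\<lambda>x. \<phi> x * \<psi> x"
        "\<lambda>x y. \<phi> x * frechet_derivative \<psi> (at x) y + frechet_derivative \<phi> (at x) y * \<psi> x" b K])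
    show "((\<lambda>x. \<phi> x * \<psi> x) has_derivative
        (\<lambda>y. \<phi> x * frechet_derivative \<psi> (at x) y + frechet_derivative \<phi> (at x) y * \<psi> x)) (at x)" for x
      using assms by (intro has_derivative_mult test_function_has_derivative)
  qed (use K assms cont in \<open>auto intro!: continuous_intros\<close>)
  moreover have "integral\<^sup>L (lebesgue_on \<Omega>) ?D = integral\<^sup>L lborel ?D"
    using K assms cont
    by (intro integral_lebesgue_on_compact_support[of _ K]) (auto intro!: continuous_intros)
  moreover have "integral\<^sup>L (lebesgue_on \<Omega>) ?D =
      integral\<^sup>L (lebesgue_on \<Omega>) (\<lambda>x. \<phi> x * frechet_derivative \<psi> (at x) b)
      + integral\<^sup>L (lebesgue_on \<Omega>) (\<lambda>x. frechet_derivative \<phi> (at x) b * \<psi> x)"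
    using K assms cont
    by (intro Bochner_Integration.integral_add integrable_lebesgue_on_compact_support[of _ K])
      (auto intro!: continuous_intros)
  ultimately show ?thesis
    by (simp add: L2_inner_def)
qed

text \<open>Almost every point is a Lebesgue point with respect to the cubes that have it as lower
  corner, and all averages over these cubes are 0.\<close>

lemma negligible_of_integral_cbox_eq_0:
  fixes g :: "'a::euclidean_space \<Rightarrow> real"
  assumes int: "integrable (lebesgue_on (cbox a b)) g"
    and zero: "\<And>c d. cbox c d \<subseteq> cbox a b \<Longrightarrow> box c d \<noteq> {} \<Longrightarrow> integral (cbox c d) g = 0"
  shows "negligible {x \<in> cbox a b. g x \<noteq> 0}"
proof -
  \<comment> \<open>Extension by 0 gives integrals over arbitrary boxes, since the intersection of a
    box with \<open>cbox a b\<close> is again a box, possibly degenerate and then null.\<close>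
  define G where "G x = (if x \<in> cbox a b then g x else 0)" for x
  have "g integrable_on cbox a b"
    using int by (intro integrable_on_lebesgue_on) auto
  then have intG: "G integrable_on cbox c d" for c d
  proof -
    obtain c' d' where cd: "cbox a b \<inter> cbox c d = cbox c' d'"
      using Int_interval[of a b c d] by auto
    have "g integrable_on cbox c' d'"
      using \<open>g integrable_on cbox a b\<close> cd by (intro integrable_on_subcbox) auto
    then show ?thesis
      unfolding cd[symmetric] G_def[abs_def] by (subst Henstock_Kurzweil_Integration.integrable_restrict_Int)
  qed
  have 0: "integral (cbox c d) G = 0" for c d
  proof -
    obtain c' d' where cd: "cbox a b \<inter> cbox c d = cbox c' d'"
      using Int_interval[of a b c d] by auto
    have "integral (cbox c d) G = integral (cbox c' d') g"
      unfolding G_def cd[symmetric] by (rule integral_restrict_Int)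
    also have "\<dots> = 0"
    proof (cases "box c' d' = {}")
      case True
      then have "negligible (cbox c' d')" by (simp add: negligible_interval)
      then show ?thesis by (rule integral_negligible)
    next
      case False
      then show ?thesis using zero cd by (metis inf_le1)
    qed
    finally show ?thesis .
  qed
  obtain N where "negligible N" and N: "\<And>x e. x \<notin> N \<Longrightarrow> 0 < e \<Longrightarrow> \<exists>d>0. \<forall>h. 0 < h \<and> h < d \<longrightarrow>
      norm (integral (cbox x (x + h *\<^sub>R One)) G /\<^sub>R h ^ DIM('a) - G x) < e"
    using integrable_ccontinuous_explicit[OF intG] by metis
  have "G x = 0" if x: "x \<notin> N" for x
  proof (rule ccontr)
    assume "G x \<noteq> 0"
    then have "norm (G x) > 0" by simp
    from N[OF x this] obtain d where "d > 0"
      and d: "\<And>h. 0 < h \<Longrightarrow> h < d \<Longrightarrow>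
        norm (integral (cbox x (x + h *\<^sub>R One)) G /\<^sub>R h ^ DIM('a) - G x) < norm (G x)"
      by blast
    from d[of "d / 2"] \<open>d > 0\<close> show False
      by (simp add: 0)
  qed
  then have "{x \<in> cbox a b. g x \<noteq> 0} \<subseteq> N"
    unfolding G_def by force
  with \<open>negligible N\<close> show ?thesis
    by (rule negligible_subset)
qed

text \<open>Box bumps stay below 1 and converge to the indicator of the box, so dominated
  convergence turns orthogonality into vanishing integrals over boxes. As g is only locally
  integrable, the null sets are obtained box by box and joined by the local character of
  negligibility.\<close>

lemma du_Bois_Reymond:
  fixes g :: "'a::euclidean_space \<Rightarrow> real"
  assumes "open \<Omega>" and meas: "g \<in> borel_measurable (lebesgue_on \<Omega>)"
    and int: "\<And>a b. cbox a b \<subseteq> \<Omega> \<Longrightarrow> integrable (lebesgue_on (cbox a b)) g"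
    and orth: "\<And>\<phi>. \<phi> \<in> test_functions \<Omega> \<Longrightarrow> (LINT x|lebesgue_on \<Omega>. g x * \<phi> x) = 0"
  shows "AE x in lebesgue_on \<Omega>. g x = 0"
proof -
  have \<Omega>: "\<Omega> \<in> sets lebesgue" using \<open>open \<Omega>\<close> by (simp add: borel_open)
  have zero: "integral (cbox a b) g = 0" if ab: "cbox a b \<subseteq> \<Omega>" "box a b \<noteq> {}" for a b
  proof -
    have "(\<lambda>n. LINT x|lebesgue_on \<Omega>. g x * box_bump a b n x)
        \<longlonglongrightarrow> (LINT x|lebesgue_on \<Omega>. g x * indicator (box a b) x)"
    proof (rule integral_dominated_convergence[where w = "\<lambda>x. if x \<in> cbox a b then norm (g x) else 0"])
      have [measurable]: "box_bump a b n \<in> borel_measurable (lebesgue_on \<Omega>)" for n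
        using Ck_box_bump[of 0 a b n]
        by (auto intro!: continuous_imp_measurable_on_sets_lebesgue \<Omega> intro: continuous_on_subset)
      note meas[measurable]
      show "(\<lambda>x. g x * box_bump a b n x) \<in> borel_measurable (lebesgue_on \<Omega>)" for n
        by measurable
      have [measurable]: "indicat_real (box a b) \<in> borel_measurable (lebesgue_on \<Omega>)"
        by (intro measurable_restrict_space1 measurable_completion borel_measurable_indicator) auto
      show "(\<lambda>x. g x * indicator (box a b) x) \<in> borel_measurable (lebesgue_on \<Omega>)"
        by measurable
      have "integrable lebesgue (\<lambda>x. if x \<in> cbox a b then norm (g x) else 0)"
        using int[OF ab(1)]
        by (subst Lebesgue_Measure.integrable_restrict_UNIV) auto
      then show "integrable (lebesgue_on \<Omega>) (\<lambda>x. if x \<in> cbox a b then norm (g x) else 0)"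
        using \<Omega> by (rule integrable_lebesgue_onI)
      show "AE x in lebesgue_on \<Omega>. (\<lambda>n. g x * box_bump a b n x) \<longlonglongrightarrow> g x * indicator (box a b) x"
        by (intro AE_I2 tendsto_intros box_bump_tendsto ab)
      show "AE x in lebesgue_on \<Omega>. norm (g x * box_bump a b n x)
          \<le> (if x \<in> cbox a b then norm (g x) else 0)" for n
      proof (rule AE_I2)
        fix x
        have "x \<notin> box a b" if "x \<notin> cbox a b"
          using that box_subset_cbox by blast
        then show "norm (g x * box_bump a b n x) \<le> (if x \<in> cbox a b then norm (g x) else 0)"
          using box_bump_bounds[of a b n x] box_bump_eq_0[of x a b n] ab(2)
          by (auto simp: abs_mult intro: mult_left_le)
      qed
    qed
    then have "(LINT x|lebesgue_on \<Omega>. g x * indicator (box a b) x) = 0"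
      using orth[OF box_bump_test_function[OF ab(2,1)]] by (simp add: LIMSEQ_const_iff)
    moreover have "(LINT x|lebesgue_on \<Omega>. g x * indicator (box a b) x)
        = (LINT x|lebesgue_on \<Omega>. (if x \<in> box a b then g x else 0))"
      by (rule Bochner_Integration.integral_cong) (auto simp: indicator_def)
    moreover have "\<dots> = integral\<^sup>L (lebesgue_on (box a b)) g"
      using ab(1) box_subset_cbox[of a b] by (intro Lebesgue_Measure.integral_restrict \<Omega>) auto
    moreover have "integrable (lebesgue_on (box a b)) g"
      using int[OF ab(1)] box_subset_cbox[of a b]
      by (rule integrable_lebesgue_on_subset) auto
    then have "integral\<^sup>L (lebesgue_on (box a b)) g = integral (box a b) g"
      by (intro lebesgue_integral_eq_integral) auto
    ultimately show ?thesis
      by (simp add: integral_open_interval)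
  qed
  have "negligible {x \<in> \<Omega>. g x \<noteq> 0}"
  proof (rule iffD2[OF locally_negligible_alt], rule ballI)
    fix x assume x: "x \<in> {x \<in> \<Omega>. g x \<noteq> 0}"
    then have "x \<in> \<Omega>" by simp
    obtain a b where ab: "cbox a b \<subseteq> \<Omega>" "x \<in> box a b"
      by (rule open_contains_cbox[OF \<open>open \<Omega>\<close> \<open>x \<in> \<Omega>\<close>])
    have "negligible {x \<in> cbox a b. g x \<noteq> 0}"
      by (rule negligible_of_integral_cbox_eq_0[OF int[OF ab(1)] zero]) (use ab(1) in auto)
    then have "negligible ({x \<in> \<Omega>. g x \<noteq> 0} \<inter> box a b)"
      by (rule negligible_subset) (use box_subset_cbox in blast)
    then show "\<exists>U. openin (top_of_set {x \<in> \<Omega>. g x \<noteq> 0}) U \<and> x \<in> U \<and> negligible U"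
      using x ab(2) by (intro exI[of _ "{x \<in> \<Omega>. g x \<noteq> 0} \<inter> box a b"]) (auto simp: openin_open_Int)
  qed
  then have "AE x in lebesgue. x \<notin> {x \<in> \<Omega>. g x \<noteq> 0}"
    by (intro AE_not_in) (simp add: negligible_iff_null_sets)
  then show ?thesis
    using \<Omega> by (subst AE_restrict_space_iff) auto
qed

section \<open>Square integrable functions\<close>

text \<open>One source for the inequalities of the L2, energy and H1 forms. The form is only
  semidefinite, because functions equal a.e. on \<Omega> remain distinct elements. Symmetry and
  nonnegativity are demanded of all functions; they hold there because an integral that does not
  exist has the value 0.\<close>

locale semi_inner =
  fixes S :: "('x \<Rightarrow> real) set" and B :: "('x \<Rightarrow> real) \<Rightarrow> ('x \<Rightarrow> real) \<Rightarrow> real"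
    and N :: "('x \<Rightarrow> real) \<Rightarrow> real"
  assumes add_closed: "v \<in> S \<Longrightarrow> w \<in> S \<Longrightarrow> (\<lambda>x. v x + w x) \<in> S"
    and scale_closed: "v \<in> S \<Longrightarrow> (\<lambda>x. c * v x) \<in> S"
    and sym: "B v w = B w v"
    and add_left: "v \<in> S \<Longrightarrow> w \<in> S \<Longrightarrow> z \<in> S \<Longrightarrow> B (\<lambda>x. v x + w x) z = B v z + B w z"
    and scale_left: "v \<in> S \<Longrightarrow> w \<in> S \<Longrightarrow> B (\<lambda>x. c * v x) w = c * B v w"
    and nonneg: "0 \<le> B v v"
    and norm_eq: "N v = sqrt (B v v)"
begin

lemma diff_eq: "(\<lambda>x. v x - w x) = (\<lambda>x. v x + (- 1) * w x)" for v w :: "'x \<Rightarrow> real"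
  by simp

lemma diff_closed: "v \<in> S \<Longrightarrow> w \<in> S \<Longrightarrow> (\<lambda>x. v x - w x) \<in> S"
  unfolding diff_eq by (intro add_closed scale_closed)

lemma add_right: "v \<in> S \<Longrightarrow> w \<in> S \<Longrightarrow> z \<in> S \<Longrightarrow> B z (\<lambda>x. v x + w x) = B z v + B z w"
  by (simp add: add_left sym[of z])

lemma scale_right: "v \<in> S \<Longrightarrow> w \<in> S \<Longrightarrow> B w (\<lambda>x. c * v x) = c * B w v"
  by (simp add: scale_left sym[of w])

lemma diff_left: "v \<in> S \<Longrightarrow> w \<in> S \<Longrightarrow> z \<in> S \<Longrightarrow> B (\<lambda>x. v x - w x) z = B v z - B w z"
  unfolding diff_eq by (simp only: add_left scale_left scale_closed)

lemma diff_right: "v \<in> S \<Longrightarrow> w \<in> S \<Longrightarrow> z \<in> S \<Longrightarrow> B z (\<lambda>x. v x - w x) = B z v - B z w"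
  by (simp add: diff_left sym[of z])

lemma norm_nonneg: "0 \<le> N v"
  by (simp add: norm_eq nonneg)

lemma norm_sq: "(N v)\<^sup>2 = B v v"
  by (simp add: norm_eq nonneg)

lemma norm_sq_add:
  "v \<in> S \<Longrightarrow> w \<in> S \<Longrightarrow> (N (\<lambda>x. v x + w x))\<^sup>2 = (N v)\<^sup>2 + 2 * B v w + (N w)\<^sup>2"
  by (simp add: norm_sq add_left add_right add_closed sym[of w v])

lemma norm_scale: "v \<in> S \<Longrightarrow> N (\<lambda>x. c * v x) = \<bar>c\<bar> * N v"
  by (simp add: norm_eq scale_left scale_right scale_closed real_sqrt_mult flip: power2_eq_square mult.assoc)

lemma norm_minus_commute: "v \<in> S \<Longrightarrow> w \<in> S \<Longrightarrow> N (\<lambda>x. v x - w x) = N (\<lambda>x. w x - v x)"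
  using norm_scale[OF diff_closed, of w v "-1"] by simp

text \<open>The discriminant argument, with the case N w = 0 treated apart, since the form may
  degenerate on nonzero functions.\<close>

lemma Cauchy_Schwarz:
  assumes "v \<in> S" "w \<in> S"
  shows "\<bar>B v w\<bar> \<le> N v * N w"
proof -
  have quad: "0 \<le> (N v)\<^sup>2 + 2 * (c * B v w) + c\<^sup>2 * (N w)\<^sup>2" for c
  proof -
    have "(N (\<lambda>x. v x + c * w x))\<^sup>2 = (N v)\<^sup>2 + 2 * (c * B v w) + c\<^sup>2 * (N w)\<^sup>2"
      by (simp add: norm_sq_add assms scale_closed scale_right norm_scale power_mult_distrib)
    then show ?thesis by (metis zero_le_power2)
  qed
  have "(B v w)\<^sup>2 \<le> (N v)\<^sup>2 * (N w)\<^sup>2"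
  proof (cases "N w = 0")
    case True
    have "B v w = 0"
    proof (rule ccontr)
      assume "B v w \<noteq> 0"
      \<comment> \<open>This value of c makes the right-hand side of \<open>quad\<close> equal to
        -1.\<close>
      then show False
        using quad[of "- ((N v)\<^sup>2 + 1) / (2 * B v w)"] True by (simp add: field_simps)
    qed
    then show ?thesis by simp
  next
    case False
    \<comment> \<open>The minimiser c = - B v w / (N w)^2 of the quadratic is inserted, and the
      result is multiplied by (N w)^2.\<close>
    have "0 \<le> ((N v)\<^sup>2 + 2 * (- B v w / (N w)\<^sup>2 * B v w) + (- B v w / (N w)\<^sup>2)\<^sup>2 * (N w)\<^sup>2) * (N w)\<^sup>2"
      by (intro mult_nonneg_nonneg quad) auto
    also have "\<dots> = (N v)\<^sup>2 * (N w)\<^sup>2 - (B v w)\<^sup>2"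
      using False by (simp add: field_simps power2_eq_square)
    finally show ?thesis by simp
  qed
  then have "(B v w)\<^sup>2 \<le> (N v * N w)\<^sup>2"
    by (simp add: power_mult_distrib)
  then show ?thesis
    using abs_le_square_iff[of "B v w" "N v * N w"] norm_nonneg by simp
qed

lemma norm_triangle:
  assumes "v \<in> S" "w \<in> S"
  shows "N (\<lambda>x. v x + w x) \<le> N v + N w"
proof (rule power2_le_imp_le)
  show "(N (\<lambda>x. v x + w x))\<^sup>2 \<le> (N v + N w)\<^sup>2"
    using Cauchy_Schwarz[OF assms] by (simp add: norm_sq_add assms power2_sum)
qed (simp add: norm_nonneg)

lemma norm_triangle_diff:
  assumes "v \<in> S" "w \<in> S"
  shows "N (\<lambda>x. v x - w x) \<le> N v + N w"
  using norm_triangle[OF assms(1) scale_closed[OF assms(2)], of "-1"] norm_scale[OF assms(2), of "-1"]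
  by simp

lemma norm_le_norm_diff:
  assumes "v \<in> S" "w \<in> S"
  shows "\<bar>N v - N w\<bar> \<le> N (\<lambda>x. v x - w x)"
proof -
  have "N v \<le> N (\<lambda>x. v x - w x) + N w"
    using norm_triangle[OF diff_closed[OF assms] assms(2)] by simp
  moreover have "N w \<le> N (\<lambda>x. w x - v x) + N v"
    using norm_triangle[OF diff_closed[OF assms(2,1)] assms(1)] by simp
  ultimately show ?thesis
    using norm_minus_commute[OF assms] by simp
qed

text \<open>\<open>N w'\<close> is replaced by \<open>N w + N (\<lambda>x. w x - w' x)\<close>, so
  that the bound mentions only v, w and the distances to them. This is the form in which
  \<open>inner_tendsto\<close> lets v' and w' converge.\<close>

lemma inner_diff_le:
  assumes "v \<in> S" "w \<in> S" "v' \<in> S" "w' \<in> S"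
  shows "\<bar>B v w - B v' w'\<bar>
    \<le> N (\<lambda>x. v x - v' x) * (N w + N (\<lambda>x. w x - w' x)) + N v * N (\<lambda>x. w x - w' x)"
proof -
  have "B v w - B v' w' = B (\<lambda>x. v x - v' x) w' + B v (\<lambda>x. w x - w' x)"
    using assms by (simp add: diff_left diff_right diff_closed)
  also have "\<bar>\<dots>\<bar> \<le> N (\<lambda>x. v x - v' x) * N w' + N v * N (\<lambda>x. w x - w' x)"
    using Cauchy_Schwarz[of "\<lambda>x. v x - v' x" w'] Cauchy_Schwarz[of v "\<lambda>x. w x - w' x"] assms
    by (intro abs_triangle_ineq[THEN order_trans] add_mono) (auto intro: diff_closed)
  also have "\<dots> \<le> N (\<lambda>x. v x - v' x) * (N w + N (\<lambda>x. w x - w' x)) + N v * N (\<lambda>x. w x - w' x)"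
    using norm_le_norm_diff[of w w'] assms
    by (intro add_right_mono mult_left_mono norm_nonneg) auto
  finally show ?thesis .
qed

lemma sum_closed:
  assumes "S \<noteq> {}" "finite I" "\<And>i. i \<in> I \<Longrightarrow> v i \<in> S"
  shows "(\<lambda>x. \<Sum>i\<in>I. c i * v i x) \<in> S"
proof -
  obtain z where "z \<in> S" using assms(1) by blast
  from scale_closed[OF this, of 0] have "(\<lambda>x. 0) \<in> S" by simp
  with assms(2,3) show ?thesis
  proof (induction I)
    case (insert i I)
    have "(\<lambda>x. c i * v i x + (\<Sum>j\<in>I. c j * v j x)) \<in> S"
      using insert by (intro add_closed scale_closed) auto
    with insert show ?case by simp
  qed simp
qed

lemma sum_left:
  assumes "S \<noteq> {}" "finite I" "\<And>i. i \<in> I \<Longrightarrow> v i \<in> S" "w \<in> S"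
  shows "B (\<lambda>x. \<Sum>i\<in>I. c i * v i x) w = (\<Sum>i\<in>I. c i * B (v i) w)"
  using assms(2,3)
proof (induction I)
  case empty
  show ?case using scale_left[OF assms(4,4), of 0] by simp
next
  case (insert i I)
  then show ?case
    using assms(1,4) by (simp add: add_left scale_left scale_closed sum_closed)
qed

lemma norm_sum_le:
  assumes "S \<noteq> {}" "finite I" "\<And>i. i \<in> I \<Longrightarrow> v i \<in> S"
  shows "N (\<lambda>x. \<Sum>i\<in>I. c i * v i x) \<le> (\<Sum>i\<in>I. \<bar>c i\<bar> * N (v i))"
  using assms(2,3)
proof (induction I)
  case empty
  obtain z where "z \<in> S" using assms(1) by blast
  with norm_scale[OF this, of 0] show ?case by simp
next
  case (insert i I)
  have "N (\<lambda>x. c i * v i x + (\<Sum>j\<in>I. c j * v j x))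
      \<le> N (\<lambda>x. c i * v i x) + N (\<lambda>x. \<Sum>j\<in>I. c j * v j x)"
    using insert assms(1) by (intro norm_triangle scale_closed sum_closed) auto
  with insert show ?case by (simp add: norm_scale)
qed

end

section \<open>Square integrable functions with values in a Euclidean space\<close>

lemma L2_D:
  assumes "v \<in> L2 \<Omega>"
  shows "v \<in> borel_measurable (lebesgue_on \<Omega>)" "integrable (lebesgue_on \<Omega>) (\<lambda>x. (norm (v x))\<^sup>2)"
  using assms by (auto simp: L2_def)

lemma L2_integrable_inner:
  fixes v w :: "'a::euclidean_space \<Rightarrow> 'b::euclidean_space"
  assumes "v \<in> L2 \<Omega>" "w \<in> L2 \<Omega>"
  shows "integrable (lebesgue_on \<Omega>) (\<lambda>x. v x \<bullet> w x)"
proof (rule Bochner_Integration.integrable_bound)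
  note [measurable] = L2_D(1)[OF assms(1)] L2_D(1)[OF assms(2)]
  show "integrable (lebesgue_on \<Omega>) (\<lambda>x. (norm (v x))\<^sup>2 + (norm (w x))\<^sup>2)"
    using assms by (intro Bochner_Integration.integrable_add L2_D)
  show "(\<lambda>x. v x \<bullet> w x) \<in> borel_measurable (lebesgue_on \<Omega>)"
    by measurable
  have "norm (v x \<bullet> w x) \<le> norm ((norm (v x))\<^sup>2 + (norm (w x))\<^sup>2)" for x
  proof -
    have "2 * (norm (v x) * norm (w x)) \<le> (norm (v x))\<^sup>2 + (norm (w x))\<^sup>2"
      using sum_squares_bound[of "norm (v x)" "norm (w x)"] by simp
    moreover have "0 \<le> norm (v x) * norm (w x)" by simp
    ultimately show ?thesis
      using Cauchy_Schwarz_ineq2[of "v x" "w x"] by simp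
  qed
  then show "AE x in lebesgue_on \<Omega>. norm (v x \<bullet> w x) \<le> norm ((norm (v x))\<^sup>2 + (norm (w x))\<^sup>2)"
    by simp
qed

lemma L2_scaleR:
  assumes "v \<in> L2 \<Omega>" shows "(\<lambda>x. c *\<^sub>R v x) \<in> L2 \<Omega>"
  using assms by (auto simp: L2_def power_mult_distrib)

lemma L2_add:
  fixes v w :: "'a::euclidean_space \<Rightarrow> 'b::euclidean_space"
  assumes "v \<in> L2 \<Omega>" "w \<in> L2 \<Omega>" shows "(\<lambda>x. v x + w x) \<in> L2 \<Omega>"
proof -
  have "(norm (v x + w x))\<^sup>2 = (norm (v x))\<^sup>2 + (norm (w x))\<^sup>2 + 2 * (v x \<bullet> w x)" for x
    by (simp add: power2_norm_eq_inner inner_add inner_commute)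
  then show ?thesis
    using assms L2_integrable_inner[OF assms] by (auto simp: L2_def)
qed

lemma L2_diff:
  fixes v w :: "'a::euclidean_space \<Rightarrow> 'b::euclidean_space"
  assumes "v \<in> L2 \<Omega>" "w \<in> L2 \<Omega>" shows "(\<lambda>x. v x - w x) \<in> L2 \<Omega>"
  using L2_add[OF assms(1) L2_scaleR[OF assms(2), of "-1"]] by simp

lemma L2_mult: "v \<in> L2 \<Omega> \<Longrightarrow> (\<lambda>x. c * v x :: real) \<in> L2 \<Omega>"
  using L2_scaleR[of v \<Omega> c] by simp

lemma L2_component:
  assumes "v \<in> L2 \<Omega>" "b \<in> Basis" shows "(\<lambda>x. v x \<bullet> b) \<in> L2 \<Omega>"
proof -
  note [measurable] = L2_D(1)[OF assms(1)]
  have "integrable (lebesgue_on \<Omega>) (\<lambda>x. (norm (v x \<bullet> b))\<^sup>2)"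
  proof (rule Bochner_Integration.integrable_bound[OF L2_D(2)[OF assms(1)]])
    show "(\<lambda>x. (norm (v x \<bullet> b))\<^sup>2) \<in> borel_measurable (lebesgue_on \<Omega>)" by measurable
    show "AE x in lebesgue_on \<Omega>. norm ((norm (v x \<bullet> b))\<^sup>2) \<le> norm ((norm (v x))\<^sup>2)"
      using power_mono[OF Basis_le_norm[OF assms(2)], of _ 2] by (intro AE_I2) simp
  qed
  then show ?thesis by (simp add: L2_def)
qed

lemma L2_inner_commute: "L2_inner \<Omega> v w = L2_inner \<Omega> w v"
  by (simp add: L2_inner_def inner_commute)

lemma L2_inner_nonneg: "0 \<le> L2_inner \<Omega> v v"
  by (simp add: L2_inner_def)

lemma L2_inner_add_left:
  fixes v w z :: "'a::euclidean_space \<Rightarrow> 'b::euclidean_space"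
  shows "v \<in> L2 \<Omega> \<Longrightarrow> w \<in> L2 \<Omega> \<Longrightarrow> z \<in> L2 \<Omega> \<Longrightarrow>
    L2_inner \<Omega> (\<lambda>x. v x + w x) z = L2_inner \<Omega> v z + L2_inner \<Omega> w z"
  by (simp add: L2_inner_def inner_add_left L2_integrable_inner)

lemma L2_inner_scaleR_left:
  fixes v w :: "'a::euclidean_space \<Rightarrow> 'b::euclidean_space"
  shows "L2_inner \<Omega> (\<lambda>x. c *\<^sub>R v x) w = c * L2_inner \<Omega> v w"
  by (simp add: L2_inner_def)

lemma L2_inner_cong_AE:
  fixes v w :: "'a::euclidean_space \<Rightarrow> 'b::euclidean_space"
  assumes "AE x in lebesgue_on \<Omega>. v x = v' x" "AE x in lebesgue_on \<Omega>. w x = w' x"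
    and "v \<in> L2 \<Omega>" "v' \<in> L2 \<Omega>" "w \<in> L2 \<Omega>" "w' \<in> L2 \<Omega>"
  shows "L2_inner \<Omega> v w = L2_inner \<Omega> v' w'"
  unfolding L2_inner_def
proof (rule integral_cong_AE)
  show "AE x in lebesgue_on \<Omega>. v x \<bullet> w x = v' x \<bullet> w' x"
    using assms(1,2) by eventually_elim simp
qed (use L2_integrable_inner assms in blast)+

interpretation L2: semi_inner "L2 \<Omega> :: ('a::euclidean_space \<Rightarrow> real) set" "L2_inner \<Omega>" "L2_norm \<Omega>"
  for \<Omega>
proof
  show "L2_inner \<Omega> (\<lambda>x. c * v x) w = c * L2_inner \<Omega> v w" for c and v w :: "'a \<Rightarrow> real"
    using L2_inner_scaleR_left[of \<Omega> c v w] by simp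
qed (auto intro: L2_add L2_mult L2_inner_commute simp: L2_inner_add_left L2_inner_nonneg L2_norm_def)

lemma L2_norm_eq_0_iff:
  fixes v :: "'a::euclidean_space \<Rightarrow> real"
  assumes "v \<in> L2 \<Omega>"
  shows "L2_norm \<Omega> v = 0 \<longleftrightarrow> (AE x in lebesgue_on \<Omega>. v x = 0)"
  using L2_integrable_inner[OF assms assms] unfolding L2_norm_def L2_inner_def
  by (subst real_sqrt_eq_0_iff, subst integral_nonneg_eq_0_iff_AE) auto

section \<open>Weak gradients and Sobolev spaces\<close>

locale open_domain =
  fixes \<Omega> :: "'a::euclidean_space set"
  assumes open_domain: "open \<Omega>"
begin

lemma domain_sets [simp, measurable]: "\<Omega> \<in> sets lebesgue"
  using open_domain by (simp add: borel_open)

text \<open>The majorant 1 + |v|^2 of |v| is integrable on a box because the box has finite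
  measure.\<close>

lemma L2_local_integrable:
  assumes "v \<in> L2 \<Omega>" "cbox a b \<subseteq> \<Omega>"
  shows "integrable (lebesgue_on (cbox a b)) (v :: 'a \<Rightarrow> real)"
proof (rule Bochner_Integration.integrable_bound)
  have "integrable (lebesgue_on (cbox a b)) (\<lambda>x. (norm (v x))\<^sup>2)"
    using L2_D(2)[OF assms(1)] assms(2) by (rule integrable_lebesgue_on_subset) auto
  moreover have "integrable (lebesgue_on (cbox a b)) (\<lambda>x. 1::real)"
    by (intro finite_measure.integrable_const finite_measure_lebesgue_on) auto
  ultimately show "integrable (lebesgue_on (cbox a b)) (\<lambda>x. 1 + (norm (v x))\<^sup>2)"
    by simp
  show "v \<in> borel_measurable (lebesgue_on (cbox a b))"
    using L2_D(1)[OF assms(1)] assms(2) by (rule measurable_restrict_mono)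
  have "norm (v x) \<le> norm (1 + (norm (v x))\<^sup>2)" for x
    using sum_squares_bound[of 1 "norm (v x)"] zero_le_power2[of "v x"]
    by (simp add: abs_of_nonneg del: zero_le_power2)
  then show "AE x in lebesgue_on (cbox a b). norm (v x) \<le> norm (1 + (norm (v x))\<^sup>2)"
    by simp
qed

lemma continuous_compact_support_L2:
  fixes g :: "'a \<Rightarrow> real"
  assumes "continuous_on UNIV g" "compact K" "\<And>x. x \<notin> K \<Longrightarrow> g x = 0"
  shows "g \<in> L2 \<Omega>"
proof -
  have "g \<in> borel_measurable (lebesgue_on \<Omega>)"
    using integrable_lebesgue_on_compact_support[OF assms domain_sets] by blast
  moreover have "integrable (lebesgue_on \<Omega>) (\<lambda>x. (g x)\<^sup>2)"
    using assms
    by (intro integrable_lebesgue_on_compact_support[of _ K] domain_sets) (auto intro!: continuous_intros)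
  ultimately show ?thesis by (simp add: L2_def)
qed

lemma test_function_L2:
  assumes "\<phi> \<in> test_functions \<Omega>"
  shows "\<phi> \<in> L2 \<Omega>"
proof -
  obtain K where "compact K" "\<And>x. x \<notin> K \<Longrightarrow> \<phi> x = 0"
    using test_functionsE[OF assms] by metis
  then show ?thesis
    by (intro continuous_compact_support_L2[of _ K] test_function_continuous[OF assms]) auto
qed

lemma test_function_derivative_L2:
  assumes "\<phi> \<in> test_functions \<Omega>" "b \<in> Basis"
  shows "(\<lambda>x. frechet_derivative \<phi> (at x) b) \<in> L2 \<Omega>"
proof -
  obtain K where "compact K" "\<And>x v. x \<notin> K \<Longrightarrow> frechet_derivative \<phi> (at x) v = 0"
    using test_functionsE[OF assms(1)] by metis
  then show ?thesis
    by (intro continuous_compact_support_L2[of _ K] test_function_continuous_derivative[OF assms]) auto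
qed

lemma weak_gradient_test_function:
  assumes "\<phi> \<in> test_functions \<Omega>"
  shows "(\<lambda>x. \<Sum>b\<in>Basis. frechet_derivative \<phi> (at x) b *\<^sub>R b) \<in> L2 \<Omega>"
    "weak_gradient \<Omega> \<phi> (\<lambda>x. \<Sum>b\<in>Basis. frechet_derivative \<phi> (at x) b *\<^sub>R b)"
proof -
  let ?G = "\<lambda>x. \<Sum>b\<in>Basis. frechet_derivative \<phi> (at x) b *\<^sub>R b"
  have "?G \<in> borel_measurable (lebesgue_on \<Omega>)"
    by (intro borel_measurable_sum borel_measurable_scaleR) (auto simp: L2_D(1)[OF test_function_derivative_L2[OF assms]])
  moreover have "(norm (?G x))\<^sup>2 = (\<Sum>b\<in>Basis. (norm (frechet_derivative \<phi> (at x) b))\<^sup>2)" for x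
    unfolding power2_norm_eq_inner by (subst euclidean_inner) (simp flip: power2_eq_square)
  moreover have "integrable (lebesgue_on \<Omega>) (\<lambda>x. \<Sum>b\<in>Basis. (norm (frechet_derivative \<phi> (at x) b))\<^sup>2)"
    by (intro Bochner_Integration.integrable_sum L2_D(2) test_function_derivative_L2 assms)
  ultimately show "?G \<in> L2 \<Omega>"
    by (simp add: L2_def)
  show "weak_gradient \<Omega> \<phi> ?G"
    using assms by (auto simp: weak_gradient_def integral_by_parts_test_functions)
qed

lemma test_function_H1: "\<phi> \<in> test_functions \<Omega> \<Longrightarrow> \<phi> \<in> H1 \<Omega>"
  by (auto simp: H1_def intro: weak_gradient_test_function test_function_L2)

text \<open>Each component of G - H is orthogonal to all test functions, so the du Bois-Reymond
  lemma applies componentwise.\<close>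

lemma weak_gradient_unique:
  assumes "weak_gradient \<Omega> v G" "weak_gradient \<Omega> v H" "G \<in> L2 \<Omega>" "H \<in> L2 \<Omega>"
  shows "AE x in lebesgue_on \<Omega>. G x = H x"
proof -
  have "AE x in lebesgue_on \<Omega>. G x \<bullet> b - H x \<bullet> b = 0" if b: "b \<in> Basis" for b
  proof (rule du_Bois_Reymond[OF open_domain])
    have L2: "(\<lambda>x. G x \<bullet> b) \<in> L2 \<Omega>" "(\<lambda>x. H x \<bullet> b) \<in> L2 \<Omega>"
      using assms b by (auto intro: L2_component)
    then have diff: "(\<lambda>x. G x \<bullet> b - H x \<bullet> b) \<in> L2 \<Omega>"
      by (rule L2_diff)
    then show "(\<lambda>x. G x \<bullet> b - H x \<bullet> b) \<in> borel_measurable (lebesgue_on \<Omega>)"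
      by (rule L2_D)
    show "integrable (lebesgue_on (cbox c d)) (\<lambda>x. G x \<bullet> b - H x \<bullet> b)" if "cbox c d \<subseteq> \<Omega>" for c d
      using diff that by (rule L2_local_integrable)
    show "(LINT x|lebesgue_on \<Omega>. (G x \<bullet> b - H x \<bullet> b) * \<phi> x) = 0" if "\<phi> \<in> test_functions \<Omega>" for \<phi>
    proof -
      have "L2_inner \<Omega> (\<lambda>x. G x \<bullet> b - H x \<bullet> b) \<phi> = L2_inner \<Omega> (\<lambda>x. G x \<bullet> b) \<phi> - L2_inner \<Omega> (\<lambda>x. H x \<bullet> b) \<phi>"
        using L2 test_function_L2[OF that] by (intro L2.diff_left)
      also have "\<dots> = 0"
        using assms(1)[unfolded weak_gradient_def, rule_format, OF that b]
          assms(2)[unfolded weak_gradient_def, rule_format, OF that b] by linarith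
      finally show ?thesis by (simp add: L2_inner_def)
    qed
  qed
  then have "AE x in lebesgue_on \<Omega>. \<forall>b\<in>Basis. G x \<bullet> b - H x \<bullet> b = 0"
    by (simp add: AE_finite_all)
  then show ?thesis
    by eventually_elim (rule euclidean_eqI, simp)
qed

lemma weak_gradient_add:
  assumes "weak_gradient \<Omega> v G" "weak_gradient \<Omega> w H" "v \<in> L2 \<Omega>" "w \<in> L2 \<Omega>" "G \<in> L2 \<Omega>" "H \<in> L2 \<Omega>"
  shows "weak_gradient \<Omega> (\<lambda>x. v x + w x) (\<lambda>x. G x + H x)"
  unfolding weak_gradient_def
proof (intro ballI)
  fix \<phi> and b :: 'a assume \<phi>: "\<phi> \<in> test_functions \<Omega>" and b: "b \<in> Basis"
  have "L2_inner \<Omega> (\<lambda>x. v x + w x) (\<lambda>x. frechet_derivative \<phi> (at x) b)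
      = - L2_inner \<Omega> (\<lambda>x. G x \<bullet> b) \<phi> - L2_inner \<Omega> (\<lambda>x. H x \<bullet> b) \<phi>"
    using assms \<phi> b
    by (subst L2_inner_add_left) (auto simp: weak_gradient_def test_function_derivative_L2)
  also have "\<dots> = - L2_inner \<Omega> (\<lambda>x. (G x + H x) \<bullet> b) \<phi>"
    using assms \<phi> b unfolding inner_add_left
    by (subst L2_inner_add_left) (auto simp: L2_component test_function_L2)
  finally show "L2_inner \<Omega> (\<lambda>x. v x + w x) (\<lambda>x. frechet_derivative \<phi> (at x) b)
      = - L2_inner \<Omega> (\<lambda>x. (G x + H x) \<bullet> b) \<phi>" .
qed

lemma weak_gradient_scale:
  assumes "weak_gradient \<Omega> v G"
  shows "weak_gradient \<Omega> (\<lambda>x. c * v x) (\<lambda>x. c *\<^sub>R G x)"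
  unfolding weak_gradient_def
proof (intro ballI)
  fix \<phi> and b :: 'a assume "\<phi> \<in> test_functions \<Omega>" "b \<in> Basis"
  note assms[unfolded weak_gradient_def, rule_format, OF this]
  then show "L2_inner \<Omega> (\<lambda>x. c * v x) (\<lambda>x. frechet_derivative \<phi> (at x) b)
      = - L2_inner \<Omega> (\<lambda>x. (c *\<^sub>R G x) \<bullet> b) \<phi>"
    by (simp add: L2_inner_def mult.assoc)
qed

lemma grad:
  assumes "v \<in> H1 \<Omega>"
  shows "grad \<Omega> v \<in> L2 \<Omega>" "weak_gradient \<Omega> v (grad \<Omega> v)"
  using someI_ex[of "\<lambda>G. G \<in> L2 \<Omega> \<and> weak_gradient \<Omega> v G"] assms
  by (auto simp: H1_def grad_def)

lemma H1_L2: "v \<in> H1 \<Omega> \<Longrightarrow> v \<in> L2 \<Omega>"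
  by (simp add: H1_def)

lemma H1_I: "v \<in> L2 \<Omega> \<Longrightarrow> G \<in> L2 \<Omega> \<Longrightarrow> weak_gradient \<Omega> v G \<Longrightarrow> v \<in> H1 \<Omega>"
  by (auto simp: H1_def)

lemma H1_add:
  assumes "v \<in> H1 \<Omega>" "w \<in> H1 \<Omega>"
  shows "(\<lambda>x. v x + w x) \<in> H1 \<Omega>"
  by (rule H1_I[OF _ _ weak_gradient_add[OF grad(2)[OF assms(1)] grad(2)[OF assms(2)]]])
    (intro L2_add H1_L2 grad(1) assms)+

lemma H1_scale:
  assumes "v \<in> H1 \<Omega>"
  shows "(\<lambda>x. c * v x) \<in> H1 \<Omega>"
  by (rule H1_I[OF _ _ weak_gradient_scale[OF grad(2)[OF assms]]])
    (intro L2_mult L2_scaleR H1_L2 grad(1) assms)+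

text \<open>Uniqueness of weak gradients removes the choice made in \<open>grad\<close>. Bilinearity
  of the energy rests on this, since \<open>grad\<close> of a sum is only a.e. the sum of the
  gradients.\<close>

lemma energy_eq:
  assumes "weak_gradient \<Omega> v G" "weak_gradient \<Omega> w H" "v \<in> L2 \<Omega>" "w \<in> L2 \<Omega>" "G \<in> L2 \<Omega>" "H \<in> L2 \<Omega>"
  shows "energy \<Omega> v w = L2_inner \<Omega> G H"
proof -
  have "v \<in> H1 \<Omega>" "w \<in> H1 \<Omega>" using assms by (auto simp: H1_def)
  then show ?thesis
    unfolding energy_def using assms
    by (intro L2_inner_cong_AE weak_gradient_unique) (auto intro: grad)
qed

sublocale energy: semi_inner "H1 \<Omega>" "energy \<Omega>" "energy_norm \<Omega>"
proof
  show "energy \<Omega> (\<lambda>x. v x + w x) z = energy \<Omega> v z + energy \<Omega> w z"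
    if "v \<in> H1 \<Omega>" "w \<in> H1 \<Omega>" "z \<in> H1 \<Omega>" for v w z
  proof -
    have "energy \<Omega> (\<lambda>x. v x + w x) z = L2_inner \<Omega> (\<lambda>x. grad \<Omega> v x + grad \<Omega> w x) (grad \<Omega> z)"
      using that by (intro energy_eq weak_gradient_add) (auto intro: grad H1_L2 L2_add)
    also have "\<dots> = energy \<Omega> v z + energy \<Omega> w z"
      unfolding energy_def using that by (intro L2_inner_add_left grad)
    finally show ?thesis .
  qed
  show "energy \<Omega> (\<lambda>x. c * v x) w = c * energy \<Omega> v w"
    if "v \<in> H1 \<Omega>" "w \<in> H1 \<Omega>" for c v w
  proof -
    have "energy \<Omega> (\<lambda>x. c * v x) w = L2_inner \<Omega> (\<lambda>x. c *\<^sub>R grad \<Omega> v x) (grad \<Omega> w)"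
      using that by (intro energy_eq weak_gradient_scale) (auto intro: grad H1_L2 L2_mult L2_scaleR)
    then show ?thesis by (simp add: L2_inner_scaleR_left energy_def)
  qed
qed (auto intro: H1_add H1_scale simp: energy_def L2_inner_commute L2_inner_nonneg energy_norm_def)

sublocale H1: semi_inner "H1 \<Omega>" "\<lambda>v w. L2_inner \<Omega> v w + energy \<Omega> v w" "H1_norm \<Omega>"
proof
  show "H1_norm \<Omega> v = sqrt (L2_inner \<Omega> v v + energy \<Omega> v v)" for v
    by (simp add: H1_norm_def L2.norm_sq energy.norm_sq)
  show "L2_inner \<Omega> v w + energy \<Omega> v w = L2_inner \<Omega> w v + energy \<Omega> w v" for v w
    by (simp only: L2_inner_commute[of \<Omega> v] energy.sym[of v])
qed (auto simp: energy.add_left energy.scale_left L2.add_left L2.scale_left H1_L2 energy.nonneg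
    L2_inner_nonneg distrib_left intro: H1_add H1_scale)

lemma L2_norm_le_H1_norm: "L2_norm \<Omega> v \<le> H1_norm \<Omega> v"
  by (simp add: H1_norm_def L2.norm_nonneg)

lemma energy_norm_le_H1_norm: "energy_norm \<Omega> v \<le> H1_norm \<Omega> v"
  by (simp add: H1_norm_def energy.norm_nonneg)

section \<open>Sobolev functions with zero boundary values\<close>

lemma H10_H1: "v \<in> H10 \<Omega> \<Longrightarrow> v \<in> H1 \<Omega>"
  by (simp add: H10_def)

lemma H10_L2: "v \<in> H10 \<Omega> \<Longrightarrow> v \<in> L2 \<Omega>"
  by (simp add: H10_H1 H1_L2)

lemma zero_test_function: "(\<lambda>x. 0) \<in> test_functions \<Omega>"
  by (rule test_functionsI[of _ "{}"]) (auto intro: Ck_const)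

lemma zero_H10: "(\<lambda>x. 0) \<in> H10 \<Omega>"
proof -
  have "H1_norm \<Omega> (\<lambda>x. 0) = 0"
    using H1.norm_scale[OF test_function_H1[OF zero_test_function], of 0] by simp
  then show ?thesis
    using zero_test_function test_function_H1 by (auto simp: H10_def intro!: bexI[of _ "\<lambda>x. 0"])
qed

lemma test_function_add:
  assumes "\<phi> \<in> test_functions \<Omega>" "\<psi> \<in> test_functions \<Omega>"
  shows "(\<lambda>x. \<phi> x + \<psi> x) \<in> test_functions \<Omega>"
proof -
  obtain K L where "compact K" "K \<subseteq> \<Omega>" "\<And>x. x \<notin> K \<Longrightarrow> \<phi> x = 0"
    "compact L" "L \<subseteq> \<Omega>" "\<And>x. x \<notin> L \<Longrightarrow> \<psi> x = 0"
    using test_functionsE[OF assms(1)] test_functionsE[OF assms(2)] by metis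
  then show ?thesis
    by (intro test_functionsI[of _ "K \<union> L"] Ck_add test_function_Ck[OF assms(1)]
        test_function_Ck[OF assms(2)]) auto
qed

lemma test_function_scale: "\<phi> \<in> test_functions \<Omega> \<Longrightarrow> (\<lambda>x. c * \<phi> x) \<in> test_functions \<Omega>"
proof -
  assume \<phi>: "\<phi> \<in> test_functions \<Omega>"
  obtain K where "compact K" "K \<subseteq> \<Omega>" "\<And>x. x \<notin> K \<Longrightarrow> \<phi> x = 0"
    using test_functionsE[OF \<phi>] by metis
  then show ?thesis
    by (intro test_functionsI[of _ K] Ck_mult Ck_const test_function_Ck[OF \<phi>]) auto
qed

lemma H10_add:
  assumes "v \<in> H10 \<Omega>" "w \<in> H10 \<Omega>"
  shows "(\<lambda>x. v x + w x) \<in> H10 \<Omega>"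
proof -
  have "\<exists>\<phi>\<in>test_functions \<Omega>. H1_norm \<Omega> (\<lambda>x. (v x + w x) - \<phi> x) < \<epsilon>" if "\<epsilon> > 0" for \<epsilon>
  proof -
    obtain \<phi> \<psi> where \<phi>: "\<phi> \<in> test_functions \<Omega>" "H1_norm \<Omega> (\<lambda>x. v x - \<phi> x) < \<epsilon> / 2"
      and \<psi>: "\<psi> \<in> test_functions \<Omega>" "H1_norm \<Omega> (\<lambda>x. w x - \<psi> x) < \<epsilon> / 2"
      using assms \<open>\<epsilon> > 0\<close> by (auto simp: H10_def dest!: spec[of _ "\<epsilon> / 2"])
    have "H1_norm \<Omega> (\<lambda>x. (v x - \<phi> x) + (w x - \<psi> x))
        \<le> H1_norm \<Omega> (\<lambda>x. v x - \<phi> x) + H1_norm \<Omega> (\<lambda>x. w x - \<psi> x)"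
      using assms \<phi> \<psi> by (intro H1.norm_triangle H1.diff_closed) (auto intro: H10_H1 test_function_H1)
    also have "\<dots> < \<epsilon>"
      using \<phi> \<psi> by simp
    also have "(\<lambda>x. (v x - \<phi> x) + (w x - \<psi> x)) = (\<lambda>x. (v x + w x) - (\<phi> x + \<psi> x))"
      by (simp add: algebra_simps)
    finally show ?thesis
      using test_function_add[OF \<phi>(1) \<psi>(1)] by (intro bexI[of _ "\<lambda>x. \<phi> x + \<psi> x"])
  qed
  then show ?thesis
    using assms by (auto simp: H10_def H1_add)
qed

lemma H10_scale:
  assumes "v \<in> H10 \<Omega>"
  shows "(\<lambda>x. c * v x) \<in> H10 \<Omega>"
proof (cases "c = 0")
  case True
  then show ?thesis using zero_H10 by simp
next
  case False
  have "\<exists>\<phi>\<in>test_functions \<Omega>. H1_norm \<Omega> (\<lambda>x. c * v x - \<phi> x) < \<epsilon>" if "\<epsilon> > 0" for \<epsilon>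
  proof -
    have "\<epsilon> / \<bar>c\<bar> > 0" using False that by simp
    then obtain \<phi> where \<phi>: "\<phi> \<in> test_functions \<Omega>" "H1_norm \<Omega> (\<lambda>x. v x - \<phi> x) < \<epsilon> / \<bar>c\<bar>"
      using assms by (auto simp: H10_def)
    have "H1_norm \<Omega> (\<lambda>x. c * (v x - \<phi> x)) = \<bar>c\<bar> * H1_norm \<Omega> (\<lambda>x. v x - \<phi> x)"
      using assms \<phi> by (intro H1.norm_scale H1.diff_closed) (auto intro: H10_H1 test_function_H1)
    also have "\<dots> < \<epsilon>"
      using \<phi>(2) False by (simp add: field_simps)
    also have "(\<lambda>x. c * (v x - \<phi> x)) = (\<lambda>x. c * v x - c * \<phi> x)"
      by (simp add: algebra_simps)
    finally show ?thesis
      using test_function_scale[OF \<phi>(1)] by (intro bexI[of _ "\<lambda>x. c * \<phi> x"])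
  qed
  then show ?thesis
    using assms by (auto simp: H10_def H1_scale)
qed

lemma H10_diff: "v \<in> H10 \<Omega> \<Longrightarrow> w \<in> H10 \<Omega> \<Longrightarrow> (\<lambda>x. v x - w x) \<in> H10 \<Omega>"
  using H10_add[OF _ H10_scale[of w "-1"], of v] by simp

text \<open>The zero field is a weak gradient of a function that vanishes a.e. Expansions in
  \<open>V\<close> hold only a.e., and this carries them over to the energy and the H1 norm.\<close>

lemma norm_diff_eq_0_of_AE_eq:
  assumes "v \<in> H1 \<Omega>" "w \<in> H1 \<Omega>" "AE x in lebesgue_on \<Omega>. v x = w x"
  shows "energy_norm \<Omega> (\<lambda>x. v x - w x) = 0" "H1_norm \<Omega> (\<lambda>x. v x - w x) = 0"
proof -
  have d: "(\<lambda>x. v x - w x) \<in> L2 \<Omega>"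
    using assms by (intro L2_diff H1_L2)
  have 0: "L2_norm \<Omega> (\<lambda>x. v x - w x) = 0"
    using assms(3) d by (simp add: L2_norm_eq_0_iff)
  have "L2_inner \<Omega> (\<lambda>x. v x - w x) \<phi> = 0" if "\<phi> \<in> L2 \<Omega>" for \<phi>
    using L2.Cauchy_Schwarz[OF d that] 0 by simp
  then have "weak_gradient \<Omega> (\<lambda>x. v x - w x) (\<lambda>x. 0)"
    by (auto simp: weak_gradient_def test_function_derivative_L2 L2_inner_def)
  moreover have "(\<lambda>x. 0::'a) \<in> L2 \<Omega>" by (simp add: L2_def)
  ultimately have "energy \<Omega> (\<lambda>x. v x - w x) (\<lambda>x. v x - w x) = L2_inner \<Omega> (\<lambda>x. 0::'a) (\<lambda>x. 0)"
    using d by (intro energy_eq)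
  then show "energy_norm \<Omega> (\<lambda>x. v x - w x) = 0"
    by (simp add: energy_norm_def L2_inner_def)
  with 0 show "H1_norm \<Omega> (\<lambda>x. v x - w x) = 0"
    by (simp add: H1_norm_def)
qed

end

section \<open>Weak derivatives on an interval\<close>

text \<open>Bochner spaces and weak time derivatives live on the open interval, the integral
  estimates on closed ones; the end points are null sets.\<close>

lemma integrable_lebesgue_on_Ioo_iff:
  fixes f :: "real \<Rightarrow> real"
  shows "integrable (lebesgue_on {a<..<b}) f \<longleftrightarrow> integrable (lebesgue_on {a..b}) f"
  using absolutely_integrable_on_Icc_iff_Ioo[where f = f and a = a and b = b]
  by (simp add: set_integrable_def integrable_restrict_space)

lemma AE_lebesgue_on_Ioo_iff:
  "(AE t in lebesgue_on {a<..<b}. P t) \<longleftrightarrow> (AE t in lebesgue_on {a..b::real}. P t)"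
proof -
  have "AE t in lebesgue. t \<noteq> a" "AE t in lebesgue. t \<noteq> b"
    by (intro AE_completion AE_lborel_singleton)+
  then have "AE t in lebesgue. (t \<in> {a<..<b} \<longrightarrow> P t) \<longleftrightarrow> (t \<in> {a..b} \<longrightarrow> P t)"
    by eventually_elim auto
  then have "(AE t in lebesgue. t \<in> {a<..<b} \<longrightarrow> P t) \<longleftrightarrow> (AE t in lebesgue. t \<in> {a..b} \<longrightarrow> P t)"
    by (rule eventually_subst)
  then show ?thesis
    by (simp add: AE_restrict_space_iff)
qed

lemma integral_lebesgue_on_Ioo_eq:
  fixes f :: "real \<Rightarrow> real"
  assumes "integrable (lebesgue_on {a<..<b}) f"
  shows "integral\<^sup>L (lebesgue_on {a<..<b}) f = integral {a..b} f"
  using assms by (simp add: lebesgue_integral_eq_integral integral_open_interval_real)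

lemma integrable_on_of_lebesgue_on:
  fixes f :: "real \<Rightarrow> real"
  assumes "integrable (lebesgue_on {a..b}) f" "a \<le> c" "d \<le> b"
  shows "integrable (lebesgue_on {c..d}) f" "f integrable_on {c..d}"
    "integral\<^sup>L (lebesgue_on {c..d}) f = integral {c..d} f"
proof -
  show *: "integrable (lebesgue_on {c..d}) f"
    using assms by (intro integrable_lebesgue_on_subset[OF assms(1)]) auto
  from * show "f integrable_on {c..d}" by (rule integrable_on_lebesgue_on) auto
  from * show "integral\<^sup>L (lebesgue_on {c..d}) f = integral {c..d} f"
    by (rule lebesgue_integral_eq_integral) auto
qed

text \<open>\<open>integrable_ccontinuous_explicit\<close> concerns averages over intervals to the
  right of a point. Reflecting time turns them into averages to the left and the exceptional set
  into its mirror image.\<close>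

lemma AE_left_average_tendsto:
  fixes g :: "real \<Rightarrow> real"
  assumes "integrable lebesgue g"
  shows "AE t in lebesgue. ((\<lambda>h. integral {t - h..t} g / h) \<longlongrightarrow> g t) (at_right 0)"
proof -
  have g: "g integrable_on {c..d}" for c d
    using assms integrable_on_lebesgue integrable_on_subinterval by blast
  have "(\<lambda>x. g (- x)) integrable_on cbox c d" for c d
    using g[of "- d" "- c"] Henstock_Kurzweil_Integration.integrable_reflect_real[of g "- c" "- d"]
    by simp
  then obtain N where "negligible N" and N: "\<And>x e. x \<notin> N \<Longrightarrow> 0 < e \<Longrightarrow> \<exists>d>0. \<forall>h. 0 < h \<and> h < d \<longrightarrow>
      norm (integral (cbox x (x + h *\<^sub>R One)) (\<lambda>x. g (- x)) /\<^sub>R h ^ DIM(real) - g (- x)) < e"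
    using integrable_ccontinuous_explicit[of "\<lambda>x. g (- x)"] by metis
  have "negligible (uminus ` N)"
    using \<open>negligible N\<close>
    by (intro negligible_differentiable_image_negligible) (auto intro!: derivative_intros simp: differentiable_on_def)
  then have "AE t in lebesgue. t \<notin> uminus ` N"
    by (intro AE_not_in) (simp add: negligible_iff_null_sets)
  then show ?thesis
  proof eventually_elim
    case (elim t)
    then have "- t \<notin> N" by force
    have eq: "integral (cbox (- t) (- t + h *\<^sub>R One)) (\<lambda>x. g (- x)) /\<^sub>R h ^ DIM(real)
        = integral {t - h..t} g / h" for h
    proof -
      have "cbox (- t) (- t + h *\<^sub>R One) = {- t..- (t - h)}"
        by simp
      then show ?thesis
        by (simp only: Henstock_Kurzweil_Integration.integral_reflect_real)
          (simp add: divide_inverse)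
    qed
    show ?case
      unfolding tendsto_iff dist_norm eventually_at_right_field
    proof (intro allI impI)
      fix e :: real assume "e > 0"
      from N[OF \<open>- t \<notin> N\<close> this] show
        "\<exists>b>0. \<forall>y>0. y < b \<longrightarrow> norm (integral {t - y..t} g / y - g t) < e"
        by (simp only: eq minus_minus) blast
    qed
  qed
qed

text \<open>The normalised primitive of a bump on (s, s + d): a smoothed Heaviside function that
  rises from 0 at s to 1 at s + d. The lower limit s - 1 makes s an interior point of the range of
  integration; below s - 1 the empty interval gives the correct value 0.\<close>

definition smooth_step :: "real \<Rightarrow> real \<Rightarrow> real \<Rightarrow> real" where
  "smooth_step s d x = integral {s - 1..x} (box_bump s (s + d) 1) /
     integral {s - 1..s + d} (box_bump s (s + d) 1)"

text \<open>The derivative of \<open>smooth_step s d\<close>: a nonnegative kernel of mass 1 on (s,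
  s + d), hence an approximate Dirac mass at s for small d.\<close>

definition step_kernel :: "real \<Rightarrow> real \<Rightarrow> real \<Rightarrow> real" where
  "step_kernel s d x = box_bump s (s + d) 1 x / integral {s - 1..s + d} (box_bump s (s + d) 1)"

context
  fixes s d :: real
  assumes d: "d > 0"
begin

lemma box_bump_integral_pos: "integral {s - 1..s + d} (box_bump s (s + d) 1) > 0"
proof -
  have cont: "continuous_on {s - 1..s + d} (box_bump s (s + d) 1)"
    using Ck_box_bump[of 0 s "s + d" 1] by (auto intro: continuous_on_subset)
  have "integral {s - 1..s + d} (box_bump s (s + d) 1) \<noteq> 0"
  proof
    assume *: "integral {s - 1..s + d} (box_bump s (s + d) 1) = 0"
    have "\<forall>x\<in>{s - 1..s + d}. box_bump s (s + d) 1 x = 0"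
      by (rule iffD1[OF integral_eq_0_iff[OF cont _ box_bump_bounds(1)] *]) (use d in simp)
    then have "box_bump s (s + d) 1 (s + d / 2) = 0"
      using d by (auto dest!: bspec[of _ _ "s + d / 2"])
    with box_bump_pos[of "s + d / 2" s "s + d" 1] d show False
      by (simp add: box_real)
  qed
  moreover have "integral {s - 1..s + d} (box_bump s (s + d) 1) \<ge> 0"
    by (intro integral_nonneg integrable_continuous_real cont box_bump_bounds)
  ultimately show ?thesis by simp
qed

lemma step_kernel_nonneg: "0 \<le> step_kernel s d x"
  unfolding step_kernel_def by (intro divide_nonneg_pos box_bump_integral_pos box_bump_bounds)

lemma step_kernel_eq_0: "x \<notin> {s<..<s + d} \<Longrightarrow> step_kernel s d x = 0"
  using d box_bump_eq_0[of x s "s + d" 1] by (auto simp: step_kernel_def box_real)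

lemma Ck_step_kernel: "Ck k (step_kernel s d)"
  using Ck_mult[OF Ck_box_bump[of k s "s + d" 1] Ck_const, of "1 / integral {s - 1..s + d} (box_bump s (s + d) 1)"]
  by (simp add: step_kernel_def[abs_def])

lemma smooth_step_eq_0: "x \<le> s \<Longrightarrow> smooth_step s d x = 0"
proof -
  assume "x \<le> s"
  then have "integral {s - 1..x} (box_bump s (s + d) 1) = integral {s - 1..x} (\<lambda>_. 0)"
    using d by (intro Henstock_Kurzweil_Integration.integral_cong box_bump_eq_0) (auto simp: box_real)
  then show ?thesis by (simp add: smooth_step_def)
qed

lemma smooth_step_has_derivative:
  "(smooth_step s d has_real_derivative step_kernel s d x) (at x)"
proof (cases "x < s")
  case True
  have "((\<lambda>x. 0) has_real_derivative step_kernel s d x) (at x)"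
    using step_kernel_eq_0[of x] True by simp
  then show ?thesis
    by (rule has_field_derivative_transform_within_open[of _ _ _ "{..<s}"])
      (use True in \<open>auto simp: smooth_step_eq_0\<close>)
next
  case False
  have "continuous_on {s - 1..x + 1} (box_bump s (s + d) 1)"
    using Ck_box_bump[of 0 s "s + d" 1] by (auto intro: continuous_on_subset)
  then have "((\<lambda>x. integral {s - 1..x} (box_bump s (s + d) 1)) has_real_derivative box_bump s (s + d) 1 x)
      (at x within {s - 1..x + 1})"
    using False by (intro integral_has_real_derivative) auto
  moreover have "at x within {s - 1..x + 1} = at x"
    using False by (intro at_within_interior) auto
  ultimately show ?thesis
    unfolding smooth_step_def[abs_def] step_kernel_def by (simp add: DERIV_cdivide)
qed

lemma smooth_step_mono: "x \<le> y \<Longrightarrow> smooth_step s d x \<le> smooth_step s d y"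
  by (rule DERIV_nonneg_imp_nondecreasing[where f = "smooth_step s d"])
    (assumption, intro exI conjI, rule smooth_step_has_derivative, rule step_kernel_nonneg)

lemma smooth_step_eq_1:
  assumes "s + d \<le> x"
  shows "smooth_step s d x = 1"
proof -
  have "smooth_step s d (s + d) = 1"
    using box_bump_integral_pos by (simp add: smooth_step_def)
  moreover have "- smooth_step s d (s + d) \<le> - smooth_step s d x"
  proof (rule DERIV_nonneg_imp_nondecreasing[OF assms])
    fix y assume "s + d \<le> y"
    then show "\<exists>z. ((\<lambda>x. - smooth_step s d x) has_real_derivative z) (at y) \<and> 0 \<le> z"
      using DERIV_minus[OF smooth_step_has_derivative[of y]] step_kernel_eq_0[of y] by auto
  qed
  ultimately show ?thesis using smooth_step_mono[OF assms] by simp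
qed

lemma smooth_step_bounds: "0 \<le> smooth_step s d x" "smooth_step s d x \<le> 1"
  using smooth_step_mono[of "min x s" x] smooth_step_eq_0[of "min x s"]
    smooth_step_mono[of x "max x (s + d)"] smooth_step_eq_1[of "max x (s + d)"]
  by linarith+

lemma Ck_smooth_step: "Ck k (smooth_step s d)"
proof (rule Ck_SucD, rule Ck_SucI)
  show "(smooth_step s d has_derivative (*) (step_kernel s d x)) (at x)" for x
    using smooth_step_has_derivative by (simp add: has_field_derivative_def)
  show "Ck k (\<lambda>x. step_kernel s d x * b)" if "b \<in> Basis" for b :: real
    using that Ck_step_kernel by simp
qed

lemma step_kernel_integral:
  assumes "a \<le> s" "s + d \<le> b"
  shows "(step_kernel s d has_integral 1) {a..b}"
proof -
  have "(step_kernel s d has_integral (smooth_step s d b - smooth_step s d a)) {a..b}"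
  proof (rule fundamental_theorem_of_calculus)
    show "a \<le> b" using assms d by simp
    show "(smooth_step s d has_vector_derivative step_kernel s d x) (at x within {a..b})" for x
      by (rule has_vector_derivative_at_within,
          rule smooth_step_has_derivative[unfolded has_real_derivative_iff_has_vector_derivative])
  qed
  then show ?thesis
    using assms by (simp add: smooth_step_eq_0 smooth_step_eq_1)
qed

text \<open>The integral is a weighted mean of h over [s, s + d], as the kernel is nonnegative with
  mass 1; so it deviates from h s by at most the oscillation.\<close>

lemma step_kernel_approximates:
  assumes "a \<le> s" "s + d \<le> b" and cont: "continuous_on {a..b} h"
    and close: "\<And>x. s \<le> x \<Longrightarrow> x \<le> s + d \<Longrightarrow> \<bar>h x - h s\<bar> \<le> e"
  shows "\<bar>integral {a..b} (\<lambda>x. step_kernel s d x * h x) - h s\<bar> \<le> e"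
proof -
  have contk: "continuous_on {a..b} (step_kernel s d)"
    using Ck_step_kernel[of 0] by (auto intro: continuous_on_subset)
  have 1: "((\<lambda>x. step_kernel s d x * h x - step_kernel s d x * h s) has_integral
      (integral {a..b} (\<lambda>x. step_kernel s d x * h x) - 1 * h s)) {a..b}"
    using assms
    by (intro has_integral_diff has_integral_mult_left step_kernel_integral integrable_integral
        integrable_continuous_real continuous_intros contk cont)
  have 2: "((\<lambda>x. step_kernel s d x * e) has_integral 1 * e) {a..b}"
    using assms by (intro has_integral_mult_left step_kernel_integral)
  have 3: "norm (step_kernel s d x * h x - step_kernel s d x * h s) \<le> step_kernel s d x * e" for x
  proof (cases "x \<in> {s<..<s + d}")
    case True
    then have "step_kernel s d x * \<bar>h x - h s\<bar> \<le> step_kernel s d x * e"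
      using close by (intro mult_left_mono step_kernel_nonneg) auto
    then show ?thesis
      by (simp add: abs_mult step_kernel_nonneg flip: right_diff_distrib)
  qed (simp add: step_kernel_eq_0)
  have "norm (integral {a..b} (\<lambda>x. step_kernel s d x * h x) - 1 * h s) \<le> 1 * e"
    unfolding integral_unique[OF 1, symmetric] integral_unique[OF 2, symmetric]
    by (rule integral_norm_bound_integral[OF has_integral_integrable[OF 1] has_integral_integrable[OF 2] 3])
  then show ?thesis by simp
qed

end

text \<open>Both steps equal 0 up to s and 1 from t + d on, so they cancel outside the compact
  interval [s, t + d].\<close>

lemma step_difference_test_function:
  assumes "0 < s" "s < t" "d > 0" "t + d < T"
  shows "(\<lambda>x. smooth_step s d x - smooth_step t d x) \<in> test_functions {0<..<T}"
  using assms
  by (intro test_functionsI[of _ "{s..t + d}"] Ck_diff Ck_smooth_step)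
    (auto simp: smooth_step_eq_0 smooth_step_eq_1 not_le)

text \<open>The test function is a smooth step at s minus a smooth step at t. Its derivative is a
  difference of two kernels, whose pairings with h tend to h s - h t, while the function itself
  tends to the indicator of (s, t].\<close>

lemma weak_derivative_imp_integral:
  fixes h k :: "real \<Rightarrow> real"
  assumes cont: "continuous_on {0..T} h" and k: "integrable (lebesgue_on {0<..<T}) k"
    and weak: "\<And>\<eta>. \<eta> \<in> test_functions {0<..<T} \<Longrightarrow>
      (LINT t|lebesgue_on {0<..<T}. deriv \<eta> t * h t) = - (LINT t|lebesgue_on {0<..<T}. \<eta> t * k t)"
    and st: "0 < s" "s < t" "t < T"
  shows "h t - h s = integral {s..t} k"
proof -
  \<comment> \<open>With n + 2 in place of n + 1, already the first member satisfies t + d n < T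
    strictly.\<close>
  define d where "d n = (T - t) / real (n + 2)" for n
  have d: "d n > 0" "t + d n < T" "s + d n < T" for n
  proof -
    show "d n > 0" using st by (simp add: d_def)
    have "(T - t) / real (n + 2) < T - t"
      using st mult_strict_left_mono[of 1 "real (n + 2)" "T - t"] by (subst divide_less_eq) auto
    then show "t + d n < T" by (simp add: d_def)
    then show "s + d n < T" using st by simp
  qed
  have d0: "d \<longlonglongrightarrow> 0"
    using tendsto_mult[OF tendsto_const[of "T - t"] LIMSEQ_ignore_initial_segment[OF lim_1_over_n[where ?'a = real], of 2]]
    by (simp add: d_def[abs_def])
  have kernel: "(\<lambda>n. integral {0..T} (\<lambda>x. step_kernel r (d n) x * h x)) \<longlonglongrightarrow> h r"
    if r: "0 < r" "r \<le> t" for r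
    unfolding tendsto_iff
  proof (intro allI impI)
    fix e :: real assume "e > 0"
    have "continuous (at r within {0..T}) h"
      using cont r st by (simp add: continuous_on_eq_continuous_within)
    then obtain d1 where d1: "d1 > 0" "\<And>x. x \<in> {0..T} \<Longrightarrow> dist x r < d1 \<Longrightarrow> dist (h x) (h r) < e / 2"
      using \<open>e > 0\<close> unfolding continuous_within_eps_delta by (metis half_gt_zero)
    have "\<forall>\<^sub>F n in sequentially. d n < d1"
      using d0 d1(1) by (rule order_tendstoD)
    then show "\<forall>\<^sub>F n in sequentially. dist (integral {0..T} (\<lambda>x. step_kernel r (d n) x * h x)) (h r) < e"
    proof eventually_elim
      case (elim n)
      have "\<bar>integral {0..T} (\<lambda>x. step_kernel r (d n) x * h x) - h r\<bar> \<le> e / 2"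
      proof (rule step_kernel_approximates[OF d(1) _ _ cont])
        show "\<bar>h x - h r\<bar> \<le> e / 2" if "r \<le> x" "x \<le> r + d n" for x
          using d1(2)[of x] that r elim d(2)[of n] by (auto simp: dist_real_def)
      qed (use r d(2)[of n] in auto)
      then show ?case using \<open>e > 0\<close> by (simp add: dist_real_def)
    qed
  qed
  define \<eta> where "\<eta> n x = smooth_step s (d n) x - smooth_step t (d n) x" for n x
  have lhs: "(LINT x|lebesgue_on {0<..<T}. deriv (\<eta> n) x * h x)
      = integral {0..T} (\<lambda>x. step_kernel s (d n) x * h x) - integral {0..T} (\<lambda>x. step_kernel t (d n) x * h x)"
    for n
  proof -
    have deriv: "deriv (\<eta> n) x = step_kernel s (d n) x - step_kernel t (d n) x" for x
      unfolding \<eta>_def[abs_def]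
      by (intro DERIV_imp_deriv DERIV_diff smooth_step_has_derivative d)
    have c: "continuous_on {0..T} (step_kernel r (d n))" for r
      using Ck_step_kernel[OF d(1), of 0] by (auto intro: continuous_on_subset)
    have "integrable (lebesgue_on {0..T}) (\<lambda>x. (step_kernel s (d n) x - step_kernel t (d n) x) * h x)"
      by (intro continuous_imp_integrable_real continuous_intros c cont)
    then have "(LINT x|lebesgue_on {0<..<T}. deriv (\<eta> n) x * h x)
        = integral {0..T} (\<lambda>x. (step_kernel s (d n) x - step_kernel t (d n) x) * h x)"
      by (simp add: deriv integral_lebesgue_on_Ioo_eq integrable_lebesgue_on_Ioo_iff)
    also have "\<dots> = integral {0..T} (\<lambda>x. step_kernel s (d n) x * h x) - integral {0..T} (\<lambda>x. step_kernel t (d n) x * h x)"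
      unfolding left_diff_distrib
      by (intro Henstock_Kurzweil_Integration.integral_diff integrable_continuous_real continuous_intros c cont)
    finally show ?thesis .
  qed
  have rhs: "(\<lambda>n. LINT x|lebesgue_on {0<..<T}. \<eta> n x * k x)
      \<longlonglongrightarrow> (LINT x|lebesgue_on {0<..<T}. indicator {s<..t} x * k x)"
  proof (rule integral_dominated_convergence[where w = "\<lambda>x. norm (k x)"])
    note [measurable] = borel_measurable_integrable[OF k]
    have [measurable]: "\<eta> n \<in> borel_measurable (lebesgue_on {0<..<T})" for n
      using Ck_diff[OF Ck_smooth_step[OF d(1), of 0] Ck_smooth_step[OF d(1), of 0]]
      unfolding \<eta>_def[abs_def]
      by (intro continuous_imp_measurable_on_sets_lebesgue) (auto intro: continuous_on_subset[OF _ subset_UNIV])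
    have [measurable]: "indicat_real {s<..t} \<in> borel_measurable (lebesgue_on {0<..<T})"
      by (intro measurable_restrict_space1 measurable_completion borel_measurable_indicator) auto
    show "(\<lambda>x. \<eta> n x * k x) \<in> borel_measurable (lebesgue_on {0<..<T})" for n by measurable
    show "(\<lambda>x. indicator {s<..t} x * k x) \<in> borel_measurable (lebesgue_on {0<..<T})" by measurable
    show "integrable (lebesgue_on {0<..<T}) (\<lambda>x. norm (k x))" using k by simp
    have "norm (\<eta> n x * k x) \<le> norm (k x)" for n x
      using smooth_step_bounds[OF d(1), of s n x] smooth_step_bounds[OF d(1), of t n x]
      by (auto simp: \<eta>_def abs_mult intro!: mult_left_le_one_le)
    then show "AE x in lebesgue_on {0<..<T}. norm (\<eta> n x * k x) \<le> norm (k x)" for n by simp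
    \<comment> \<open>At x = r the step is 0 for every n, which is why the limit of the test
      functions is the indicator of a half-open interval.\<close>
    have step: "(\<lambda>n. smooth_step r (d n) x) \<longlonglongrightarrow> of_bool (r < x)" for r x
    proof (cases "r < x")
      case True
      then have "\<forall>\<^sub>F n in sequentially. d n < x - r"
        using d0 by (intro order_tendstoD) auto
      then have "\<forall>\<^sub>F n in sequentially. smooth_step r (d n) x = 1"
        by eventually_elim (simp add: smooth_step_eq_1 d)
      then show ?thesis using True by (simp add: tendsto_eventually)
    qed (simp add: smooth_step_eq_0 d)
    have "(\<lambda>n. \<eta> n x * k x) \<longlonglongrightarrow> (of_bool (s < x) - of_bool (t < x)) * k x" for x
      unfolding \<eta>_def by (intro tendsto_intros step)
    moreover have "of_bool (s < x) - of_bool (t < x) = indicat_real {s<..t} x" for x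
      using st by (auto simp: indicator_def)
    ultimately show "AE x in lebesgue_on {0<..<T}. (\<lambda>n. \<eta> n x * k x) \<longlonglongrightarrow> indicator {s<..t} x * k x"
      by simp
  qed
  have rhs_lim: "(LINT x|lebesgue_on {0<..<T}. indicator {s<..t} x * k x) = integral {s..t} k"
  proof -
    have "(LINT x|lebesgue_on {0<..<T}. indicator {s<..t} x * k x)
        = (LINT x|lebesgue_on {0<..<T}. (if x \<in> {s<..t} then k x else 0))"
      by (rule Bochner_Integration.integral_cong) (auto simp: indicator_def)
    also have "\<dots> = integral\<^sup>L (lebesgue_on {s<..t}) k"
      using st by (intro Lebesgue_Measure.integral_restrict) auto
    also have "\<dots> = integral {s<..t} k"
      using st by (intro lebesgue_integral_eq_integral integrable_lebesgue_on_subset[OF k]) auto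
    also have "\<dots> = integral {s..t} k"
      by (rule integral_subset_negligible, force, rule negligible_subset[of "{s}"]) auto
    finally show ?thesis .
  qed
  have lhs_lim: "(\<lambda>n. LINT x|lebesgue_on {0<..<T}. deriv (\<eta> n) x * h x) \<longlonglongrightarrow> h s - h t"
    unfolding lhs using st by (intro tendsto_diff kernel) auto
  have "(LINT x|lebesgue_on {0<..<T}. deriv (\<eta> n) x * h x)
      = - (LINT x|lebesgue_on {0<..<T}. \<eta> n x * k x)" for n
    using st d unfolding \<eta>_def[abs_def] by (intro weak step_difference_test_function)
  then have "(\<lambda>n. - (LINT x|lebesgue_on {0<..<T}. \<eta> n x * k x)) \<longlonglongrightarrow> h s - h t"
    using lhs_lim by simp
  from LIMSEQ_unique[OF this tendsto_minus[OF rhs]] have "h s - h t = - integral {s..t} k"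
    by (simp only: rhs_lim)
  then show ?thesis by simp
qed

section \<open>Integrating bounds on left difference quotients\<close>

text \<open>Each term is the mean of W over [a - h n, a]. The difference of primitives is the form
  that telescoping leaves in \<open>increment_le_integral_aux\<close>.\<close>

lemma left_difference_quotient_tendsto:
  fixes W :: "real \<Rightarrow> real"
  assumes cont: "continuous_on {0..T} W" and a: "0 < a" "a \<le> T" and h: "\<And>n. 0 < h n" "\<And>n. h n \<le> a" "h \<longlonglongrightarrow> 0"
  shows "(\<lambda>n. (integral {0..a} W - integral {0..a - h n} W) / h n) \<longlonglongrightarrow> W a"
proof -
  have "((\<lambda>u. integral {0..u} W) has_real_derivative W a) (at a within {0..T})"
    using cont a by (intro integral_has_real_derivative) auto
  then have "((\<lambda>u. (integral {0..u} W - integral {0..a} W) / (u - a)) \<longlongrightarrow> W a) (at a within {0..T})"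
    by (simp add: has_field_derivative_iff)
  moreover have "filterlim (\<lambda>n. a - h n) (at a within {0..T}) sequentially"
    unfolding filterlim_at
  proof
    show "\<forall>\<^sub>F n in sequentially. a - h n \<in> {0..T} \<and> a - h n \<noteq> a"
    proof (intro always_eventually allI)
      show "a - h n \<in> {0..T} \<and> a - h n \<noteq> a" for n
        using h(1)[of n] h(2)[of n] a by auto
    qed
    show "(\<lambda>n. a - h n) \<longlonglongrightarrow> a"
      using tendsto_diff[OF tendsto_const[of a] h(3)] by simp
  qed
  ultimately have "(\<lambda>n. (integral {0..a - h n} W - integral {0..a} W) / (a - h n - a)) \<longlonglongrightarrow> W a"
    by (rule filterlim_compose)
  moreover have "(integral {0..a - h n} W - integral {0..a} W) / (a - h n - a)
      = (integral {0..a} W - integral {0..a - h n} W) / h n" for n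
    using h(1)[of n] by (simp add: divide_simps)
  ultimately show ?thesis by simp
qed

text \<open>A Fatou argument. The averages of k over [t - h, t] bound the left difference quotients
  of \<Phi>, but no majorant uniform in h is given for them. Subtracting \<Phi> from a primitive of
  k moves them into W: then \<open>bound\<close> says that f n is nonnegative, while
  \<open>lim\<close> and Lebesgue differentiation give a lower limit of at least c = m + k - H. The
  integral of f n telescopes to means of W near b and a, so that \<integral>c \<le> \<integral>m + W
  b - W a, in which the contributions of m and k cancel.\<close>

lemma increment_le_integral_aux:
  fixes \<Phi> H k m :: "real \<Rightarrow> real"
  assumes cont: "continuous_on {0..T} \<Phi>"
    and H: "integrable (lebesgue_on {0..T}) H"
    and k: "integrable (lebesgue_on {0..T}) k"
    and m: "integrable (lebesgue_on {0..T}) m"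
    and bound: "AE t in lebesgue_on {0..T}. \<forall>h. 0 < h \<longrightarrow> h < t \<longrightarrow>
      \<Phi> t - \<Phi> (t - h) \<le> integral {t - h..t} k + h * m t"
    and lim: "AE t in lebesgue_on {0..T}. \<forall>e>0. \<exists>d>0. \<forall>h. 0 < h \<longrightarrow> h < d \<longrightarrow>
      \<Phi> t - \<Phi> (t - h) \<le> h * (H t + e)"
    and ab: "0 < a" "a \<le> b" "b \<le> T"
  shows "\<Phi> b - \<Phi> a \<le> integral {a..b} H"
proof -
  define W where "W t = integral {0..t} k - \<Phi> t" for t
  have contW: "continuous_on {0..T} W"
    unfolding W_def using integrable_on_of_lebesgue_on(2)[OF k, of 0 T]
    by (intro continuous_on_diff cont indefinite_integral_continuous_1) auto
  have k_int: "integral {0..t} k - integral {0..t - h} k = integral {t - h..t} k"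
    if "0 < h" "h < t" "t \<le> T" for t h
    using Henstock_Kurzweil_Integration.integral_combine[of 0 "t - h" t k]
      integrable_on_of_lebesgue_on(2)[OF k, of 0 t] that by simp
  \<comment> \<open>Every h n is strictly below a, also for n = 0, so t - h n stays positive for t
    in [a, b], as \<open>bound\<close> requires.\<close>
  define h where "h n = a / real (n + 2)" for n
  have h: "0 < h n" "h n < a" for n
    using ab mult_strict_left_mono[of 1 "real (n + 2)" a] by (auto simp: h_def divide_less_eq)
  have h0: "h \<longlonglongrightarrow> 0"
    using tendsto_mult[OF tendsto_const[of a] LIMSEQ_ignore_initial_segment[OF lim_1_over_n[where ?'a = real], of 2]]
    by (simp add: h_def[abs_def])
  define f where "f n t = m t + (W t - W (t - h n)) / h n" for n t
  define c where "c t = m t + k t - H t" for t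
  have Icc: "{a..b} \<subseteq> {0..T}" using ab by auto
  have AE_sub: "AE t in lebesgue_on {a..b}. P t" if "AE t in lebesgue_on {0..T}. P t" for P
    using that Icc by (auto simp: AE_restrict_space_iff elim!: eventually_mono)
  have shift: "continuous_on {a..b} (\<lambda>t. W (t - h n))" for n
    by (rule continuous_on_compose2[OF contW])
      (use ab h[of n] in \<open>auto intro!: continuous_intros\<close>)
  have contWab: "continuous_on {a..b} W"
    using contW Icc by (rule continuous_on_subset)
  have quot_int: "integrable (lebesgue_on {a..b}) (\<lambda>t. (W t - W (t - h n)) / h n)" for n
    by (intro continuous_imp_integrable_real continuous_intros contWab shift) (use h(1)[of n] in simp)
  have m_int: "integrable (lebesgue_on {a..b}) m" and H_int: "integrable (lebesgue_on {a..b}) H"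
    and k_int': "integrable (lebesgue_on {a..b}) k"
    using ab by (auto intro: integrable_on_of_lebesgue_on(1)[OF m] integrable_on_of_lebesgue_on(1)[OF H]
        integrable_on_of_lebesgue_on(1)[OF k])
  have f_int: "integrable (lebesgue_on {a..b}) (f n)" for n
    unfolding f_def[abs_def] by (intro Bochner_Integration.integrable_add m_int quot_int)
  have c_int: "integrable (lebesgue_on {a..b}) c"
    unfolding c_def[abs_def] by (intro Bochner_Integration.integrable_add Bochner_Integration.integrable_diff m_int k_int' H_int)
  have f_nonneg: "AE t in lebesgue_on {a..b}. \<forall>n. 0 \<le> f n t"
  proof -
    have "AE t in lebesgue_on {a..b}. t \<in> {a..b}"
      by (rule AE_I2) simp
    with AE_sub[OF bound] show ?thesis
    proof eventually_elim
      case (elim t)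
      show ?case
      proof
        fix n
        have "\<Phi> t - \<Phi> (t - h n) \<le> integral {t - h n..t} k + h n * m t"
          using elim h[of n] by auto
        moreover have "integral {0..t} k - integral {0..t - h n} k = integral {t - h n..t} k"
          by (rule k_int) (use elim(2) h[of n] ab in auto)
        ultimately have "0 \<le> h n * m t + (W t - W (t - h n))"
          unfolding W_def by linarith
        also have "\<dots> = h n * f n t"
          using h(1)[of n] by (simp add: f_def field_simps)
        finally show "0 \<le> f n t"
          using h(1)[of n] by (simp add: zero_le_mult_iff)
      qed
    qed
  qed
  have f_lim: "AE t in lebesgue_on {a..b}. (\<lambda>n. min (f n t) (c t)) \<longlonglongrightarrow> c t"
  proof -
    have "integrable lebesgue (\<lambda>t. if t \<in> {0..T} then k t else 0)"
      using k by (subst Lebesgue_Measure.integrable_restrict_UNIV) auto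
    from AE_left_average_tendsto[OF this]
    have "AE t in lebesgue. t \<in> {a..b} \<longrightarrow> ((\<lambda>h. integral {t - h..t} (\<lambda>t. if t \<in> {0..T} then k t else 0) / h)
        \<longlongrightarrow> (if t \<in> {0..T} then k t else 0)) (at_right 0)"
      by eventually_elim simp
    then have "AE t in lebesgue_on {a..b}. ((\<lambda>h. integral {t - h..t} (\<lambda>t. if t \<in> {0..T} then k t else 0) / h)
        \<longlongrightarrow> (if t \<in> {0..T} then k t else 0)) (at_right 0)"
      by (subst AE_restrict_space_iff) auto
    moreover have "AE t in lebesgue_on {a..b}. t \<in> {a..b}"
      by (rule AE_I2) simp
    ultimately show ?thesis using AE_sub[OF lim]
    proof eventually_elim
      case (elim t)
      have t: "t \<in> {0..T}" using elim(2) Icc by blast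
      have "filterlim h (at_right 0) sequentially"
        unfolding filterlim_at
      proof (intro conjI h0)
        show "\<forall>\<^sub>F n in sequentially. h n \<in> {0<..} \<and> h n \<noteq> 0"
          using h(1) by (intro always_eventually allI) (simp add: less_imp_neq[THEN not_sym])
      qed
      from filterlim_compose[OF elim(1) this]
      have "(\<lambda>n. integral {t - h n..t} (\<lambda>t. if t \<in> {0..T} then k t else 0) / h n) \<longlonglongrightarrow> k t"
        using t by simp
      moreover have "integral {t - h n..t} (\<lambda>t. if t \<in> {0..T} then k t else 0) = integral {t - h n..t} k" for n
        using elim(2) ab h[of n] by (intro Henstock_Kurzweil_Integration.integral_cong) auto
      ultimately have k_lim: "(\<lambda>n. integral {t - h n..t} k / h n) \<longlonglongrightarrow> k t" by simp
      show ?case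
        unfolding tendsto_iff
      proof (intro allI impI)
        fix e :: real assume "e > 0"
        then have "e / 2 > 0" by simp
        with elim(3) obtain d where d: "d > 0" "\<And>h. 0 < h \<Longrightarrow> h < d \<Longrightarrow> \<Phi> t - \<Phi> (t - h) \<le> h * (H t + e / 2)"
          by blast
        have "\<forall>\<^sub>F n in sequentially. h n < d"
          using h0 d(1) by (rule order_tendstoD)
        moreover have "\<forall>\<^sub>F n in sequentially. k t - e / 2 < integral {t - h n..t} k / h n"
          using k_lim \<open>e > 0\<close> by (intro order_tendstoD(1)) auto
        ultimately show "\<forall>\<^sub>F n in sequentially. dist (min (f n t) (c t)) (c t) < e"
        proof eventually_elim
          case (elim n)
          have "(\<Phi> t - \<Phi> (t - h n)) / h n \<le> H t + e / 2"
            using d(2)[of "h n"] elim(1) h(1)[of n] by (simp add: divide_le_eq mult.commute)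
          moreover have "integral {0..t} k - integral {0..t - h n} k = integral {t - h n..t} k"
            by (rule k_int) (use \<open>t \<in> {a..b}\<close> h[of n] ab in auto)
          then have "W t - W (t - h n) = integral {t - h n..t} k - (\<Phi> t - \<Phi> (t - h n))"
            unfolding W_def by linarith
          then have "f n t = m t + integral {t - h n..t} k / h n - (\<Phi> t - \<Phi> (t - h n)) / h n"
            by (simp add: f_def diff_divide_distrib)
          \<comment> \<open>A lower bound suffices, since the minimum with c t never exceeds c t.
            Half of e is spent on H and half on the average of k.\<close>
          ultimately have "c t - e < f n t"
            using elim(2) by (simp add: c_def)
          then show ?case
            using \<open>e > 0\<close> by (auto simp: dist_real_def min_def)
        qed
      qed
    qed
  qed
  \<comment> \<open>Truncating at the expected limit gives the Fatou-type bound by dominated convergence.\<close>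
  have "(\<lambda>n. LINT t|lebesgue_on {a..b}. min (f n t) (c t)) \<longlonglongrightarrow> integral\<^sup>L (lebesgue_on {a..b}) c"
  proof (rule integral_dominated_convergence[where w = "\<lambda>t. norm (c t)"])
    note [measurable] = borel_measurable_integrable[OF f_int] borel_measurable_integrable[OF c_int]
    show "c \<in> borel_measurable (lebesgue_on {a..b})" by measurable
    show "(\<lambda>t. min (f n t) (c t)) \<in> borel_measurable (lebesgue_on {a..b})" for n by measurable
    show "integrable (lebesgue_on {a..b}) (\<lambda>t. norm (c t))" using c_int by simp
    show "AE t in lebesgue_on {a..b}. norm (min (f n t) (c t)) \<le> norm (c t)" for n
      using f_nonneg by eventually_elim (auto simp: min_def dest: spec[of _ n])
  qed (rule f_lim)
  moreover have "(LINT t|lebesgue_on {a..b}. min (f n t) (c t)) \<le> integral {a..b} m +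
      ((integral {0..b} W - integral {0..b - h n} W) / h n - (integral {0..a} W - integral {0..a - h n} W) / h n)"
    for n
  proof -
    have "(LINT t|lebesgue_on {a..b}. min (f n t) (c t)) \<le> integral\<^sup>L (lebesgue_on {a..b}) (f n)"
    proof (rule integral_mono)
      show "integrable (lebesgue_on {a..b}) (\<lambda>t. min (f n t) (c t))"
        by (intro Bochner_Integration.integrable_min f_int c_int)
    qed (use f_int in auto)
    also have "\<dots> = integral\<^sup>L (lebesgue_on {a..b}) m
        + (LINT t|lebesgue_on {a..b}. (W t - W (t - h n)) / h n)"
      unfolding f_def[abs_def] by (intro Bochner_Integration.integral_add m_int quot_int)
    also have "integral\<^sup>L (lebesgue_on {a..b}) m = integral {a..b} m"
      using m_int by (rule lebesgue_integral_eq_integral) auto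
    also have "(LINT t|lebesgue_on {a..b}. (W t - W (t - h n)) / h n)
        = integral {a..b} (\<lambda>t. (W t - W (t - h n)) / h n)"
      using quot_int by (rule lebesgue_integral_eq_integral) auto
    also have "\<dots> = (integral {a..b} W - integral {a..b} (\<lambda>t. W (t - h n))) / h n"
      by (simp add: Henstock_Kurzweil_Integration.integral_diff integrable_continuous_real contWab shift)
    also have "integral {a..b} (\<lambda>t. W (t - h n)) = integral {a - h n..b - h n} W"
      using integral_shift_Icc_real[of a b W "- h n"] by (simp add: o_def)
    also have "integral {a..b} W = integral {0..b} W - integral {0..a} W"
      using Henstock_Kurzweil_Integration.integral_combine[of 0 a b W] ab
        integrable_continuous_real[OF continuous_on_subset[OF contW, of "{0..b}"]] by simp
    also have "integral {a - h n..b - h n} W = integral {0..b - h n} W - integral {0..a - h n} W"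
      using Henstock_Kurzweil_Integration.integral_combine[of 0 "a - h n" "b - h n" W] ab h[of n]
        integrable_continuous_real[OF continuous_on_subset[OF contW, of "{0..b - h n}"]] by simp
    finally show ?thesis by (simp add: diff_divide_distrib)
  qed
  moreover have "(\<lambda>n. integral {a..b} m + ((integral {0..b} W - integral {0..b - h n} W) / h n
      - (integral {0..a} W - integral {0..a - h n} W) / h n)) \<longlonglongrightarrow> integral {a..b} m + (W b - W a)"
    using ab h
    by (intro tendsto_intros left_difference_quotient_tendsto[OF contW] h0)
      (auto intro: less_imp_le order_trans[OF less_imp_le])
  ultimately have "integral\<^sup>L (lebesgue_on {a..b}) c \<le> integral {a..b} m + (W b - W a)"
    by (intro LIMSEQ_le) auto
  moreover have "integral\<^sup>L (lebesgue_on {a..b}) c = integral {a..b} m + integral {a..b} k - integral {a..b} H"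
    unfolding c_def[abs_def] using m_int k_int' H_int
    by (simp add: lebesgue_integral_eq_integral)
  moreover have "integral {0..b} k = integral {0..a} k + integral {a..b} k"
    using Henstock_Kurzweil_Integration.integral_combine[of 0 a b k]
      integrable_on_of_lebesgue_on(2)[OF k, of 0 b] ab by simp
  ultimately show ?thesis
    by (simp add: W_def)
qed

text \<open>The left shifts in the previous lemma require a > 0. The case a = 0 follows by letting a
  decrease to 0, because G is continuous there.\<close>

lemma increment_le_integral:
  fixes \<Phi> H k m :: "real \<Rightarrow> real"
  assumes cont: "continuous_on {0..T} \<Phi>"
    and H: "integrable (lebesgue_on {0..T}) H"
    and k: "integrable (lebesgue_on {0..T}) k"
    and m: "integrable (lebesgue_on {0..T}) m"
    and bound: "AE t in lebesgue_on {0..T}. \<forall>h. 0 < h \<longrightarrow> h < t \<longrightarrow>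
      \<Phi> t - \<Phi> (t - h) \<le> integral {t - h..t} k + h * m t"
    and lim: "AE t in lebesgue_on {0..T}. \<forall>e>0. \<exists>d>0. \<forall>h. 0 < h \<longrightarrow> h < d \<longrightarrow>
      \<Phi> t - \<Phi> (t - h) \<le> h * (H t + e)"
    and b: "0 \<le> b" "b \<le> T"
  shows "\<Phi> b - \<Phi> 0 \<le> integral {0..b} H"
proof (cases "b = 0")
  case False
  with b have "0 < b" by simp
  have H': "H integrable_on {0..b}"
    using integrable_on_of_lebesgue_on(2)[OF H] b by simp
  define G where "G a = \<Phi> a - integral {0..a} H" for a
  have "continuous_on {0..b} G"
    unfolding G_def using b H' by (intro continuous_on_diff indefinite_integral_continuous_1
        continuous_on_subset[OF cont]) auto
  then have "(G \<longlongrightarrow> G 0) (at 0 within {0..b})"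
    using \<open>0 < b\<close> by (simp add: continuous_on_def)
  moreover have "at 0 within {0..b} = at_right 0"
    using \<open>0 < b\<close> by (rule at_within_Icc_at_right)
  ultimately have "(G \<longlongrightarrow> G 0) (at_right 0)" by simp
  moreover have "\<forall>\<^sub>F a in at_right 0. G b \<le> G a"
    unfolding eventually_at_right_field
  proof (intro exI conjI allI impI)
    fix a assume a: "0 < a" "a < b"
    have "\<Phi> b - \<Phi> a \<le> integral {a..b} H"
      using a b by (intro increment_le_integral_aux[OF cont H k m bound lim]) auto
    moreover have "integral {0..b} H = integral {0..a} H + integral {a..b} H"
      using Henstock_Kurzweil_Integration.integral_combine[of 0 a b H] H' a by simp
    ultimately show "G b \<le> G a" by (simp add: G_def)
  qed (rule \<open>0 < b\<close>)
  ultimately have "G b \<le> G 0"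
    by (rule tendsto_lowerbound) simp
  then show ?thesis by (simp add: G_def)
qed simp

section \<open>Approximation by simple functions of time\<close>

text \<open>An instance of the completeness of Lebesgue measure. Pairings known only through an
  equation that holds a.e. obtain their measurability in this way.\<close>

lemma borel_measurable_lebesgue_on_AE_eq:
  fixes f g :: "'a::euclidean_space \<Rightarrow> real"
  assumes "f \<in> borel_measurable (lebesgue_on S)" "AE t in lebesgue_on S. f t = g t" "S \<in> sets lebesgue"
  shows "g \<in> borel_measurable (lebesgue_on S)"
proof -
  have "(\<lambda>t. if t \<in> S then f t else 0) \<in> borel_measurable lebesgue"
    using assms by (simp add: borel_measurable_if)
  moreover have "AE t in lebesgue. t \<in> S \<longrightarrow> f t = g t"
    using assms(2,3) by (subst (asm) AE_restrict_space_iff) auto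
  then have "AE t in lebesgue. (if t \<in> S then f t else 0) = (if t \<in> S then g t else 0)"
    by eventually_elim auto
  ultimately have "(\<lambda>t. if t \<in> S then g t else 0) \<in> borel_measurable lebesgue"
    by (rule borel_measurable_AE)
  then show ?thesis
    using assms by (simp add: borel_measurable_if)
qed

lemma borel_measurable_lebesgue_on_AE_LIMSEQ:
  fixes f :: "nat \<Rightarrow> 'a::euclidean_space \<Rightarrow> real"
  assumes "\<And>n. f n \<in> borel_measurable (lebesgue_on S)" "AE t in lebesgue_on S. (\<lambda>n. f n t) \<longlonglongrightarrow> g t"
    "S \<in> sets lebesgue"
  shows "g \<in> borel_measurable (lebesgue_on S)"
proof (rule borel_measurable_lebesgue_on_AE_eq[OF _ _ assms(3)])
  show "(\<lambda>t. lim (\<lambda>n. f n t)) \<in> borel_measurable (lebesgue_on S)"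
    using assms(1) by (rule borel_measurable_lim_metric)
  show "AE t in lebesgue_on S. lim (\<lambda>n. f n t) = g t"
    using assms(2) by eventually_elim (rule limI)
qed

lemma integrable_bound_AE:
  fixes f g :: "'a::euclidean_space \<Rightarrow> real"
  assumes "integrable M g" "f \<in> borel_measurable M" "AE t in M. \<bar>f t\<bar> \<le> g t"
  shows "integrable M f"
  by (rule Bochner_Integration.integrable_bound[OF assms(1,2)]) (use assms(3) in \<open>eventually_elim, auto\<close>)

lemma floor_simple_function:
  "simple_function (lebesgue_on {0<..<T}) (\<lambda>t. \<lfloor>real (Suc n) * t\<rfloor>)"
proof -
  have meas: "(\<lambda>t. \<lfloor>real (Suc n) * t\<rfloor>) \<in> measurable (lebesgue_on {0<..<T}) (count_space UNIV)"
    by (intro measurable_restrict_space1 measurable_completion) measurable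
  have "(\<lambda>t. \<lfloor>real (Suc n) * t\<rfloor>) ` {0<..<T} \<subseteq> {0..\<lfloor>real (Suc n) * T\<rfloor>}"
    by (auto intro!: floor_mono mult_left_mono simp del: of_nat_Suc)
  then have "finite ((\<lambda>t. \<lfloor>real (Suc n) * t\<rfloor>) ` {0<..<T})"
    by (rule finite_subset) simp
  then show ?thesis
    using measurable_sets[OF meas] unfolding simple_function_def by auto
qed

lemma floor_approx_tendsto: "(\<lambda>n. of_int \<lfloor>real (Suc n) * t\<rfloor> / real (Suc n)) \<longlonglongrightarrow> t"
proof (rule tendsto_sandwich)
  show "\<forall>\<^sub>F n in sequentially. t - 1 / real (Suc n) \<le> of_int \<lfloor>real (Suc n) * t\<rfloor> / real (Suc n)"
  proof (intro always_eventually allI)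
    fix n
    have "real (Suc n) * t - 1 \<le> of_int \<lfloor>real (Suc n) * t\<rfloor>" by linarith
    then show "t - 1 / real (Suc n) \<le> of_int \<lfloor>real (Suc n) * t\<rfloor> / real (Suc n)"
      by (simp add: le_divide_eq algebra_simps del: of_nat_Suc)
  qed
  show "\<forall>\<^sub>F n in sequentially. of_int \<lfloor>real (Suc n) * t\<rfloor> / real (Suc n) \<le> t"
    by (intro always_eventually allI) (simp add: divide_le_eq mult.commute del: of_nat_Suc)
  show "(\<lambda>n. t - 1 / real (Suc n)) \<longlonglongrightarrow> t"
    using tendsto_diff[OF tendsto_const[of t] LIMSEQ_Suc[OF lim_1_over_n]] by simp
qed simp

context semi_inner
begin

text \<open>This is strong measurability with the approximating sequence made explicit: its values
  supply the countable set of test functions in \<open>energy_inequality\<close>, and two sequences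
  can be combined term by term.\<close>

definition approximable :: "real \<Rightarrow> (real \<Rightarrow> 'x \<Rightarrow> real) \<Rightarrow> (nat \<Rightarrow> real \<Rightarrow> 'x \<Rightarrow> real) \<Rightarrow> bool" where
  "approximable T g s \<longleftrightarrow> (\<forall>n. simple_function (lebesgue_on {0<..<T}) (s n) \<and> (\<forall>t\<in>{0<..<T}. s n t \<in> S)) \<and>
     (AE t in lebesgue_on {0<..<T}. g t \<in> S \<and> (\<lambda>n. N (\<lambda>x. g t x - s n t x)) \<longlonglongrightarrow> 0)"

lemma approximableD:
  assumes "approximable T g s"
  shows "simple_function (lebesgue_on {0<..<T}) (s n)" "t \<in> {0<..<T} \<Longrightarrow> s n t \<in> S"
    "AE t in lebesgue_on {0<..<T}. t \<in> {0<..<T} \<and> g t \<in> S \<and> (\<forall>n. s n t \<in> S) \<and> (\<lambda>n. N (\<lambda>x. g t x - s n t x)) \<longlonglongrightarrow> 0"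
proof -
  have "AE t in lebesgue_on {0<..<T}. t \<in> {0<..<T}" by (rule AE_I2) simp
  moreover have "AE t in lebesgue_on {0<..<T}. g t \<in> S \<and> (\<lambda>n. N (\<lambda>x. g t x - s n t x)) \<longlonglongrightarrow> 0"
    using assms by (simp add: approximable_def)
  ultimately show "AE t in lebesgue_on {0<..<T}. t \<in> {0<..<T} \<and> g t \<in> S \<and> (\<forall>n. s n t \<in> S) \<and> (\<lambda>n. N (\<lambda>x. g t x - s n t x)) \<longlonglongrightarrow> 0"
    by eventually_elim (use assms in \<open>auto simp: approximable_def\<close>)
qed (use assms in \<open>auto simp: approximable_def\<close>)

lemma approximableI:
  assumes "\<And>n. simple_function (lebesgue_on {0<..<T}) (s n)" "\<And>n t. t \<in> {0<..<T} \<Longrightarrow> s n t \<in> S"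
    "AE t in lebesgue_on {0<..<T}. g t \<in> S \<and> (\<lambda>n. N (\<lambda>x. g t x - s n t x)) \<longlonglongrightarrow> 0"
  shows "approximable T g s"
  using assms by (auto simp: approximable_def)

lemma inner_tendsto:
  assumes "v \<in> S" "w \<in> S" "\<And>n. v' n \<in> S" "\<And>n. w' n \<in> S"
    and "(\<lambda>n. N (\<lambda>x. v x - v' n x)) \<longlonglongrightarrow> 0" "(\<lambda>n. N (\<lambda>x. w x - w' n x)) \<longlonglongrightarrow> 0"
  shows "(\<lambda>n. B (v' n) (w' n)) \<longlonglongrightarrow> B v w"
proof -
  have "(\<lambda>n. N (\<lambda>x. v x - v' n x) * (N w + N (\<lambda>x. w x - w' n x)) + N v * N (\<lambda>x. w x - w' n x))
      \<longlonglongrightarrow> 0 * (N w + 0) + N v * 0"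
    by (intro tendsto_intros assms)
  then have lim: "(\<lambda>n. N (\<lambda>x. v x - v' n x) * (N w + N (\<lambda>x. w x - w' n x)) + N v * N (\<lambda>x. w x - w' n x))
      \<longlonglongrightarrow> 0"
    by simp
  have "(\<lambda>n. B v w - B (v' n) (w' n)) \<longlonglongrightarrow> 0"
    by (rule Lim_null_comparison[OF always_eventually lim], rule allI)
      (simp only: real_norm_def, rule inner_diff_le[OF assms(1,2) assms(3) assms(4)])
  from tendsto_diff[OF tendsto_const[of "B v w"] this] show ?thesis by simp
qed

text \<open>Any function of two simple functions is simple, so no measurable structure on the
  function space enters; continuity of the form then passes to the a.e. limit.\<close>

lemma inner_measurable:
  assumes "approximable T g s" "approximable T h r"
  shows "(\<lambda>t. B (g t) (h t)) \<in> borel_measurable (lebesgue_on {0<..<T})"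
proof (rule borel_measurable_lebesgue_on_AE_LIMSEQ)
  show "(\<lambda>t. B (s n t) (r n t)) \<in> borel_measurable (lebesgue_on {0<..<T})" for n
    by (rule borel_measurable_simple_function,
        rule simple_function_compose2[OF approximableD(1)[OF assms(1)] approximableD(1)[OF assms(2)]])
  show "AE t in lebesgue_on {0<..<T}. (\<lambda>n. B (s n t) (r n t)) \<longlonglongrightarrow> B (g t) (h t)"
    using approximableD(3)[OF assms(1)] approximableD(3)[OF assms(2)]
    by eventually_elim (rule inner_tendsto, simp_all)
qed simp

lemma norm_measurable:
  assumes "approximable T g s"
  shows "(\<lambda>t. N (g t)) \<in> borel_measurable (lebesgue_on {0<..<T})"
  unfolding norm_eq using inner_measurable[OF assms assms] by measurable

lemma approximable_const: "v \<in> S \<Longrightarrow> approximable T (\<lambda>t. v) (\<lambda>n t. v)"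
  using norm_scale[of v 0] by (intro approximableI AE_I2) auto

lemma approximable_diff:
  assumes "approximable T g s" "approximable T h r"
  shows "approximable T (\<lambda>t x. g t x - h t x) (\<lambda>n t x. s n t x - r n t x)"
proof (rule approximableI)
  show "simple_function (lebesgue_on {0<..<T}) (\<lambda>t x. s n t x - r n t x)" for n
    by (rule simple_function_compose2[OF approximableD(1)[OF assms(1)] approximableD(1)[OF assms(2)]])
  show "(\<lambda>x. s n t x - r n t x) \<in> S" if "t \<in> {0<..<T}" for n t
    using that by (intro diff_closed approximableD(2)[OF assms(1)] approximableD(2)[OF assms(2)])
  show "AE t in lebesgue_on {0<..<T}. (\<lambda>x. g t x - h t x) \<in> S \<and>
      (\<lambda>n. N (\<lambda>x. g t x - h t x - (s n t x - r n t x))) \<longlonglongrightarrow> 0"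
    using approximableD(3)[OF assms(1)] approximableD(3)[OF assms(2)]
  proof eventually_elim
    case (elim t)
    have le: "N (\<lambda>x. g t x - h t x - (s n t x - r n t x))
        \<le> N (\<lambda>x. g t x - s n t x) + N (\<lambda>x. h t x - r n t x)" for n
      using norm_triangle_diff[OF diff_closed diff_closed, of "g t" "s n t" "h t" "r n t"] elim
      by (simp add: algebra_simps)
    have lim: "(\<lambda>n. N (\<lambda>x. g t x - s n t x) + N (\<lambda>x. h t x - r n t x)) \<longlonglongrightarrow> 0"
      using tendsto_add[of "\<lambda>n. N (\<lambda>x. g t x - s n t x)" 0 sequentially "\<lambda>n. N (\<lambda>x. h t x - r n t x)" 0] elim
      by simp
    have "(\<lambda>n. N (\<lambda>x. g t x - h t x - (s n t x - r n t x))) \<longlonglongrightarrow> 0"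
      by (rule Lim_null_comparison[OF always_eventually lim], rule allI)
        (simp only: real_norm_def abs_of_nonneg[OF norm_nonneg] le)
    then show ?case using elim by (simp add: diff_closed)
  qed
qed

text \<open>Freezing g at the grid point floor((n + 1) t) / (n + 1), which lies in [0, t] and tends
  to t, gives simple functions.\<close>

lemma approximable_of_continuous:
  assumes "\<And>t. t \<in> {0..T} \<Longrightarrow> g t \<in> S"
    and cont: "\<And>t. t \<in> {0..T} \<Longrightarrow> ((\<lambda>r. N (\<lambda>x. g r x - g t x)) \<longlongrightarrow> 0) (at t within {0..T})"
  shows "\<exists>s. approximable T g s"
proof
  have mem: "of_int \<lfloor>real (Suc n) * t\<rfloor> / real (Suc n) \<in> {0..T}" if "t \<in> {0<..<T}" for n t
  proof -
    have "of_int \<lfloor>real (Suc n) * t\<rfloor> / real (Suc n) \<le> t"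
      by (simp add: divide_le_eq mult.commute del: of_nat_Suc)
    then show ?thesis using that by (auto simp del: of_nat_Suc)
  qed
  show "approximable T g (\<lambda>n t. g (of_int \<lfloor>real (Suc n) * t\<rfloor> / real (Suc n)))"
  proof (rule approximableI)
    show "simple_function (lebesgue_on {0<..<T}) (\<lambda>t. g (of_int \<lfloor>real (Suc n) * t\<rfloor> / real (Suc n)))" for n
      by (rule simple_function_compose1[OF floor_simple_function])
    show "g (of_int \<lfloor>real (Suc n) * t\<rfloor> / real (Suc n)) \<in> S" if "t \<in> {0<..<T}" for n t
      using mem[OF that] by (rule assms(1))
    show "AE t in lebesgue_on {0<..<T}. g t \<in> S \<and>
        (\<lambda>n. N (\<lambda>x. g t x - g (of_int \<lfloor>real (Suc n) * t\<rfloor> / real (Suc n)) x)) \<longlonglongrightarrow> 0"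
    proof (rule AE_I2)
      fix t assume "t \<in> space (lebesgue_on {0<..<T})"
      then have t: "t \<in> {0<..<T}" "t \<in> {0..T}" by auto
      define G where "G r = N (\<lambda>x. g r x - g t x)" for r
      have "G t = 0"
        using norm_scale[OF assms(1)[OF t(2)], of 0] by (simp add: G_def)
      have "(G \<longlongrightarrow> G t) (at t within {0..T})"
        unfolding \<open>G t = 0\<close> using cont[OF t(2)] by (simp add: G_def[abs_def])
      then have "continuous (at t within {0..T}) G"
        by (simp add: continuous_within)
      moreover have "(\<lambda>n. of_int \<lfloor>real (Suc n) * t\<rfloor> / real (Suc n)) \<longlonglongrightarrow> t"
        by (rule floor_approx_tendsto)
      ultimately have "(\<lambda>n. G (of_int \<lfloor>real (Suc n) * t\<rfloor> / real (Suc n))) \<longlonglongrightarrow> G t"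
        by (rule continuous_within_tendsto_compose'[where x = "\<lambda>n. of_int \<lfloor>real (Suc n) * t\<rfloor> / real (Suc n)", OF _ mem[OF t(1)]])
      moreover have "G (of_int \<lfloor>real (Suc n) * t\<rfloor> / real (Suc n))
          = N (\<lambda>x. g t x - g (of_int \<lfloor>real (Suc n) * t\<rfloor> / real (Suc n)) x)" for n
        unfolding G_def using mem[OF t(1)] t(2) by (intro norm_minus_commute assms(1))
      ultimately show "g t \<in> S \<and>
        (\<lambda>n. N (\<lambda>x. g t x - g (of_int \<lfloor>real (Suc n) * t\<rfloor> / real (Suc n)) x)) \<longlonglongrightarrow> 0"
        using assms(1)[OF t(2)] \<open>G t = 0\<close> by simp
    qed
  qed
qed

lemma norm_continuous_on:
  assumes "\<And>t. t \<in> I \<Longrightarrow> g t \<in> S"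
    and cont: "\<And>t. t \<in> I \<Longrightarrow> ((\<lambda>r. N (\<lambda>x. g r x - g t x)) \<longlongrightarrow> 0) (at t within I)"
  shows "continuous_on I (\<lambda>t. N (g t))"
  unfolding continuous_on_def
proof
  fix t assume t: "t \<in> I"
  have "\<forall>\<^sub>F r in at t within I. norm (N (g r) - N (g t)) \<le> N (\<lambda>x. g r x - g t x)"
    using norm_le_norm_diff assms(1) t by (auto simp: eventually_at_filter)
  then have "((\<lambda>r. N (g r) - N (g t)) \<longlongrightarrow> 0) (at t within I)"
    using cont[OF t] by (rule Lim_null_comparison)
  then show "((\<lambda>r. N (g r)) \<longlongrightarrow> N (g t)) (at t within I)"
    by (simp add: LIM_zero_iff)
qed

lemma inner_continuous_on:
  assumes "\<And>t. t \<in> I \<Longrightarrow> g t \<in> S" "w \<in> S"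
    and cont: "\<And>t. t \<in> I \<Longrightarrow> ((\<lambda>r. N (\<lambda>x. g r x - g t x)) \<longlongrightarrow> 0) (at t within I)"
  shows "continuous_on I (\<lambda>t. B (g t) w)"
  unfolding continuous_on_def
proof
  fix t assume t: "t \<in> I"
  have "\<forall>\<^sub>F r in at t within I. norm (B (g r) w - B (g t) w) \<le> N (\<lambda>x. g r x - g t x) * N w"
  proof -
    have "norm (B (g r) w - B (g t) w) \<le> N (\<lambda>x. g r x - g t x) * N w" if "r \<in> I" for r
      using Cauchy_Schwarz[OF diff_closed[OF assms(1) assms(1)] assms(2), of r t] t that assms
      by (simp add: diff_left)
    then show ?thesis by (auto simp: eventually_at_filter)
  qed
  moreover have "((\<lambda>r. N (\<lambda>x. g r x - g t x) * N w) \<longlongrightarrow> 0) (at t within I)"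
    using tendsto_mult[OF cont[OF t] tendsto_const] by simp
  ultimately have "((\<lambda>r. B (g r) w - B (g t) w) \<longlongrightarrow> 0) (at t within I)"
    by (rule Lim_null_comparison)
  then show "((\<lambda>r. B (g r) w) \<longlongrightarrow> B (g t) w) (at t within I)"
    by (simp add: LIM_zero_iff)
qed

end

section \<open>Finite-dimensional spaces of functions\<close>

text \<open>Gram-Schmidt, by induction on the number of generators. The functions b j need not
  belong to V or to L2, so they cannot be orthonormalised themselves; they only bound the dimension.
  In the induction step, V' collects the elements of V that can be written without b i. It is all of
  V or has codimension one, and in the latter case one unit vector orthogonal to the family of V' is
  added.\<close>

lemma AE_orthonormal_generators:
  fixes V :: "('a::euclidean_space \<Rightarrow> real) set"
  assumes "finite J" and "V \<subseteq> L2 \<Omega>" "V \<noteq> {}"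
    and "\<And>v w. v \<in> V \<Longrightarrow> w \<in> V \<Longrightarrow> (\<lambda>x. v x + w x) \<in> V"
    and "\<And>v c. v \<in> V \<Longrightarrow> (\<lambda>x. c * v x) \<in> V"
    and "\<And>v. v \<in> V \<Longrightarrow> \<exists>c. AE x in lebesgue_on \<Omega>. v x = (\<Sum>j\<in>J. c j * b j x)"
  shows "\<exists>(k::nat) e. (\<forall>j<k. e j \<in> V) \<and> (\<forall>i<k. \<forall>j<k. L2_inner \<Omega> (e i) (e j) = of_bool (i = j)) \<and>
    (\<forall>v\<in>V. AE x in lebesgue_on \<Omega>. v x = (\<Sum>j<k. L2_inner \<Omega> v (e j) * e j x))"
  using assms
proof (induction J arbitrary: V rule: finite_induct)
  case empty
  then have *: "AE x in lebesgue_on \<Omega>. v x = 0" if "v \<in> V" for v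
    using that by simp
  show ?case by (rule exI[of _ "0::nat"]) (simp add: *)
next
  case (insert i J)
  define V' where "V' = {v \<in> V. \<exists>c. AE x in lebesgue_on \<Omega>. v x = (\<Sum>j\<in>J. c j * b j x)}"
  obtain z where "z \<in> V" using insert.prems by blast
  from insert.prems(4)[OF this, of 0] have "(\<lambda>x. 0) \<in> V" by simp
  then have zero: "(\<lambda>x. 0) \<in> V'"
    by (auto simp: V'_def intro!: exI[of _ "\<lambda>_. 0"])
  have add': "(\<lambda>x. v x + w x) \<in> V'" if vw: "v \<in> V'" "w \<in> V'" for v w
  proof -
    obtain c d where cd: "AE x in lebesgue_on \<Omega>. v x = (\<Sum>j\<in>J. c j * b j x)"
      "AE x in lebesgue_on \<Omega>. w x = (\<Sum>j\<in>J. d j * b j x)"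
      using vw by (auto simp: V'_def)
    from cd have "AE x in lebesgue_on \<Omega>. v x + w x = (\<Sum>j\<in>J. (c j + d j) * b j x)"
      by eventually_elim (simp add: distrib_right sum.distrib)
    moreover have "(\<lambda>x. v x + w x) \<in> V"
      using vw insert.prems(3) by (simp add: V'_def)
    ultimately show ?thesis
      unfolding V'_def by (intro CollectI conjI exI)
  qed
  have scale': "(\<lambda>x. r * v x) \<in> V'" if v: "v \<in> V'" for v r
  proof -
    obtain c where c: "AE x in lebesgue_on \<Omega>. v x = (\<Sum>j\<in>J. c j * b j x)"
      using v by (auto simp: V'_def)
    from c have "AE x in lebesgue_on \<Omega>. r * v x = (\<Sum>j\<in>J. (r * c j) * b j x)"
      by eventually_elim (simp add: sum_distrib_left mult.assoc)
    moreover have "(\<lambda>x. r * v x) \<in> V"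
      using v insert.prems(4) by (simp add: V'_def)
    ultimately show ?thesis
      unfolding V'_def by (intro CollectI conjI exI)
  qed
  have "\<exists>(k::nat) e. (\<forall>j<k. e j \<in> V') \<and> (\<forall>i<k. \<forall>j<k. L2_inner \<Omega> (e i) (e j) = of_bool (i = j)) \<and>
      (\<forall>v\<in>V'. AE x in lebesgue_on \<Omega>. v x = (\<Sum>j<k. L2_inner \<Omega> v (e j) * e j x))"
  proof (rule insert.IH)
    show "V' \<subseteq> L2 \<Omega>" using insert.prems(1) by (auto simp: V'_def)
    show "V' \<noteq> {}" using zero by blast
    show "\<exists>c. AE x in lebesgue_on \<Omega>. v x = (\<Sum>j\<in>J. c j * b j x)" if "v \<in> V'" for v
      using that by (simp add: V'_def)
  qed (fact add' scale')+
  then obtain k :: nat and e where e: "\<And>j. j < k \<Longrightarrow> e j \<in> V'"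
    and orth: "\<And>i j. i < k \<Longrightarrow> j < k \<Longrightarrow> L2_inner \<Omega> (e i) (e j) = of_bool (i = j)"
    and gen: "\<And>v. v \<in> V' \<Longrightarrow> AE x in lebesgue_on \<Omega>. v x = (\<Sum>j<k. L2_inner \<Omega> v (e j) * e j x)"
    by blast
  have L2V: "v \<in> L2 \<Omega>" if "v \<in> V" for v using that insert.prems(1) by blast
  have V'V: "v \<in> V" if "v \<in> V'" for v using that by (simp add: V'_def)
  have comb: "(\<lambda>x. \<Sum>j<k. a j * e j x) \<in> V'" for a
  proof -
    have "(\<lambda>x. \<Sum>j\<in>K. a j * e j x) \<in> V'" if "finite K" "K \<subseteq> {..<k}" for K
      using that
    proof (induction K)
      case (insert j K)
      then have "(\<lambda>x. a j * e j x + (\<Sum>j\<in>K. a j * e j x)) \<in> V'"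
        by (intro add' scale' e) auto
      with insert show ?case by simp
    qed (simp add: zero)
    then show ?thesis by blast
  qed
  show ?case
  proof (cases "V' = V")
    case True
    then show ?thesis using e orth gen by blast
  next
    case False
    then obtain v0 where v0: "v0 \<in> V" "v0 \<notin> V'"
      by (auto simp: V'_def)
    \<comment> \<open>The orthogonal projection of v0 onto V'; v1 is what remains of v0.\<close>
    define w where "w = (\<lambda>x. \<Sum>j<k. L2_inner \<Omega> v0 (e j) * e j x)"
    define v1 where "v1 x = v0 x + (- 1) * w x" for x
    have w: "w \<in> V'" unfolding w_def by (rule comb)
    have v1: "v1 \<in> V"
      unfolding v1_def[abs_def] using v0 w V'V by (intro insert.prems(3,4)) auto
    have "v1 \<notin> V'"
    proof
      assume "v1 \<in> V'"
      then have "(\<lambda>x. v1 x + w x) \<in> V'" using w by (rule add')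
      then show False using v0(2) by (simp add: v1_def)
    qed
    have "L2_norm \<Omega> v1 \<noteq> 0"
    proof
      assume "L2_norm \<Omega> v1 = 0"
      then have "AE x in lebesgue_on \<Omega>. v1 x = 0"
        using L2_norm_eq_0_iff L2V[OF v1] by blast
      then have "v1 \<in> V'"
        using v1 by (auto simp: V'_def intro!: exI[of _ "\<lambda>_. 0"])
      with \<open>v1 \<notin> V'\<close> show False ..
    qed
    define a where "a = 1 / L2_norm \<Omega> v1"
    define e' where "e' j = (if j < k then e j else (\<lambda>x. a * v1 x))" for j
    have e'V: "e' j \<in> V" for j
      using e V'V v1 insert.prems(4) by (auto simp: e'_def)
    have v1_orth: "L2_inner \<Omega> v1 (e j) = 0" if "j < k" for j
    proof -
      have "L2_inner \<Omega> w (e j) = (\<Sum>i<k. L2_inner \<Omega> v0 (e i) * L2_inner \<Omega> (e i) (e j))"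
        unfolding w_def using that zero
        by (intro L2.sum_left) (auto intro: L2V V'V e)
      also have "\<dots> = L2_inner \<Omega> v0 (e j)"
        using that by (simp add: orth)
      finally have "L2_inner \<Omega> (\<lambda>x. v0 x - w x) (e j) = 0"
        using that v0 w by (subst L2.diff_left) (auto intro: L2V V'V e)
      then show ?thesis by (simp add: v1_def[abs_def])
    qed
    have e'_new: "L2_inner \<Omega> (e' k) (e' k) = 1"
    proof -
      have "L2_inner \<Omega> (e' k) (e' k) = (L2_norm \<Omega> (\<lambda>x. a * v1 x))\<^sup>2"
        by (simp add: e'_def L2.norm_sq)
      also have "\<dots> = 1"
        unfolding L2.norm_scale[OF L2V[OF v1]]
        using \<open>L2_norm \<Omega> v1 \<noteq> 0\<close> L2.norm_nonneg[of \<Omega> v1] by (simp add: a_def)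
      finally show ?thesis .
    qed
    have e'_orth: "L2_inner \<Omega> (e' k) (e' j) = 0" if "j < k" for j
      using that v1_orth L2V[OF v1] L2V[OF V'V[OF e]] by (simp add: e'_def L2.scale_left)
    have orth': "L2_inner \<Omega> (e' i) (e' j) = of_bool (i = j)" if ij: "i < Suc k" "j < Suc k" for i j
    proof -
      consider "i < k" "j < k" | "i = k" "j < k" | "i < k" "j = k" | "i = k" "j = k"
        using ij by linarith
      then show ?thesis
      proof cases
        case 1
        then show ?thesis using orth by (simp add: e'_def)
      next
        case 3
        then show ?thesis
          using e'_orth[of i] L2_inner_commute[of \<Omega> "e' k" "e' i"] by simp
      qed (use e'_orth e'_new in simp_all)
    qed
    have "AE x in lebesgue_on \<Omega>. v x = (\<Sum>j<Suc k. L2_inner \<Omega> v (e' j) * e' j x)" if v: "v \<in> V" for v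
    proof -
      obtain c where c: "AE x in lebesgue_on \<Omega>. v x = (\<Sum>j\<in>insert i J. c j * b j x)"
        using insert.prems(5)[OF v] by blast
      obtain c1 where c1: "AE x in lebesgue_on \<Omega>. e' k x = (\<Sum>j\<in>insert i J. c1 j * b j x)"
        using insert.prems(5)[OF e'V] by blast
      have "c1 i \<noteq> 0"
      proof
        assume "c1 i = 0"
        then have "AE x in lebesgue_on \<Omega>. e' k x = (\<Sum>j\<in>J. c1 j * b j x)"
          using c1 insert.hyps by simp
        then have "e' k \<in> V'"
          using e'V by (auto simp: V'_def)
        from scale'[OF this, of "L2_norm \<Omega> v1"] have "v1 \<in> V'"
          using \<open>L2_norm \<Omega> v1 \<noteq> 0\<close> by (simp add: e'_def a_def)
        with \<open>v1 \<notin> V'\<close> show False ..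
      qed
      \<comment> \<open>This multiple of e' k cancels the coefficient of b i and so places y in V'.
        Since y is then orthogonal to e' k, r turns out to be the coefficient
        \<open>L2_inner \<Omega> v (e' k)\<close>.\<close>
      define r where "r = c i / c1 i"
      define y where "y x = v x + (- r) * e' k x" for x
      have yV: "y \<in> V"
        unfolding y_def[abs_def] using v e'V by (intro insert.prems(3,4))
      have "AE x in lebesgue_on \<Omega>. y x = (\<Sum>j\<in>J. (c j - r * c1 j) * b j x)"
        using c c1
      proof eventually_elim
        case (elim x)
        have "y x = (\<Sum>j\<in>insert i J. c j * b j x) - r * (\<Sum>j\<in>insert i J. c1 j * b j x)"
          using elim by (simp add: y_def)
        also have "\<dots> = (\<Sum>j\<in>insert i J. (c j - r * c1 j) * b j x)"
          by (simp add: sum_distrib_left left_diff_distrib sum_subtractf mult.assoc)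
        also have "\<dots> = (\<Sum>j\<in>J. (c j - r * c1 j) * b j x)"
          using insert.hyps \<open>c1 i \<noteq> 0\<close> by (simp add: r_def)
        finally show ?case .
      qed
      then have y: "y \<in> V'"
        using yV unfolding V'_def by (intro CollectI conjI exI)
      have inner_y: "L2_inner \<Omega> y z = L2_inner \<Omega> v z - r * L2_inner \<Omega> (e' k) z" if "z \<in> V" for z
      proof -
        have "L2_inner \<Omega> (\<lambda>x. v x - r * e' k x) z = L2_inner \<Omega> v z - L2_inner \<Omega> (\<lambda>x. r * e' k x) z"
          by (rule L2.diff_left) (use that v e'V in \<open>auto intro: L2V insert.prems(4)\<close>)
        then show ?thesis
          using that e'V by (simp add: y_def[abs_def] L2.scale_left L2V)
      qed
      have "L2_inner \<Omega> y (e' k) = L2_inner \<Omega> (\<lambda>x. \<Sum>j<k. L2_inner \<Omega> y (e j) * e j x) (e' k)"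
        by (rule L2_inner_cong_AE[OF gen[OF y]]) (use yV e'V comb V'V L2V in auto)
      also have "\<dots> = (\<Sum>j<k. L2_inner \<Omega> y (e j) * L2_inner \<Omega> (e j) (e' k))"
        using zero e'V by (intro L2.sum_left) (auto intro: L2V V'V e)
      also have "\<dots> = 0"
      proof (rule sum.neutral, rule ballI)
        fix j assume "j \<in> {..<k}"
        then have "L2_inner \<Omega> (e' k) (e j) = 0"
          using e'_orth[of j] by (simp add: e'_def)
        then show "L2_inner \<Omega> y (e j) * L2_inner \<Omega> (e j) (e' k) = 0"
          by (simp add: L2_inner_commute[of \<Omega> "e j"])
      qed
      finally have r: "r = L2_inner \<Omega> v (e' k)"
        using inner_y[OF e'V, of k] e'_new by simp
      have coeff: "L2_inner \<Omega> y (e j) = L2_inner \<Omega> v (e' j)" if "j < k" for j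
        using inner_y[OF e'V, of j] e'_orth[OF that] that by (simp add: e'_def)
      show ?thesis
        using gen[OF y]
      proof eventually_elim
        case (elim x)
        have "v x = y x + r * e' k x" by (simp add: y_def)
        also have "y x = (\<Sum>j<k. L2_inner \<Omega> v (e' j) * e' j x)"
          unfolding elim by (intro sum.cong refl) (simp add: coeff, simp add: e'_def)
        finally show ?case by (simp add: r)
      qed
    qed
    then show ?thesis
      using e'V orth' by blast
  qed
qed

section \<open>Piecewise polynomial spaces\<close>

lemma polynomials_add:
  assumes "q \<in> polynomials p" "r \<in> polynomials p"
  shows "(\<lambda>x. q x + r x) \<in> polynomials p"
proof -
  obtain c d where "\<And>x. q x = (\<Sum>\<alpha> | \<alpha> \<in> Basis \<rightarrow>\<^sub>E (UNIV :: nat set) \<and> (\<Sum>b\<in>Basis. \<alpha> b) \<le> p. c \<alpha> * (\<Prod>b\<in>Basis. (x \<bullet> b) ^ \<alpha> b))"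
    "\<And>x. r x = (\<Sum>\<alpha> | \<alpha> \<in> Basis \<rightarrow>\<^sub>E (UNIV :: nat set) \<and> (\<Sum>b\<in>Basis. \<alpha> b) \<le> p. d \<alpha> * (\<Prod>b\<in>Basis. (x \<bullet> b) ^ \<alpha> b))"
    using assms by (auto simp: polynomials_def)
  then show ?thesis
    unfolding polynomials_def
    by (intro CollectI exI[of _ "\<lambda>\<alpha>. c \<alpha> + d \<alpha>"]) (simp add: distrib_right sum.distrib)
qed

lemma polynomials_scale:
  assumes "q \<in> polynomials p"
  shows "(\<lambda>x. r * q x) \<in> polynomials p"
proof -
  obtain c where "\<And>x. q x = (\<Sum>\<alpha> | \<alpha> \<in> Basis \<rightarrow>\<^sub>E (UNIV :: nat set) \<and> (\<Sum>b\<in>Basis. \<alpha> b) \<le> p. c \<alpha> * (\<Prod>b\<in>Basis. (x \<bullet> b) ^ \<alpha> b))"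
    using assms by (auto simp: polynomials_def)
  then show ?thesis
    unfolding polynomials_def
    by (intro CollectI exI[of _ "\<lambda>\<alpha>. r * c \<alpha>"]) (simp add: sum_distrib_left mult.assoc)
qed

lemma finite_multi_indices:
  "finite {\<alpha>. \<alpha> \<in> (Basis :: 'a::euclidean_space set) \<rightarrow>\<^sub>E (UNIV :: nat set) \<and> (\<Sum>b\<in>Basis. \<alpha> b) \<le> p}"
proof (rule finite_subset)
  show "{\<alpha>. \<alpha> \<in> (Basis :: 'a set) \<rightarrow>\<^sub>E (UNIV :: nat set) \<and> (\<Sum>b\<in>Basis. \<alpha> b) \<le> p} \<subseteq> Basis \<rightarrow>\<^sub>E {..p}"
  proof
    fix \<alpha> assume \<alpha>: "\<alpha> \<in> {\<alpha>. \<alpha> \<in> (Basis :: 'a set) \<rightarrow>\<^sub>E (UNIV :: nat set) \<and> (\<Sum>b\<in>Basis. \<alpha> b) \<le> p}"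
    have "\<alpha> b \<le> p" if "b \<in> Basis" for b
      using member_le_sum[of b Basis \<alpha>] that \<alpha> by auto
    with \<alpha> show "\<alpha> \<in> Basis \<rightarrow>\<^sub>E {..p}"
      by (auto simp: PiE_def Pi_def)
  qed
qed (intro finite_PiE finite_Basis finite_atMost)

context open_domain
begin

sublocale H10: semi_inner "H10 \<Omega>" "\<lambda>v w. L2_inner \<Omega> v w + energy \<Omega> v w" "H1_norm \<Omega>"
proof
  show "L2_inner \<Omega> v w + energy \<Omega> v w = L2_inner \<Omega> w v + energy \<Omega> w v" for v w
    by (rule H1.sym)
qed (rule H10_add H10_scale H1.add_left H1.scale_left H1.nonneg H1.norm_eq; (rule H10_H1)?; assumption)+

lemma fe_space_H10: "v \<in> fe_space \<Omega> \<T> p \<Longrightarrow> v \<in> H10 \<Omega>"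
  by (simp add: fe_space_def)

lemma fe_space_add:
  assumes "v \<in> fe_space \<Omega> \<T> p" "w \<in> fe_space \<Omega> \<T> p"
  shows "(\<lambda>x. v x + w x) \<in> fe_space \<Omega> \<T> p"
  unfolding fe_space_def
proof (intro CollectI conjI ballI)
  show "(\<lambda>x. v x + w x) \<in> H10 \<Omega>"
    using assms by (intro H10_add fe_space_H10)
  fix K assume "K \<in> \<T>"
  then obtain q r where qr: "q \<in> polynomials p" "AE x in lebesgue_on \<Omega>. x \<in> K \<longrightarrow> v x = q x"
    "r \<in> polynomials p" "AE x in lebesgue_on \<Omega>. x \<in> K \<longrightarrow> w x = r x"
    using assms unfolding fe_space_def by blast
  from qr(2,4) have "AE x in lebesgue_on \<Omega>. x \<in> K \<longrightarrow> v x + w x = q x + r x"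
    by eventually_elim simp
  then show "\<exists>q\<in>polynomials p. AE x in lebesgue_on \<Omega>. x \<in> K \<longrightarrow> v x + w x = q x"
    by (rule bexI[where x = "\<lambda>x. q x + r x", OF _ polynomials_add[OF qr(1,3)]])
qed

lemma fe_space_scale:
  assumes "v \<in> fe_space \<Omega> \<T> p"
  shows "(\<lambda>x. c * v x) \<in> fe_space \<Omega> \<T> p"
  unfolding fe_space_def
proof (intro CollectI conjI ballI)
  show "(\<lambda>x. c * v x) \<in> H10 \<Omega>"
    using assms by (intro H10_scale fe_space_H10)
  fix K assume "K \<in> \<T>"
  then obtain q where q: "q \<in> polynomials p" "AE x in lebesgue_on \<Omega>. x \<in> K \<longrightarrow> v x = q x"
    using assms unfolding fe_space_def by blast
  from q(2) have "AE x in lebesgue_on \<Omega>. x \<in> K \<longrightarrow> c * v x = c * q x"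
    by eventually_elim simp
  then show "\<exists>q\<in>polynomials p. AE x in lebesgue_on \<Omega>. x \<in> K \<longrightarrow> c * v x = q x"
    by (rule bexI[where x = "\<lambda>x. c * q x", OF _ polynomials_scale[OF q(1)]])
qed

text \<open>The generators are monomials cut off to single simplices. Such functions jump across
  faces and need not lie in V, which is why \<open>AE_orthonormal_generators\<close> admits
  arbitrary functions as generators.\<close>

lemma fe_space_orthonormal_generators:
  fixes \<T> :: "'a set set" and p :: nat
  assumes "finite \<T>" "\<Omega> \<subseteq> \<Union>\<T>" "fe_space \<Omega> \<T> p \<noteq> {}"
  defines "V \<equiv> fe_space \<Omega> \<T> p"
  shows "\<exists>(k::nat) e. (\<forall>j<k. e j \<in> V) \<and> (\<forall>i<k. \<forall>j<k. L2_inner \<Omega> (e i) (e j) = of_bool (i = j)) \<and>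
    (\<forall>v\<in>V. AE x in lebesgue_on \<Omega>. v x = (\<Sum>j<k. L2_inner \<Omega> v (e j) * e j x))"
proof -
  define I where "I = {\<alpha>. \<alpha> \<in> (Basis :: 'a set) \<rightarrow>\<^sub>E (UNIV :: nat set) \<and> (\<Sum>b\<in>Basis. \<alpha> b) \<le> p}"
  \<comment> \<open>Choosing one simplex per point avoids an argument that the common faces are null sets.\<close>
  define \<kappa> where "\<kappa> x = (SOME K. K \<in> \<T> \<and> x \<in> K)" for x
  have \<kappa>: "\<kappa> x \<in> \<T>" "x \<in> \<kappa> x" if "x \<in> \<Omega>" for x
    using someI_ex[of "\<lambda>K. K \<in> \<T> \<and> x \<in> K"] that assms(2) unfolding \<kappa>_def by blast+
  define mono where "mono \<alpha> x = (\<Prod>b\<in>Basis. (x \<bullet> b) ^ \<alpha> b)" for \<alpha> :: "'a \<Rightarrow> nat" and x :: 'a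
  define g where "g = (\<lambda>(K, \<alpha>) x. of_bool (\<kappa> x = K) * mono \<alpha> x)"
  have rep: "\<exists>c. AE x in lebesgue_on \<Omega>. v x = (\<Sum>j\<in>\<T> \<times> I. c j * g j x)" if v: "v \<in> V" for v
  proof -
    have "\<forall>K\<in>\<T>. \<exists>c. AE x in lebesgue_on \<Omega>. x \<in> K \<longrightarrow> v x = (\<Sum>\<alpha>\<in>I. c \<alpha> * mono \<alpha> x)"
    proof
      fix K assume "K \<in> \<T>"
      then obtain q where q: "q \<in> polynomials p" "AE x in lebesgue_on \<Omega>. x \<in> K \<longrightarrow> v x = q x"
        using v unfolding V_def fe_space_def by blast
      then obtain c where "\<And>x. q x = (\<Sum>\<alpha>\<in>I. c \<alpha> * mono \<alpha> x)"
        unfolding polynomials_def I_def mono_def by blast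
      with q(2) show "\<exists>c. AE x in lebesgue_on \<Omega>. x \<in> K \<longrightarrow> v x = (\<Sum>\<alpha>\<in>I. c \<alpha> * mono \<alpha> x)"
        by auto
    qed
    from bchoice[OF this] obtain c where
      "\<And>K. K \<in> \<T> \<Longrightarrow> AE x in lebesgue_on \<Omega>. x \<in> K \<longrightarrow> v x = (\<Sum>\<alpha>\<in>I. c K \<alpha> * mono \<alpha> x)"
      by blast
    then have "AE x in lebesgue_on \<Omega>. \<forall>K\<in>\<T>. x \<in> K \<longrightarrow> v x = (\<Sum>\<alpha>\<in>I. c K \<alpha> * mono \<alpha> x)"
      by (intro AE_finite_allI assms)
    moreover have "AE x in lebesgue_on \<Omega>. x \<in> \<Omega>" by (rule AE_I2) simp
    ultimately have "AE x in lebesgue_on \<Omega>. v x = (\<Sum>j\<in>\<T> \<times> I. c (fst j) (snd j) * g j x)"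
    proof eventually_elim
      case (elim x)
      have "(\<Sum>j\<in>\<T> \<times> I. c (fst j) (snd j) * g j x)
          = (\<Sum>K\<in>\<T>. \<Sum>\<alpha>\<in>I. c K \<alpha> * (of_bool (\<kappa> x = K) * mono \<alpha> x))"
        by (simp add: sum.cartesian_product g_def case_prod_beta)
      also have "\<dots> = (\<Sum>K\<in>\<T>. if \<kappa> x = K then (\<Sum>\<alpha>\<in>I. c K \<alpha> * mono \<alpha> x) else 0)"
        by (intro sum.cong refl) auto
      also have "\<dots> = (\<Sum>\<alpha>\<in>I. c (\<kappa> x) \<alpha> * mono \<alpha> x)"
        using assms(1) \<kappa>(1) elim(2) by simp
      also have "\<dots> = v x"
        using elim \<kappa>[of x] by simp
      finally show ?case ..
    qed
    then show ?thesis by (rule exI[where x = "\<lambda>j. c (fst j) (snd j)"])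
  qed
  show ?thesis
  proof (rule AE_orthonormal_generators[of "\<T> \<times> I" V \<Omega> g])
    show "finite (\<T> \<times> I)"
      using assms(1) finite_multi_indices unfolding I_def by blast
    show "V \<subseteq> L2 \<Omega>" unfolding V_def using fe_space_H10 H10_L2 by blast
    show "V \<noteq> {}" using assms(3) by (simp add: V_def)
  qed (use fe_space_add fe_space_scale rep in \<open>auto simp: V_def\<close>)
qed

text \<open>Here q t is the time derivative of e as a functional on H10, of norm at most \<gamma> t.
  Both hypotheses of \<open>increment_le_integral\<close> start from the convexity estimate with the
  fixed test function e t: the Young inequality 2 q r (e t) \<le> \<gamma>(r)^2 + ||e(t)||^2 in the
  H1 norm gives the crude bound for all h, and replacing e t by a value of an approximating simple
  function gives the sharp bound for small h.\<close>

lemma energy_inequality: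
  assumes "T > 0"
    and e_cont: "\<And>t. t \<in> {0..T} \<Longrightarrow> e t \<in> L2 \<Omega>"
      "\<And>t. t \<in> {0..T} \<Longrightarrow> ((\<lambda>r. L2_norm \<Omega> (\<lambda>x. e r x - e t x)) \<longlongrightarrow> 0) (at t within {0..T})"
    and approx: "H10.approximable T e s"
    and e_int: "integrable (lebesgue_on {0<..<T}) (\<lambda>t. (H1_norm \<Omega> (e t))\<^sup>2)"
    and \<gamma>_int: "integrable (lebesgue_on {0<..<T}) (\<lambda>t. (\<gamma> t)\<^sup>2)"
    and \<gamma>_nonneg: "\<And>t. 0 \<le> \<gamma> t"
    and q_bound: "AE t in lebesgue_on {0<..<T}. \<forall>v\<in>H10 \<Omega>. \<bar>q t v\<bar> \<le> \<gamma> t * H1_norm \<Omega> v"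
    and q_diff: "AE t in lebesgue_on {0<..<T}. \<forall>v\<in>H10 \<Omega>. \<forall>w\<in>H10 \<Omega>. q t (\<lambda>x. v x - w x) = q t v - q t w"
    and q_meas: "\<And>v. v \<in> H10 \<Omega> \<Longrightarrow> (\<lambda>t. q t v) \<in> borel_measurable (lebesgue_on {0<..<T})"
    and weak: "\<And>\<eta> v. \<eta> \<in> test_functions {0<..<T} \<Longrightarrow> v \<in> H10 \<Omega> \<Longrightarrow>
      (LINT t|lebesgue_on {0<..<T}. deriv \<eta> t * L2_inner \<Omega> (e t) v)
        = - (LINT t|lebesgue_on {0<..<T}. \<eta> t * q t v)"
    and H_int: "integrable (lebesgue_on {0<..<T}) H"
    and H: "AE t in lebesgue_on {0<..<T}. 2 * q t (e t) \<le> H t"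
    and b: "b \<in> {0..T}"
  shows "(L2_norm \<Omega> (e b))\<^sup>2 - (L2_norm \<Omega> (e 0))\<^sup>2 \<le> integral {0..b} H"
proof -
  let ?N = "H1_norm \<Omega>"
  have q_int: "integrable (lebesgue_on {0<..<T}) (\<lambda>t. q t v)" if v: "v \<in> H10 \<Omega>" for v
  proof (rule integrable_bound_AE[OF _ q_meas[OF v]])
    have "finite_measure (lebesgue_on {0<..<T})"
      by (rule finite_measure_lebesgue_on) auto
    then show "integrable (lebesgue_on {0<..<T}) (\<lambda>t. (\<gamma> t)\<^sup>2 + (?N v)\<^sup>2)"
      by (intro Bochner_Integration.integrable_add \<gamma>_int finite_measure.integrable_const)
    show "AE t in lebesgue_on {0<..<T}. \<bar>q t v\<bar> \<le> (\<gamma> t)\<^sup>2 + (?N v)\<^sup>2"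
      using q_bound
    proof eventually_elim
      case (elim t)
      then have "\<bar>q t v\<bar> \<le> \<gamma> t * ?N v" using v by blast
      moreover have "2 * (\<gamma> t * ?N v) \<le> (\<gamma> t)\<^sup>2 + (?N v)\<^sup>2"
        using sum_squares_bound[of "\<gamma> t" "?N v"] by (simp add: mult.assoc)
      moreover have "0 \<le> \<gamma> t * ?N v" using \<gamma>_nonneg H10.norm_nonneg by simp
      ultimately show ?case by linarith
    qed
  qed
  have incr: "L2_inner \<Omega> (e t) v - L2_inner \<Omega> (e r) v = integral {r..t} (\<lambda>r. q r v)"
    if "v \<in> H10 \<Omega>" "0 < r" "r < t" "t < T" for v r t
  proof (rule weak_derivative_imp_integral[OF _ q_int[OF that(1)] weak[OF _ that(1)] that(2-4)])
    show "continuous_on {0..T} (\<lambda>t. L2_inner \<Omega> (e t) v)"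
      using e_cont H10_L2[OF that(1)] by (intro L2.inner_continuous_on)
  qed
  have conv: "integrable (lebesgue_on {0..T}) g" if "integrable (lebesgue_on {0<..<T}) g" for g :: "real \<Rightarrow> real"
    using that by (simp add: integrable_lebesgue_on_Ioo_iff)
  have mono: "integral {c..d} g1 \<le> integral {c..d} g2"
    if "integrable (lebesgue_on {0<..<T}) g1" "integrable (lebesgue_on {0<..<T}) g2"
      "AE t in lebesgue_on {0<..<T}. g1 t \<le> g2 t" "0 \<le> c" "d \<le> T" for c d and g1 g2 :: "real \<Rightarrow> real"
  proof -
    have "AE t in lebesgue_on {0..T}. g1 t \<le> g2 t"
      using that(3) by (simp add: AE_lebesgue_on_Ioo_iff)
    then have "AE t in lebesgue. t \<in> {0..T} \<longrightarrow> g1 t \<le> g2 t"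
      by (subst (asm) AE_restrict_space_iff) auto
    then have "AE t in lebesgue. t \<in> {c..d} \<longrightarrow> g1 t \<le> g2 t"
      by eventually_elim (use that(4,5) in auto)
    then have "AE t in lebesgue_on {c..d}. g1 t \<le> g2 t"
      by (subst AE_restrict_space_iff) auto
    then have "integral\<^sup>L (lebesgue_on {c..d}) g1 \<le> integral\<^sup>L (lebesgue_on {c..d}) g2"
      by (intro integral_mono_AE integrable_on_of_lebesgue_on(1)[OF conv[OF that(1)]]
          integrable_on_of_lebesgue_on(1)[OF conv[OF that(2)]] that)
    then show ?thesis
      by (simp only: integrable_on_of_lebesgue_on(3)[OF conv[OF that(1)] that(4,5)]
          integrable_on_of_lebesgue_on(3)[OF conv[OF that(2)] that(4,5)])
  qed
  have convex: "(L2_norm \<Omega> (e t))\<^sup>2 - (L2_norm \<Omega> (e (t - h)))\<^sup>2 \<le> 2 * integral {t - h..t} (\<lambda>r. q r (e t))"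
    if "e t \<in> H10 \<Omega>" "0 < h" "h < t" "t < T" for t h
  proof -
    have L2: "e t \<in> L2 \<Omega>" "e (t - h) \<in> L2 \<Omega>"
      using that e_cont(1) by auto
    have "0 \<le> (L2_norm \<Omega> (\<lambda>x. e t x - e (t - h) x))\<^sup>2" by simp
    also have "\<dots> = (L2_norm \<Omega> (e t))\<^sup>2 - 2 * L2_inner \<Omega> (e (t - h)) (e t) + (L2_norm \<Omega> (e (t - h)))\<^sup>2"
      using L2 by (simp add: L2.norm_sq L2.diff_left L2.diff_right L2.diff_closed L2_inner_commute[of \<Omega> "e t" "e (t - h)"])
    finally show ?thesis
      using incr[OF that(1), of "t - h" t] that by (simp add: L2.norm_sq)
  qed
  have e_H10: "AE t in lebesgue_on {0<..<T}. t \<in> {0<..<T} \<and> e t \<in> H10 \<Omega> \<and> (\<forall>n. s n t \<in> H10 \<Omega>)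
      \<and> (\<lambda>n. ?N (\<lambda>x. e t x - s n t x)) \<longlonglongrightarrow> 0"
    using H10.approximableD(3)[OF approx] .
  \<comment> \<open>Lebesgue differentiation of \<open>q r v\<close> has an exceptional set
    depending on v. The union over the countably many v in D is still null, and the values s n t
    approach e t, so elements of D can stand in for e t.\<close>
  define D where "D = (\<Union>n. s n ` {0<..<T})"
  have "countable D"
    unfolding D_def
  proof (rule countable_UN[OF countableI_type], rule countable_finite)
    show "finite (s n ` {0<..<T})" for n
      using H10.approximableD(1)[OF approx, of n] by (simp add: simple_function_def)
  qed
  have D_H10: "v \<in> H10 \<Omega>" if "v \<in> D" for v
    using that H10.approximableD(2)[OF approx] by (auto simp: D_def)
  have average: "AE t in lebesgue_on {0<..<T}. ((\<lambda>h. integral {t - h..t} g / h) \<longlongrightarrow> g t) (at_right 0)"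
    if "integrable (lebesgue_on {0<..<T}) g" for g :: "real \<Rightarrow> real"
  proof -
    have "integrable lebesgue (\<lambda>t. if t \<in> {0<..<T} then g t else 0)"
      using that by (subst Lebesgue_Measure.integrable_restrict_UNIV) auto
    from AE_left_average_tendsto[OF this]
    have "AE t in lebesgue. t \<in> {0<..<T} \<longrightarrow> ((\<lambda>h. integral {t - h..t} g / h) \<longlongrightarrow> g t) (at_right 0)"
    proof eventually_elim
      case (elim t)
      show ?case
      proof
        assume t: "t \<in> {0<..<T}"
        have "\<forall>\<^sub>F h in at_right 0. integral {t - h..t} (\<lambda>t. if t \<in> {0<..<T} then g t else 0) / h
            = integral {t - h..t} g / h"
          unfolding eventually_at_right_field
          by (intro exI[of _ t] conjI allI impI arg_cong2[where f = "(/)"] refl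
              Henstock_Kurzweil_Integration.integral_cong) (use t in auto)
        moreover have "((\<lambda>h. integral {t - h..t} (\<lambda>t. if t \<in> {0<..<T} then g t else 0) / h) \<longlongrightarrow> g t) (at_right 0)"
          using elim t by simp
        ultimately show "((\<lambda>h. integral {t - h..t} g / h) \<longlongrightarrow> g t) (at_right 0)"
          by (rule Lim_transform_eventually[rotated])
      qed
    qed
    then show ?thesis
      by (subst AE_restrict_space_iff) auto
  qed
  have average_D: "AE t in lebesgue_on {0<..<T}. \<forall>v\<in>D.
      ((\<lambda>h. integral {t - h..t} (\<lambda>r. q r v) / h) \<longlongrightarrow> q t v) (at_right 0)"
    using \<open>countable D\<close> by (intro AE_ball_countable[THEN iffD2] ballI average q_int D_H10)
  show ?thesis
  proof (rule increment_le_integral[where T = T and k = "\<lambda>t. (\<gamma> t)\<^sup>2" and m = "\<lambda>t. (?N (e t))\<^sup>2"])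
    show "continuous_on {0..T} (\<lambda>t. (L2_norm \<Omega> (e t))\<^sup>2)"
      using e_cont by (intro continuous_on_power L2.norm_continuous_on)
    show "integrable (lebesgue_on {0..T}) H" "integrable (lebesgue_on {0..T}) (\<lambda>t. (\<gamma> t)\<^sup>2)"
      "integrable (lebesgue_on {0..T}) (\<lambda>t. (?N (e t))\<^sup>2)"
      using H_int \<gamma>_int e_int by (auto intro: conv)
    show "0 \<le> b" "b \<le> T" using b by auto
    show "AE t in lebesgue_on {0..T}. \<forall>h>0. h < t \<longrightarrow> (L2_norm \<Omega> (e t))\<^sup>2 - (L2_norm \<Omega> (e (t - h)))\<^sup>2
        \<le> integral {t - h..t} (\<lambda>t. (\<gamma> t)\<^sup>2) + h * (?N (e t))\<^sup>2"
      unfolding AE_lebesgue_on_Ioo_iff[symmetric]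
      using e_H10
    proof eventually_elim
      case (elim t)
      show ?case
      proof (intro allI impI)
        fix h assume h: "0 < h" "h < t"
        have et: "e t \<in> H10 \<Omega>" and t: "0 < t" "t < T" using elim by auto
        have fin: "finite_measure (lebesgue_on {0<..<T})"
          by (rule finite_measure_lebesgue_on) auto
        have "(L2_norm \<Omega> (e t))\<^sup>2 - (L2_norm \<Omega> (e (t - h)))\<^sup>2 \<le> 2 * integral {t - h..t} (\<lambda>r. q r (e t))"
          by (rule convex[OF et h t(2)])
        also have "\<dots> = integral {t - h..t} (\<lambda>r. 2 * q r (e t))" by simp
        also have "\<dots> \<le> integral {t - h..t} (\<lambda>r. (\<gamma> r)\<^sup>2 + (?N (e t))\<^sup>2)"
        proof (rule mono)
          show "integrable (lebesgue_on {0<..<T}) (\<lambda>r. 2 * q r (e t))"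
            using q_int[OF et] by simp
          show "integrable (lebesgue_on {0<..<T}) (\<lambda>r. (\<gamma> r)\<^sup>2 + (?N (e t))\<^sup>2)"
            by (intro Bochner_Integration.integrable_add \<gamma>_int finite_measure.integrable_const fin)
          show "AE r in lebesgue_on {0<..<T}. 2 * q r (e t) \<le> (\<gamma> r)\<^sup>2 + (?N (e t))\<^sup>2"
            using q_bound
          proof eventually_elim
            case (elim r)
            then have "\<bar>q r (e t)\<bar> \<le> \<gamma> r * ?N (e t)" using et by blast
            then show ?case
              using sum_squares_bound[of "\<gamma> r" "?N (e t)"] by (simp add: mult.assoc)
          qed
        qed (use h t in auto)
        also have "\<dots> = integral {t - h..t} (\<lambda>r. (\<gamma> r)\<^sup>2) + integral {t - h..t} (\<lambda>r. (?N (e t))\<^sup>2)"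
          using h t integrable_on_of_lebesgue_on(2)[OF conv[OF \<gamma>_int], of "t - h" t]
          by (intro Henstock_Kurzweil_Integration.integral_add) auto
        also have "integral {t - h..t} (\<lambda>r. (?N (e t))\<^sup>2) = h * (?N (e t))\<^sup>2"
          using h by simp
        finally show "(L2_norm \<Omega> (e t))\<^sup>2 - (L2_norm \<Omega> (e (t - h)))\<^sup>2
          \<le> integral {t - h..t} (\<lambda>t. (\<gamma> t)\<^sup>2) + h * (?N (e t))\<^sup>2" .
      qed
    qed
    show "AE t in lebesgue_on {0..T}. \<forall>\<epsilon>>0. \<exists>d>0. \<forall>h>0. h < d \<longrightarrow>
        (L2_norm \<Omega> (e t))\<^sup>2 - (L2_norm \<Omega> (e (t - h)))\<^sup>2 \<le> h * (H t + \<epsilon>)"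
      unfolding AE_lebesgue_on_Ioo_iff[symmetric]
      using e_H10 average_D average[OF \<gamma>_int] q_bound q_diff H
    proof eventually_elim
      case (elim t)
      have et: "e t \<in> H10 \<Omega>" and t: "0 < t" "t < T" using elim(1) by auto
      show ?case
      proof (intro allI impI)
        fix \<epsilon> :: real assume "\<epsilon> > 0"
        \<comment> \<open>c collects the factors of \<delta>: 2 \<gamma>(t) from returning from q t
          v to q t (e t), and \<gamma>(t)^2 + 4 from the two averages, as 2 \<delta> + \<delta> +
          \<delta> (\<gamma>(t)^2 + 1).\<close>
        define c where "c = 2 * \<gamma> t + (\<gamma> t)\<^sup>2 + 4"
        have "c > 0" using \<gamma>_nonneg[of t] by (simp add: c_def add_nonneg_pos)
        define \<delta> where "\<delta> = \<epsilon> / c"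
        have "\<delta> > 0" using \<open>\<epsilon> > 0\<close> \<open>c > 0\<close> by (simp add: \<delta>_def)
        have "\<forall>\<^sub>F n in sequentially. ?N (\<lambda>x. e t x - s n t x) < \<delta>"
          using elim(1) \<open>\<delta> > 0\<close> by (auto dest: order_tendstoD)
        then obtain n where n: "?N (\<lambda>x. e t x - s n t x) < \<delta>"
          by (auto dest: eventually_happens)
        define v where "v = s n t"
        have v: "v \<in> H10 \<Omega>" "v \<in> D"
          using elim(1) unfolding v_def D_def by (blast, blast)
        have d: "(\<lambda>x. e t x - v x) \<in> H10 \<Omega>" using et v by (intro H10_diff)
        have Nd: "?N (\<lambda>x. e t x - v x) < \<delta>" using n by (simp add: v_def)
        have "\<forall>\<^sub>F h in at_right 0. integral {t - h..t} (\<lambda>r. q r v) / h < q t v + \<delta>"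
          using elim(2) v(2) \<open>\<delta> > 0\<close> by (intro order_tendstoD(2)[of _ "q t v"]) auto
        moreover have "\<forall>\<^sub>F h in at_right 0. integral {t - h..t} (\<lambda>r. (\<gamma> r)\<^sup>2) / h < (\<gamma> t)\<^sup>2 + 1"
          using elim(3) by (intro order_tendstoD(2)[of _ "(\<gamma> t)\<^sup>2"]) auto
        ultimately have "\<forall>\<^sub>F h in at_right 0. integral {t - h..t} (\<lambda>r. q r v) / h < q t v + \<delta> \<and>
            integral {t - h..t} (\<lambda>r. (\<gamma> r)\<^sup>2) / h < (\<gamma> t)\<^sup>2 + 1"
          by (rule eventually_conj)
        then obtain d0 where d0: "d0 > 0" "\<And>h. 0 < h \<Longrightarrow> h < d0 \<Longrightarrow>
            integral {t - h..t} (\<lambda>r. q r v) / h < q t v + \<delta> \<and>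
            integral {t - h..t} (\<lambda>r. (\<gamma> r)\<^sup>2) / h < (\<gamma> t)\<^sup>2 + 1"
          unfolding eventually_at_right_field by blast
        show "\<exists>d>0. \<forall>h>0. h < d \<longrightarrow>
            (L2_norm \<Omega> (e t))\<^sup>2 - (L2_norm \<Omega> (e (t - h)))\<^sup>2 \<le> h * (H t + \<epsilon>)"
        proof (intro exI[of _ "min d0 t"] conjI allI impI)
          fix h assume h: "0 < h" "h < min d0 t"
          have fin: "finite_measure (lebesgue_on {0<..<T})"
            by (rule finite_measure_lebesgue_on) auto
          have i1: "integrable (lebesgue_on {0<..<T}) (\<lambda>r. \<delta> * (1 + (\<gamma> r)\<^sup>2))"
            by (intro integrable_mult_right Bochner_Integration.integrable_add \<gamma>_int finite_measure.integrable_const fin)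
          have HK: "(\<lambda>r. q r v) integrable_on {t - h..t}" "(\<lambda>r. (\<gamma> r)\<^sup>2) integrable_on {t - h..t}"
            using h t by (auto intro!: integrable_on_of_lebesgue_on(2)[OF conv[OF q_int[OF v(1)]]]
              integrable_on_of_lebesgue_on(2)[OF conv[OF \<gamma>_int]])
          have q1: "integral {t - h..t} (\<lambda>r. q r v) \<le> h * (q t v + \<delta>)"
            using d0(2)[of h] h by (simp add: divide_less_eq mult.commute)
          have q2: "integral {t - h..t} (\<lambda>r. (\<gamma> r)\<^sup>2) \<le> h * ((\<gamma> t)\<^sup>2 + 1)"
            using d0(2)[of h] h by (simp add: divide_less_eq mult.commute)
          have "(L2_norm \<Omega> (e t))\<^sup>2 - (L2_norm \<Omega> (e (t - h)))\<^sup>2 \<le> 2 * integral {t - h..t} (\<lambda>r. q r (e t))"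
            using h by (intro convex[OF et _ _ t(2)]) auto
          also have "\<dots> = integral {t - h..t} (\<lambda>r. 2 * q r (e t))" by simp
          also have "\<dots> \<le> integral {t - h..t} (\<lambda>r. 2 * q r v + \<delta> * (1 + (\<gamma> r)\<^sup>2))"
          proof (rule mono)
            show "integrable (lebesgue_on {0<..<T}) (\<lambda>r. 2 * q r (e t))"
              using q_int[OF et] by simp
            show "integrable (lebesgue_on {0<..<T}) (\<lambda>r. 2 * q r v + \<delta> * (1 + (\<gamma> r)\<^sup>2))"
              by (intro Bochner_Integration.integrable_add i1 integrable_mult_right q_int v)
            show "AE r in lebesgue_on {0<..<T}. 2 * q r (e t) \<le> 2 * q r v + \<delta> * (1 + (\<gamma> r)\<^sup>2)"
              using q_bound q_diff
            proof eventually_elim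
              case (elim r)
              have "q r (e t) - q r v \<le> \<bar>q r (\<lambda>x. e t x - v x)\<bar>"
                using elim(2) et v(1) by simp
              also have "\<dots> \<le> \<gamma> r * ?N (\<lambda>x. e t x - v x)"
                using elim(1) d by blast
              also have "\<dots> \<le> \<gamma> r * \<delta>"
                using Nd \<gamma>_nonneg[of r] by (intro mult_left_mono) auto
              finally have "2 * (q r (e t) - q r v) \<le> \<delta> * (2 * \<gamma> r)"
                by (simp add: algebra_simps)
              \<comment> \<open>The linear term in \<gamma> is traded for its square, whose averages
                over [t - h, t] are under control.\<close>
              also have "\<dots> \<le> \<delta> * (1 + (\<gamma> r)\<^sup>2)"
                using sum_squares_bound[of 1 "\<gamma> r"] \<open>\<delta> > 0\<close> by (intro mult_left_mono) auto
              finally show ?case by simp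
            qed
          qed (use h t in auto)
          also have "\<dots> = 2 * integral {t - h..t} (\<lambda>r. q r v) + \<delta> * (h + integral {t - h..t} (\<lambda>r. (\<gamma> r)\<^sup>2))"
          proof -
            have "((\<lambda>r. 2 * q r v + \<delta> * (1 + (\<gamma> r)\<^sup>2)) has_integral
                (2 * integral {t - h..t} (\<lambda>r. q r v) + \<delta> * (measure lborel {t - h..t} *\<^sub>R 1 + integral {t - h..t} (\<lambda>r. (\<gamma> r)\<^sup>2))))
                {t - h..t}"
              using HK by (intro has_integral_add has_integral_mult_right integrable_integral has_integral_const_real)
            then show ?thesis using h by (simp add: integral_unique)
          qed
          also have "\<dots> \<le> 2 * (h * (q t v + \<delta>)) + \<delta> * (h + h * ((\<gamma> t)\<^sup>2 + 1))"
            using q1 q2 \<open>\<delta> > 0\<close> by (intro add_mono mult_left_mono) auto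
          also have "\<dots> = h * (2 * q t v + \<delta> * ((\<gamma> t)\<^sup>2 + 4))"
            by (simp add: algebra_simps)
          also have "\<dots> \<le> h * (H t + \<epsilon>)"
          proof (rule mult_left_mono)
            have "q t v - q t (e t) \<le> \<bar>q t (\<lambda>x. e t x - v x)\<bar>"
              using elim(5) et v(1) by simp
            also have "\<dots> \<le> \<gamma> t * ?N (\<lambda>x. e t x - v x)"
              using elim(4) d by blast
            also have "\<dots> \<le> \<gamma> t * \<delta>"
              using Nd \<gamma>_nonneg[of t] by (intro mult_left_mono) auto
            finally have "2 * q t v \<le> 2 * q t (e t) + \<delta> * (2 * \<gamma> t)"
              by (simp add: algebra_simps)
            moreover have "\<delta> * (2 * \<gamma> t) + \<delta> * ((\<gamma> t)\<^sup>2 + 4) = \<epsilon>"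
            proof -
              have "\<delta> * c = \<epsilon>" using \<open>c > 0\<close> by (simp add: \<delta>_def)
              then show ?thesis by (simp add: c_def algebra_simps)
            qed
            ultimately show "2 * q t v + \<delta> * ((\<gamma> t)\<^sup>2 + 4) \<le> H t + \<epsilon>"
              using elim(6) by linarith
          qed (use h in simp)
          finally show "(L2_norm \<Omega> (e t))\<^sup>2 - (L2_norm \<Omega> (e (t - h)))\<^sup>2 \<le> h * (H t + \<epsilon>)" .
        qed (use d0(1) t in auto)
      qed
    qed
  qed
qed

end

section \<open>The semidiscrete scheme\<close>

lemma tendsto_0_of_le_mult:
  fixes g h :: "real \<Rightarrow> real"
  assumes "(h \<longlongrightarrow> 0) (at t within I)" "\<And>r. r \<in> I \<Longrightarrow> 0 \<le> g r" "\<And>r. r \<in> I \<Longrightarrow> g r \<le> C * h r"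
  shows "(g \<longlongrightarrow> 0) (at t within I)"
proof (rule Lim_null_comparison)
  show "\<forall>\<^sub>F r in at t within I. norm (g r) \<le> C * h r"
    using assms(2,3) by (auto simp: eventually_at_filter)
  show "((\<lambda>r. C * h r) \<longlongrightarrow> 0) (at t within I)"
    using tendsto_mult[OF tendsto_const assms(1), of C] by simp
qed

text \<open>\<open>weak_time_derivative\<close> is phrased with \<open>deriv\<close>, smoothness of
  test functions with \<open>frechet_derivative\<close>.\<close>

lemma deriv_test_function:
  fixes \<eta> :: "real \<Rightarrow> real"
  assumes "\<eta> \<in> test_functions S"
  shows "deriv \<eta> t = frechet_derivative \<eta> (at t) 1"
proof -
  have der: "(\<eta> has_derivative frechet_derivative \<eta> (at t)) (at t)"
    using assms by (rule test_function_has_derivative)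
  have "frechet_derivative \<eta> (at t) = (*) (frechet_derivative \<eta> (at t) 1)"
  proof
    show "frechet_derivative \<eta> (at t) h = frechet_derivative \<eta> (at t) 1 * h" for h
      using linear_scale[OF has_derivative_linear[OF der], of h 1] by simp
  qed
  with der have "(\<eta> has_real_derivative frechet_derivative \<eta> (at t) 1) (at t)"
    by (simp add: has_field_derivative_def)
  then show ?thesis by (rule DERIV_imp_deriv)
qed

text \<open>A finite-dimensional V, presented by an orthonormal family. The expansion in w holds
  only a.e., so its uses go through seminorms of the remainder that vanish.\<close>

locale discrete_space = open_domain +
  fixes V :: "('a \<Rightarrow> real) set" and k :: nat and w :: "nat \<Rightarrow> 'a \<Rightarrow> real"
  assumes V_H10: "V \<subseteq> H10 \<Omega>"
    and V_add: "v \<in> V \<Longrightarrow> v' \<in> V \<Longrightarrow> (\<lambda>x. v x + v' x) \<in> V"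
    and V_scale: "v \<in> V \<Longrightarrow> (\<lambda>x. c * v x) \<in> V"
    and w_V: "j < k \<Longrightarrow> w j \<in> V"
    and w_orthonormal: "i < k \<Longrightarrow> j < k \<Longrightarrow> L2_inner \<Omega> (w i) (w j) = of_bool (i = j)"
    and w_generates: "v \<in> V \<Longrightarrow> AE x in lebesgue_on \<Omega>. v x = (\<Sum>j<k. L2_inner \<Omega> v (w j) * w j x)"
begin

lemma V_memD: "v \<in> V \<Longrightarrow> v \<in> H10 \<Omega>" "v \<in> V \<Longrightarrow> v \<in> H1 \<Omega>" "v \<in> V \<Longrightarrow> v \<in> L2 \<Omega>"
  using V_H10 H10_H1 H10_L2 by blast+

sublocale V: semi_inner V "L2_inner \<Omega>" "L2_norm \<Omega>"
proof
  show "L2_inner \<Omega> v v' = L2_inner \<Omega> v' v" for v v' by (rule L2_inner_commute)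
  show "L2_norm \<Omega> v = sqrt (L2_inner \<Omega> v v)" for v by (rule L2_norm_def)
qed (auto intro: V_add V_scale V_memD simp: L2.add_left L2.scale_left V_memD L2_inner_nonneg)

lemma coefficient_le:
  assumes "v \<in> V" "j < k"
  shows "\<bar>L2_inner \<Omega> v (w j)\<bar> \<le> L2_norm \<Omega> v"
proof -
  have "L2_norm \<Omega> (w j) = 1"
    using w_orthonormal[OF assms(2,2)] by (simp add: L2_norm_def)
  then show ?thesis
    using V.Cauchy_Schwarz[OF assms(1) w_V[OF assms(2)]] by simp
qed

text \<open>Equivalence of norms in finite dimension: each coefficient in the orthonormal expansion
  is at most the L2 norm.\<close>

lemma H1_norm_le_L2_norm:
  assumes "v \<in> V"
  shows "H1_norm \<Omega> v \<le> (\<Sum>j<k. H1_norm \<Omega> (w j)) * L2_norm \<Omega> v"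
proof -
  define z where "z x = (\<Sum>j<k. L2_inner \<Omega> v (w j) * w j x)" for x
  have z: "z \<in> H10 \<Omega>"
    unfolding z_def[abs_def] using zero_H10 by (intro H10.sum_closed V_memD w_V) auto
  have v: "v \<in> H10 \<Omega>" using assms by (rule V_memD)
  have "H1_norm \<Omega> (\<lambda>x. v x - z x) = 0"
    using w_generates[OF assms] v z unfolding z_def by (intro norm_diff_eq_0_of_AE_eq(2)) (auto intro: H10_H1)
  moreover have "H1_norm \<Omega> v \<le> H1_norm \<Omega> (\<lambda>x. v x - z x) + H1_norm \<Omega> z"
    using H10.norm_triangle[OF H10.diff_closed[OF v z] z] by simp
  moreover have "H1_norm \<Omega> z \<le> (\<Sum>j<k. \<bar>L2_inner \<Omega> v (w j)\<bar> * H1_norm \<Omega> (w j))"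
    unfolding z_def[abs_def] using zero_H10 by (intro H10.norm_sum_le V_memD w_V) auto
  moreover have "\<dots> \<le> (\<Sum>j<k. L2_norm \<Omega> v * H1_norm \<Omega> (w j))"
    using coefficient_le[OF assms] by (intro sum_mono mult_right_mono H10.norm_nonneg) auto
  ultimately show ?thesis
    by (simp add: sum_distrib_left mult.commute)
qed

text \<open>Testing with v itself shows that v has norm 0. Hence an equation tested within V whose
  residual lies in V may be tested with every function of L2; this carries the scheme over to test
  functions in H10.\<close>

lemma L2_inner_eq_0:
  assumes "v \<in> V" "\<And>\<Phi>. \<Phi> \<in> V \<Longrightarrow> L2_inner \<Omega> v \<Phi> = 0" "\<phi> \<in> L2 \<Omega>"
  shows "L2_inner \<Omega> v \<phi> = 0"
proof -
  have "L2_norm \<Omega> v = 0"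
    using assms(2)[OF assms(1)] by (simp add: L2_norm_def)
  then show ?thesis
    using L2.Cauchy_Schwarz[OF V_memD(3)[OF assms(1)] assms(3)] by simp
qed

text \<open>R and A are fixed only up to null sets and need not be linear as maps of functions, so
  differences have to be treated directly. The proof shows linearity modulo functions of zero energy
  and expands v - v' in the family w.\<close>

lemma reconstruction_diff_le:
  assumes A: "discrete_laplacian \<Omega> V A" and R: "elliptic_reconstruction \<Omega> V A R" and v: "v \<in> V" "v' \<in> V"
  shows "energy_norm \<Omega> (\<lambda>x. R v x - R v' x)
    \<le> (\<Sum>j<k. energy_norm \<Omega> (R (w j))) * L2_norm \<Omega> (\<lambda>x. v x - v' x)"
proof -
  have AV: "A z \<in> V" and A_eq: "\<And>\<Phi>. \<Phi> \<in> V \<Longrightarrow> L2_inner \<Omega> (A z) \<Phi> = energy \<Omega> z \<Phi>" if "z \<in> V" for z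
    using A that by (auto simp: discrete_laplacian_def)
  have RH: "R z \<in> H10 \<Omega>" and R_eq: "\<And>\<phi>. \<phi> \<in> H10 \<Omega> \<Longrightarrow> energy \<Omega> (R z) \<phi> = L2_inner \<Omega> (A z) \<phi>" if "z \<in> V" for z
    using R that by (auto simp: elliptic_reconstruction_def)
  note mem = V_memD(2) H10_H1[OF RH] v w_V
  define d where "d x = v x - v' x" for x
  have d: "d \<in> V" unfolding d_def[abs_def] using v by (rule V.diff_closed)
  define c where "c j = L2_inner \<Omega> d (w j)" for j
  have H1ne: "H1 \<Omega> \<noteq> {}" and H10ne: "H10 \<Omega> \<noteq> {}" and Vne: "V \<noteq> {}" and L2ne: "L2 \<Omega> \<noteq> ({} :: ('a \<Rightarrow> real) set)"
    using zero_H10 H10_H1 d H10_L2 by blast+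
  define y where "y x = (\<Sum>j<k. c j * R (w j) x)" for x
  define yA where "yA x = (\<Sum>j<k. c j * A (w j) x)" for x
  define z where "z x = (\<Sum>j<k. c j * w j x)" for x
  have y: "y \<in> H10 \<Omega>"
    unfolding y_def[abs_def] by (intro H10.sum_closed H10ne RH w_V) auto
  have yA: "yA \<in> V"
    unfolding yA_def[abs_def] by (intro V.sum_closed Vne AV w_V) auto
  have z: "z \<in> V"
    unfolding z_def[abs_def] by (intro V.sum_closed Vne w_V) auto
  define RX where "RX x = R v x - R v' x" for x
  have RX: "RX \<in> H10 \<Omega>" unfolding RX_def[abs_def] using v by (intro H10.diff_closed RH)
  define AX where "AX x = A v x - A v' x" for x
  have AX: "AX \<in> V" unfolding AX_def[abs_def] using v by (intro V.diff_closed AV)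
  \<comment> \<open>X and Z below measure the failure of linearity of R and of A on the expansion of
    v - v'. Z lies in V and is orthogonal to V, hence to X; and the squared energy norm of X is the
    L2 inner product of Z and X.\<close>
  define X where "X x = RX x - y x" for x
  have X: "X \<in> H10 \<Omega>" unfolding X_def[abs_def] using RX y by (rule H10.diff_closed)
  define Z where "Z x = AX x - yA x" for x
  have Z: "Z \<in> V" unfolding Z_def[abs_def] using AX yA by (rule V.diff_closed)
  have Z0: "L2_inner \<Omega> Z \<Phi> = 0" if \<Phi>: "\<Phi> \<in> V" for \<Phi>
  proof -
    have "L2_inner \<Omega> Z \<Phi> = L2_inner \<Omega> AX \<Phi> - L2_inner \<Omega> yA \<Phi>"
      unfolding Z_def[abs_def] using AX yA \<Phi> by (rule V.diff_left)
    also have "L2_inner \<Omega> AX \<Phi> = energy \<Omega> v \<Phi> - energy \<Omega> v' \<Phi>"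
      unfolding AX_def[abs_def] using v \<Phi> by (simp add: V.diff_left AV A_eq)
    also have "\<dots> = energy \<Omega> d \<Phi>"
      unfolding d_def[abs_def] using v \<Phi> by (simp add: energy.diff_left V_memD)
    also have "L2_inner \<Omega> yA \<Phi> = (\<Sum>j<k. c j * L2_inner \<Omega> (A (w j)) \<Phi>)"
      unfolding yA_def[abs_def] using \<Phi> by (intro V.sum_left Vne AV w_V) auto
    also have "\<dots> = (\<Sum>j<k. c j * energy \<Omega> (w j) \<Phi>)"
      using \<Phi> by (intro sum.cong refl) (simp add: A_eq w_V)
    also have "\<dots> = energy \<Omega> z \<Phi>"
      unfolding z_def[abs_def] using \<Phi> by (intro energy.sum_left[symmetric] H1ne V_memD(2) w_V) auto
    also have "energy \<Omega> d \<Phi> - energy \<Omega> z \<Phi> = energy \<Omega> (\<lambda>x. d x - z x) \<Phi>"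
      using d z \<Phi> by (simp add: energy.diff_left V_memD)
    also have "energy_norm \<Omega> (\<lambda>x. d x - z x) = 0"
      using w_generates[OF d] d z unfolding z_def c_def by (intro norm_diff_eq_0_of_AE_eq(1)) (auto intro: V_memD)
    then have "energy \<Omega> (\<lambda>x. d x - z x) \<Phi> = 0"
      using energy.Cauchy_Schwarz[OF energy.diff_closed, of d z \<Phi>] d z \<Phi> by (simp add: V_memD)
    finally show ?thesis .
  qed
  have "(energy_norm \<Omega> X)\<^sup>2 = energy \<Omega> RX X - energy \<Omega> y X"
    using RX y X unfolding energy.norm_sq by (subst X_def[abs_def]) (intro energy.diff_left H10_H1)
  also have "energy \<Omega> RX X = L2_inner \<Omega> AX X"
    unfolding RX_def[abs_def] AX_def[abs_def] using v X
    by (simp add: energy.diff_left L2.diff_left R_eq RH H10_H1 AV V_memD H10_L2)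
  also have "energy \<Omega> y X = (\<Sum>j<k. c j * energy \<Omega> (R (w j)) X)"
    unfolding y_def[abs_def] using X by (intro energy.sum_left H1ne H10_H1 RH w_V) auto
  also have "\<dots> = (\<Sum>j<k. c j * L2_inner \<Omega> (A (w j)) X)"
    using X by (intro sum.cong refl) (simp add: R_eq w_V)
  also have "\<dots> = L2_inner \<Omega> yA X"
    unfolding yA_def[abs_def] using X
    by (intro L2.sum_left[symmetric] L2ne V_memD(3) AV w_V H10_L2) auto
  also have "L2_inner \<Omega> AX X - L2_inner \<Omega> yA X = L2_inner \<Omega> Z X"
    unfolding Z_def[abs_def] using AX yA X by (intro L2.diff_left[symmetric] V_memD(3) H10_L2)
  also have "\<dots> = 0"
    using Z Z0 H10_L2[OF X] by (rule L2_inner_eq_0)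
  finally have X0: "energy_norm \<Omega> X = 0" by simp
  have "energy_norm \<Omega> RX \<le> energy_norm \<Omega> X + energy_norm \<Omega> y"
    using energy.norm_triangle[OF H10_H1[OF X] H10_H1[OF y]] by (simp add: X_def[abs_def])
  also have "\<dots> \<le> (\<Sum>j<k. \<bar>c j\<bar> * energy_norm \<Omega> (R (w j)))"
    unfolding X0 y_def[abs_def] using energy.norm_sum_le[OF H1ne, of "{..<k}" "\<lambda>j. R (w j)" c]
    by (simp add: H10_H1 RH w_V)
  also have "\<dots> \<le> (\<Sum>j<k. L2_norm \<Omega> d * energy_norm \<Omega> (R (w j)))"
    using coefficient_le[OF d] unfolding c_def by (intro sum_mono mult_right_mono energy.norm_nonneg) auto
  finally show ?thesis
    by (simp add: sum_distrib_left mult.commute RX_def[abs_def] d_def[abs_def])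
qed

text \<open>P need not be linear as a map of functions, so contraction is shown for differences, by
  testing with the difference D of the two projections, which lies in V.\<close>

lemma L2_projection_diff_le:
  assumes P: "L2_projection \<Omega> V P" and v: "v \<in> L2 \<Omega>" "v' \<in> L2 \<Omega>"
  shows "L2_norm \<Omega> (\<lambda>x. P v x - P v' x) \<le> L2_norm \<Omega> (\<lambda>x. v x - v' x)"
proof -
  have PV: "P z \<in> V" and P_eq: "\<And>\<Phi>. \<Phi> \<in> V \<Longrightarrow> L2_inner \<Omega> (P z) \<Phi> = L2_inner \<Omega> z \<Phi>" if "z \<in> L2 \<Omega>" for z
    using P that by (auto simp: L2_projection_def)
  define D where "D x = P v x - P v' x" for x
  have D: "D \<in> V" unfolding D_def[abs_def] using v by (intro V.diff_closed PV)
  have "(L2_norm \<Omega> D)\<^sup>2 = L2_inner \<Omega> (P v) D - L2_inner \<Omega> (P v') D"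
    unfolding V.norm_sq using v D by (subst D_def[abs_def]) (intro V.diff_left PV)
  also have "\<dots> = L2_inner \<Omega> (\<lambda>x. v x - v' x) D"
    using v D by (simp add: P_eq L2.diff_left V_memD)
  also have "\<dots> \<le> L2_norm \<Omega> (\<lambda>x. v x - v' x) * L2_norm \<Omega> D"
    using L2.Cauchy_Schwarz[OF L2.diff_closed[OF v] V_memD(3)[OF D]] by simp
  finally have "L2_norm \<Omega> D * L2_norm \<Omega> D \<le> L2_norm \<Omega> (\<lambda>x. v x - v' x) * L2_norm \<Omega> D"
    by (simp add: power2_eq_square)
  then show ?thesis
    using L2.norm_nonneg[of \<Omega> D] L2.norm_nonneg[of \<Omega> "\<lambda>x. v x - v' x"]
    by (cases "L2_norm \<Omega> D = 0") (auto simp: D_def[abs_def])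
qed

lemma L2_projection_le:
  assumes P: "L2_projection \<Omega> V P" and v: "v \<in> L2 \<Omega>"
  shows "L2_norm \<Omega> (P v) \<le> L2_norm \<Omega> v"
proof -
  have PV: "P v \<in> V" and P_eq: "L2_inner \<Omega> (P v) (P v) = L2_inner \<Omega> v (P v)"
    using P v by (auto simp: L2_projection_def)
  have "L2_norm \<Omega> (P v) * L2_norm \<Omega> (P v) \<le> L2_norm \<Omega> v * L2_norm \<Omega> (P v)"
    using L2.Cauchy_Schwarz[OF v V_memD(3)[OF PV]] V.norm_sq[of "P v"] P_eq by (simp add: power2_eq_square)
  then show ?thesis
    using L2.norm_nonneg[of \<Omega> "P v"] L2.norm_nonneg[of \<Omega> v]
    by (cases "L2_norm \<Omega> (P v) = 0") auto
qed

end

section \<open>Measurability and integrability in time\<close>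

context open_domain
begin

lemma approximable_H10_energy:
  assumes "H10.approximable T g s"
  shows "energy.approximable T g s"
proof (rule energy.approximableI)
  show "AE t in lebesgue_on {0<..<T}. g t \<in> H1 \<Omega> \<and> (\<lambda>n. energy_norm \<Omega> (\<lambda>x. g t x - s n t x)) \<longlonglongrightarrow> 0"
    using H10.approximableD(3)[OF assms]
  proof eventually_elim
    case (elim t)
    have "(\<lambda>n. energy_norm \<Omega> (\<lambda>x. g t x - s n t x)) \<longlonglongrightarrow> 0"
      by (rule Lim_null_comparison[where g = "\<lambda>n. H1_norm \<Omega> (\<lambda>x. g t x - s n t x)"])
        (simp_all add: elim energy.norm_nonneg energy_norm_le_H1_norm)
    with elim H10_H1 show ?case by blast
  qed
qed (use H10.approximableD[OF assms] H10_H1 in blast)+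

lemma approximable_H10_L2:
  assumes "H10.approximable T g s"
  shows "L2.approximable \<Omega> T g s"
proof (rule L2.approximableI)
  show "AE t in lebesgue_on {0<..<T}. g t \<in> L2 \<Omega> \<and> (\<lambda>n. L2_norm \<Omega> (\<lambda>x. g t x - s n t x)) \<longlonglongrightarrow> 0"
    using H10.approximableD(3)[OF assms]
  proof eventually_elim
    case (elim t)
    have "(\<lambda>n. L2_norm \<Omega> (\<lambda>x. g t x - s n t x)) \<longlonglongrightarrow> 0"
      by (rule Lim_null_comparison[where g = "\<lambda>n. H1_norm \<Omega> (\<lambda>x. g t x - s n t x)"])
        (simp_all add: elim L2.norm_nonneg L2_norm_le_H1_norm)
    with elim H10_L2 show ?case by blast
  qed
qed (use H10.approximableD[OF assms] H10_L2 in blast)+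

end

lemma integrable_test_function_mult:
  fixes \<eta> :: "real \<Rightarrow> real"
  assumes "\<eta> \<in> test_functions {0<..<T}" "integrable (lebesgue_on {0<..<T}) p"
  shows "integrable (lebesgue_on {0<..<T}) (\<lambda>t. \<eta> t * p t)"
proof -
  obtain K where "compact K" "\<And>x. x \<notin> K \<Longrightarrow> \<eta> x = 0"
    using test_functionsE[OF assms(1)] by metis
  then obtain M where M: "M \<ge> 0" "\<And>x. \<bar>\<eta> x\<bar> \<le> M"
    using bounded_of_compact_support[OF test_function_continuous[OF assms(1)]] by metis
  have [measurable]: "\<eta> \<in> borel_measurable (lebesgue_on {0<..<T})"
    by (intro continuous_imp_measurable_on_sets_lebesgue test_function_continuous[OF assms(1)]) simp
  note [measurable] = borel_measurable_integrable[OF assms(2)]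
  show ?thesis
  proof (rule integrable_bound_AE)
    show "integrable (lebesgue_on {0<..<T}) (\<lambda>t. M * \<bar>p t\<bar>)" using assms(2) by simp
    show "AE t in lebesgue_on {0<..<T}. \<bar>\<eta> t * p t\<bar> \<le> M * \<bar>p t\<bar>"
      using M by (intro AE_I2) (simp add: abs_mult mult_right_mono)
  qed measurable
qed

lemma Bochner_L2_integrable:
  "g \<in> Bochner_L2 T X N \<Longrightarrow> integrable (lebesgue_on {0<..<T}) (\<lambda>t. (N (g t))\<^sup>2)"
  by (simp add: Bochner_L2_def)

lemma Bochner_L2_AE: "g \<in> Bochner_L2 T X N \<Longrightarrow> AE t in lebesgue_on {0<..<T}. g t \<in> X"
  by (simp add: Bochner_L2_def strongly_measurable_def)

lemma (in semi_inner) Bochner_L2_approximable: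
  assumes "g \<in> Bochner_L2 T S N"
  shows "\<exists>s. approximable T g s"
proof -
  obtain s where s: "\<And>n. simple_function (lebesgue_on {0<..<T}) (s n)" "\<And>n. s n ` {0<..<T} \<subseteq> S"
    "AE t in lebesgue_on {0<..<T}. (\<lambda>n. N (g t - s n t)) \<longlonglongrightarrow> 0"
    using assms unfolding Bochner_L2_def strongly_measurable_def by blast
  have "AE t in lebesgue_on {0<..<T}. g t \<in> S \<and> (\<lambda>n. N (\<lambda>x. g t x - s n t x)) \<longlonglongrightarrow> 0"
    using Bochner_L2_AE[OF assms] s(3) by eventually_elim (simp add: fun_diff_def)
  then have "approximable T g s"
    using s(1,2) by (intro approximableI) blast+
  then show ?thesis by blast
qed

lemma (in semi_inner) inner_integrable:
  assumes "approximable T g s" "approximable T h r"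
    and "integrable (lebesgue_on {0<..<T}) (\<lambda>t. (N (g t))\<^sup>2)" "integrable (lebesgue_on {0<..<T}) (\<lambda>t. (N (h t))\<^sup>2)"
  shows "integrable (lebesgue_on {0<..<T}) (\<lambda>t. B (g t) (h t))"
proof (rule integrable_bound_AE[OF _ inner_measurable[OF assms(1,2)]])
  show "integrable (lebesgue_on {0<..<T}) (\<lambda>t. (N (g t))\<^sup>2 + (N (h t))\<^sup>2)"
    by (intro Bochner_Integration.integrable_add assms)
  show "AE t in lebesgue_on {0<..<T}. \<bar>B (g t) (h t)\<bar> \<le> (N (g t))\<^sup>2 + (N (h t))\<^sup>2"
    using approximableD(3)[OF assms(1)] approximableD(3)[OF assms(2)]
  proof eventually_elim
    case (elim t)
    have "0 \<le> N (g t) * N (h t)"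
      by (simp add: norm_nonneg)
    then show ?case
      using Cauchy_Schwarz[of "g t" "h t"] sum_squares_bound[of "N (g t)" "N (h t)"] elim by linarith
  qed
qed

lemma (in semi_inner) inner_const_integrable:
  assumes "approximable T g s" "integrable (lebesgue_on {0<..<T}) (\<lambda>t. (N (g t))\<^sup>2)" "v \<in> S"
  shows "integrable (lebesgue_on {0<..<T}) (\<lambda>t. B (g t) v)"
  using assms
  by (intro inner_integrable[OF assms(1) approximable_const] finite_measure.integrable_const
      finite_measure_lebesgue_on) auto

lemma power2_sum_le: "(x + y)\<^sup>2 \<le> 2 * x\<^sup>2 + 2 * y\<^sup>2" for x y :: real
  using sum_squares_bound[of x y] by (simp add: power2_sum)

lemma (in semi_inner) norm_sq_diff_integrable:
  assumes "approximable T g s" "approximable T h r"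
    and "integrable (lebesgue_on {0<..<T}) (\<lambda>t. (N (g t))\<^sup>2)" "integrable (lebesgue_on {0<..<T}) (\<lambda>t. (N (h t))\<^sup>2)"
  shows "integrable (lebesgue_on {0<..<T}) (\<lambda>t. (N (\<lambda>x. g t x - h t x))\<^sup>2)"
proof (rule integrable_bound_AE)
  note [measurable] = norm_measurable[OF approximable_diff[OF assms(1,2)]]
  show "(\<lambda>t. (N (\<lambda>x. g t x - h t x))\<^sup>2) \<in> borel_measurable (lebesgue_on {0<..<T})"
    by measurable
  show "integrable (lebesgue_on {0<..<T}) (\<lambda>t. 2 * (N (g t))\<^sup>2 + 2 * (N (h t))\<^sup>2)"
    using assms(3,4) by simp
  show "AE t in lebesgue_on {0<..<T}. \<bar>(N (\<lambda>x. g t x - h t x))\<^sup>2\<bar> \<le> 2 * (N (g t))\<^sup>2 + 2 * (N (h t))\<^sup>2"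
    using approximableD(3)[OF assms(1)] approximableD(3)[OF assms(2)]
  proof eventually_elim
    case (elim t)
    then have "(N (\<lambda>x. g t x - h t x))\<^sup>2 \<le> (N (g t) + N (h t))\<^sup>2"
      by (intro power_mono norm_triangle_diff norm_nonneg) auto
    also have "\<dots> \<le> 2 * (N (g t))\<^sup>2 + 2 * (N (h t))\<^sup>2" by (rule power2_sum_le)
    finally show ?case by simp
  qed
qed

section \<open>Error equation and energy estimate\<close>

context discrete_space
begin

lemma semidiscrete_error_estimate:
  assumes T: "T > 0" and f: "f \<in> Bochner_L2 T (L2 \<Omega>) (L2_norm \<Omega>)"
    and u: "heat_solution \<Omega> T u0 f u" and U: "semidiscrete_solution \<Omega> T V U0 f U"
    and A: "discrete_laplacian \<Omega> V A" and P0: "L2_projection \<Omega> V P0"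
    and R: "elliptic_reconstruction \<Omega> V A R"
    and b: "b \<in> {0..T}"
  defines "e \<equiv> \<lambda>t x. U t x - u t x" and "\<epsilon> \<equiv> \<lambda>t x. R (U t) x - U t x"
  shows "(L2_norm \<Omega> (e b))\<^sup>2 + (LINT s|lebesgue_on {0..b}. (energy_norm \<Omega> (e s))\<^sup>2)
      \<le> (L2_norm \<Omega> (e 0))\<^sup>2 + (LINT s|lebesgue_on {0..b}.
            (energy_norm \<Omega> (\<epsilon> s))\<^sup>2 + 2 * L2_inner \<Omega> (\<lambda>x. P0 (f s) x - f s x) (e s))"
proof -
  let ?M = "lebesgue_on {0<..<T}"
  let ?N = "H1_norm \<Omega>"
  define \<omega> where "\<omega> t = R (U t)" for t
  have AEI: "AE t in ?M. t \<in> {0<..<T}"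
    by (rule AE_I2) simp

  have UV: "U t \<in> V" if "t \<in> {0..T}" for t
    using U that by (simp add: semidiscrete_solution_def)
  have U_cont: "((\<lambda>r. L2_norm \<Omega> (\<lambda>x. U r x - U t x)) \<longlongrightarrow> 0) (at t within {0..T})" if "t \<in> {0..T}" for t
    using U that by (simp add: semidiscrete_solution_def continuous_L2_def fun_diff_def)
  have uL2: "u t \<in> L2 \<Omega>" if "t \<in> {0..T}" for t
    using u that by (simp add: heat_solution_def continuous_L2_def)
  have u_cont: "((\<lambda>r. L2_norm \<Omega> (\<lambda>x. u r x - u t x)) \<longlongrightarrow> 0) (at t within {0..T})" if "t \<in> {0..T}" for t
    using u that by (simp add: heat_solution_def continuous_L2_def fun_diff_def)
  have u_Bochner: "u \<in> Bochner_L2 T (H10 \<Omega>) (H1_norm \<Omega>)"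
    using u by (simp add: heat_solution_def)
  obtain u' where u': "weak_time_derivative \<Omega> T u u'"
    "AE t in ?M. \<forall>\<phi>\<in>H10 \<Omega>. u' t \<phi> + energy \<Omega> (u t) \<phi> = L2_inner \<Omega> (f t) \<phi>"
    using u unfolding heat_solution_def by blast
  obtain U' where U'_B: "U' \<in> Bochner_L2 T V (L2_norm \<Omega>)"
    and U': "weak_time_derivative \<Omega> T U (\<lambda>t. L2_inner \<Omega> (U' t))"
    "AE t in ?M. \<forall>\<Phi>\<in>V. L2_inner \<Omega> (U' t) \<Phi> + energy \<Omega> (U t) \<Phi> = L2_inner \<Omega> (f t) \<Phi>"
    using U unfolding semidiscrete_solution_def by blast
  have RH: "R v \<in> H10 \<Omega>" and R_eq: "\<And>\<phi>. \<phi> \<in> H10 \<Omega> \<Longrightarrow> energy \<Omega> (R v) \<phi> = L2_inner \<Omega> (A v) \<phi>" if "v \<in> V" for v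
    using R that by (auto simp: elliptic_reconstruction_def)
  have AV: "A v \<in> V" and A_eq: "\<And>\<Phi>. \<Phi> \<in> V \<Longrightarrow> L2_inner \<Omega> (A v) \<Phi> = energy \<Omega> v \<Phi>" if "v \<in> V" for v
    using A that by (auto simp: discrete_laplacian_def)
  have PV: "P0 v \<in> V" and P_eq: "\<And>\<Phi>. \<Phi> \<in> V \<Longrightarrow> L2_inner \<Omega> (P0 v) \<Phi> = L2_inner \<Omega> v \<Phi>" if "v \<in> L2 \<Omega>" for v
    using P0 that by (auto simp: L2_projection_def)

  note Umem = UV V_memD(1)[OF UV] V_memD(2)[OF UV] V_memD(3)[OF UV]
  have \<omega>H10: "\<omega> t \<in> H10 \<Omega>" if "t \<in> {0..T}" for t
    unfolding \<omega>_def using UV[OF that] by (rule RH)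
  have \<epsilon>H10: "\<epsilon> t \<in> H10 \<Omega>" if "t \<in> {0..T}" for t
    unfolding \<epsilon>_def by (intro H10_diff RH Umem that)
  \<comment> \<open>Norm equivalence on V lifts continuity in L2 to continuity in H1; the difference
    estimate for R does the same for \<omega> in the energy norm.\<close>
  have U_cont_H1: "((\<lambda>r. ?N (\<lambda>x. U r x - U t x)) \<longlongrightarrow> 0) (at t within {0..T})" if t: "t \<in> {0..T}" for t
    using U_cont[OF t]
  proof (rule tendsto_0_of_le_mult)
    show "?N (\<lambda>x. U r x - U t x) \<le> (\<Sum>j<k. ?N (w j)) * L2_norm \<Omega> (\<lambda>x. U r x - U t x)" if "r \<in> {0..T}" for r
      using that t by (intro H1_norm_le_L2_norm V.diff_closed UV)
  qed (rule H10.norm_nonneg)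
  have \<omega>_cont: "((\<lambda>r. energy_norm \<Omega> (\<lambda>x. \<omega> r x - \<omega> t x)) \<longlongrightarrow> 0) (at t within {0..T})" if t: "t \<in> {0..T}" for t
    using U_cont[OF t]
  proof (rule tendsto_0_of_le_mult)
    show "energy_norm \<Omega> (\<lambda>x. \<omega> r x - \<omega> t x)
        \<le> (\<Sum>j<k. energy_norm \<Omega> (R (w j))) * L2_norm \<Omega> (\<lambda>x. U r x - U t x)" if "r \<in> {0..T}" for r
      unfolding \<omega>_def using that t by (intro reconstruction_diff_le[OF A R] UV)
  qed (rule energy.norm_nonneg)
  have \<epsilon>_cont: "((\<lambda>r. energy_norm \<Omega> (\<lambda>x. \<epsilon> r x - \<epsilon> t x)) \<longlongrightarrow> 0) (at t within {0..T})" if t: "t \<in> {0..T}" for t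
  proof (rule tendsto_0_of_le_mult[where C = 1])
    show "((\<lambda>r. energy_norm \<Omega> (\<lambda>x. \<omega> r x - \<omega> t x) + ?N (\<lambda>x. U r x - U t x)) \<longlongrightarrow> 0) (at t within {0..T})"
      using tendsto_add[OF \<omega>_cont[OF t] U_cont_H1[OF t]] by simp
    show "energy_norm \<Omega> (\<lambda>x. \<epsilon> r x - \<epsilon> t x)
        \<le> 1 * (energy_norm \<Omega> (\<lambda>x. \<omega> r x - \<omega> t x) + ?N (\<lambda>x. U r x - U t x))" if r: "r \<in> {0..T}" for r
    proof -
      have "energy_norm \<Omega> (\<lambda>x. (\<omega> r x - \<omega> t x) - (U r x - U t x))
          \<le> energy_norm \<Omega> (\<lambda>x. \<omega> r x - \<omega> t x) + energy_norm \<Omega> (\<lambda>x. U r x - U t x)"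
        using r t by (intro energy.norm_triangle_diff energy.diff_closed H10_H1 \<omega>H10 Umem)
      moreover have "(\<lambda>x. (\<omega> r x - \<omega> t x) - (U r x - U t x)) = (\<lambda>x. \<epsilon> r x - \<epsilon> t x)"
        by (simp add: \<epsilon>_def \<omega>_def algebra_simps)
      ultimately show ?thesis
        using energy_norm_le_H1_norm[of "\<lambda>x. U r x - U t x"] by simp
    qed
  qed (rule energy.norm_nonneg)

  obtain sU where sU: "H10.approximable T U sU"
    using H10.approximable_of_continuous[OF Umem(2) U_cont_H1] by blast
  obtain s\<omega> where s\<omega>: "energy.approximable T \<omega> s\<omega>"
    using energy.approximable_of_continuous[OF H10_H1[OF \<omega>H10] \<omega>_cont] by blast
  obtain su where su: "H10.approximable T u su"
    using H10.Bochner_L2_approximable[OF u_Bochner] by blast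
  obtain sf where sf: "L2.approximable \<Omega> T f sf"
    using L2.Bochner_L2_approximable[OF f] by blast
  define se where "se n t x = sU n t x - su n t x" for n t x
  have se: "H10.approximable T e se"
    unfolding e_def se_def[abs_def] using sU su by (rule H10.approximable_diff)
  have f_L2: "AE t in ?M. f t \<in> L2 \<Omega>"
    by (rule Bochner_L2_AE[OF f])
  have u_H10: "AE t in ?M. u t \<in> H10 \<Omega>"
    by (rule Bochner_L2_AE[OF u_Bochner])
  have sP: "L2.approximable \<Omega> T (\<lambda>t. P0 (f t)) (\<lambda>n t. P0 (sf n t))"
  proof (rule L2.approximableI)
    show "simple_function ?M (\<lambda>t. P0 (sf n t))" for n
      by (rule simple_function_compose1[OF L2.approximableD(1)[OF sf]])
    show "P0 (sf n t) \<in> L2 \<Omega>" if "t \<in> {0<..<T}" for n t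
      by (intro V_memD PV L2.approximableD(2)[OF sf] that)
    show "AE t in ?M. P0 (f t) \<in> L2 \<Omega> \<and> (\<lambda>n. L2_norm \<Omega> (\<lambda>x. P0 (f t) x - P0 (sf n t) x)) \<longlonglongrightarrow> 0"
      using L2.approximableD(3)[OF sf]
    proof eventually_elim
      case (elim t)
      have "(\<lambda>n. L2_norm \<Omega> (\<lambda>x. P0 (f t) x - P0 (sf n t) x)) \<longlonglongrightarrow> 0"
        by (rule Lim_null_comparison[where g = "\<lambda>n. L2_norm \<Omega> (\<lambda>x. f t x - sf n t x)"])
          (simp_all add: elim L2.norm_nonneg L2_projection_diff_le[OF P0])
      with elim show ?case by (simp add: PV V_memD)
    qed
  qed

  define F where "F t x = P0 (f t) x - f t x" for t x
  have sF: "L2.approximable \<Omega> T F (\<lambda>n t x. P0 (sf n t) x - sf n t x)"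
    unfolding F_def[abs_def] using sP sf by (rule L2.approximable_diff)
  have Nf_int: "integrable ?M (\<lambda>t. (L2_norm \<Omega> (f t))\<^sup>2)"
    by (rule Bochner_L2_integrable[OF f])
  have Nu_int: "integrable ?M (\<lambda>t. (?N (u t))\<^sup>2)"
    by (rule Bochner_L2_integrable[OF u_Bochner])
  have cont_int: "integrable ?M (\<lambda>t. (g t)\<^sup>2)" if "continuous_on {0..T} g" for g :: "real \<Rightarrow> real"
    unfolding integrable_lebesgue_on_Ioo_iff
    by (intro continuous_imp_integrable_real continuous_intros that)
  have NU_int: "integrable ?M (\<lambda>t. (?N (U t))\<^sup>2)"
    using Umem(2) U_cont_H1 by (intro cont_int H10.norm_continuous_on)
  have N\<omega>_int: "integrable ?M (\<lambda>t. (energy_norm \<Omega> (\<omega> t))\<^sup>2)"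
    using H10_H1[OF \<omega>H10] \<omega>_cont by (intro cont_int energy.norm_continuous_on)
  have N\<epsilon>_int: "integrable ?M (\<lambda>t. (energy_norm \<Omega> (\<epsilon> t))\<^sup>2)"
    using H10_H1[OF \<epsilon>H10] \<epsilon>_cont by (intro cont_int energy.norm_continuous_on)
  have NP_int: "integrable ?M (\<lambda>t. (L2_norm \<Omega> (P0 (f t)))\<^sup>2)"
  proof (rule integrable_bound_AE[OF Nf_int])
    note [measurable] = L2.norm_measurable[OF sP]
    show "(\<lambda>t. (L2_norm \<Omega> (P0 (f t)))\<^sup>2) \<in> borel_measurable ?M" by measurable
    show "AE t in ?M. \<bar>(L2_norm \<Omega> (P0 (f t)))\<^sup>2\<bar> \<le> (L2_norm \<Omega> (f t))\<^sup>2"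
      using f_L2 by eventually_elim (simp add: L2_projection_le[OF P0] L2.norm_nonneg power_mono)
  qed
  have NF_int: "integrable ?M (\<lambda>t. (L2_norm \<Omega> (F t))\<^sup>2)"
    unfolding F_def[abs_def] by (rule L2.norm_sq_diff_integrable[OF sP sf NP_int Nf_int])
  have e_H10: "AE t in ?M. e t \<in> H10 \<Omega>"
    using u_H10 AEI by eventually_elim (auto simp: e_def intro!: H10_diff Umem)
  have Ne_int: "integrable ?M (\<lambda>t. (?N (e t))\<^sup>2)"
    unfolding e_def by (rule H10.norm_sq_diff_integrable[OF sU su NU_int Nu_int])
  have energy_int: "integrable ?M (\<lambda>t. (energy_norm \<Omega> (g t))\<^sup>2)"
    and L2_int: "integrable ?M (\<lambda>t. (L2_norm \<Omega> (g t))\<^sup>2)"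
    if g: "H10.approximable T g s" and int: "integrable ?M (\<lambda>t. (?N (g t))\<^sup>2)" for g s
  proof -
    note [measurable] = energy.norm_measurable[OF approximable_H10_energy[OF g]]
      L2.norm_measurable[OF approximable_H10_L2[OF g]]
    show "integrable ?M (\<lambda>t. (energy_norm \<Omega> (g t))\<^sup>2)"
      by (rule integrable_bound_AE[OF int])
        (simp_all add: power_mono energy_norm_le_H1_norm energy.norm_nonneg)
    show "integrable ?M (\<lambda>t. (L2_norm \<Omega> (g t))\<^sup>2)"
      by (rule integrable_bound_AE[OF int])
        (simp_all add: power_mono L2_norm_le_H1_norm L2.norm_nonneg)
  qed
  note Ee_int = energy_int[OF se Ne_int]
  have Fe_int: "integrable ?M (\<lambda>t. L2_inner \<Omega> (F t) (e t))"
    by (rule L2.inner_integrable[OF sF approximable_H10_L2[OF se] NF_int L2_int[OF se Ne_int]])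
  note Eu_int = energy_int[OF su Nu_int]
  have sq: "energy.approximable T (\<lambda>t x. \<omega> t x - u t x) (\<lambda>n t x. s\<omega> n t x - su n t x)"
    using s\<omega> approximable_H10_energy[OF su] by (rule energy.approximable_diff)
  have Eq_int: "integrable ?M (\<lambda>t. (energy_norm \<Omega> (\<lambda>x. \<omega> t x - u t x))\<^sup>2)"
    by (rule energy.norm_sq_diff_integrable[OF s\<omega> approximable_H10_energy[OF su] N\<omega>_int Eu_int])

  \<comment> \<open>By Cauchy-Schwarz, this bounds the norm on H10 of the functional q t defined
    below.\<close>
  define \<gamma> where "\<gamma> t = L2_norm \<Omega> (F t) + energy_norm \<Omega> (\<lambda>x. \<omega> t x - u t x)" for t
  have \<gamma>_nonneg: "0 \<le> \<gamma> t" for t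
    unfolding \<gamma>_def by (intro add_nonneg_nonneg L2.norm_nonneg energy.norm_nonneg)
  have \<gamma>_int: "integrable ?M (\<lambda>t. (\<gamma> t)\<^sup>2)"
  proof (rule integrable_bound_AE)
    note [measurable] = L2.norm_measurable[OF sF] energy.norm_measurable[OF sq]
    show "integrable ?M (\<lambda>t. 2 * (L2_norm \<Omega> (F t))\<^sup>2 + 2 * (energy_norm \<Omega> (\<lambda>x. \<omega> t x - u t x))\<^sup>2)"
      using NF_int Eq_int by simp
    show "(\<lambda>t. (\<gamma> t)\<^sup>2) \<in> borel_measurable ?M" unfolding \<gamma>_def by measurable
  qed (simp add: \<gamma>_def power2_sum_le)

  \<comment> \<open>\<omega> - u is \<epsilon> + e. Written with \<omega> - u, the functional splits
    into the equations for U and for u, which are treated separately in \<open>weak\<close>.\<close>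
  define q where "q t v = L2_inner \<Omega> (F t) v - energy \<Omega> (\<lambda>x. \<omega> t x - u t x) v" for t v
  have good: "AE t in ?M. t \<in> {0..T} \<and> f t \<in> L2 \<Omega> \<and> F t \<in> L2 \<Omega> \<and> P0 (f t) \<in> L2 \<Omega> \<and> u t \<in> H1 \<Omega> \<and> \<omega> t \<in> H1 \<Omega>
      \<and> (\<lambda>x. \<omega> t x - u t x) \<in> H1 \<Omega> \<and> e t \<in> H10 \<Omega>"
    using AEI f_L2 u_H10 e_H10
  proof eventually_elim
    case (elim t)
    then have "t \<in> {0..T}" by simp
    with elim show ?case
      using V_memD(3)[OF PV[of "f t"]] \<omega>H10[of t]
      by (simp add: F_def[abs_def] H10_H1 energy.diff_closed L2.diff_closed)
  qed
  have q_bound: "AE t in ?M. \<forall>v\<in>H10 \<Omega>. \<bar>q t v\<bar> \<le> \<gamma> t * ?N v"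
    using good
  proof eventually_elim
    case t: (elim t)
    show ?case
    proof
      fix v assume v: "v \<in> H10 \<Omega>"
      have "\<bar>L2_inner \<Omega> (F t) v\<bar> \<le> L2_norm \<Omega> (F t) * L2_norm \<Omega> v"
        using t H10_L2[OF v] by (intro L2.Cauchy_Schwarz) auto
      also have "\<dots> \<le> L2_norm \<Omega> (F t) * ?N v"
        by (intro mult_left_mono L2_norm_le_H1_norm L2.norm_nonneg)
      finally have 1: "\<bar>L2_inner \<Omega> (F t) v\<bar> \<le> L2_norm \<Omega> (F t) * ?N v" .
      have "\<bar>energy \<Omega> (\<lambda>x. \<omega> t x - u t x) v\<bar> \<le> energy_norm \<Omega> (\<lambda>x. \<omega> t x - u t x) * energy_norm \<Omega> v"
        using t H10_H1[OF v] by (intro energy.Cauchy_Schwarz) auto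
      also have "\<dots> \<le> energy_norm \<Omega> (\<lambda>x. \<omega> t x - u t x) * ?N v"
        by (intro mult_left_mono energy_norm_le_H1_norm energy.norm_nonneg)
      finally show "\<bar>q t v\<bar> \<le> \<gamma> t * ?N v"
        using 1 unfolding q_def \<gamma>_def distrib_right by linarith
    qed
  qed
  have q_diff: "AE t in ?M. \<forall>v\<in>H10 \<Omega>. \<forall>v'\<in>H10 \<Omega>. q t (\<lambda>x. v x - v' x) = q t v - q t v'"
    using good
  proof eventually_elim
    case (elim t)
    then show ?case
      by (simp add: q_def L2.diff_right energy.diff_right H10_L2 H10_H1)
  qed
  have q_meas: "(\<lambda>t. q t v) \<in> borel_measurable ?M" if "v \<in> H10 \<Omega>" for v
    unfolding q_def
    using L2.inner_measurable[OF sF L2.approximable_const[OF H10_L2[OF that]]]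
      energy.inner_measurable[OF sq energy.approximable_const[OF H10_H1[OF that]]]
    by (rule borel_measurable_diff)

  have weak: "(LINT t|?M. deriv \<eta> t * L2_inner \<Omega> (e t) v) = - (LINT t|?M. \<eta> t * q t v)"
    if \<eta>: "\<eta> \<in> test_functions {0<..<T}" and v: "v \<in> H10 \<Omega>" for \<eta> v
  proof -
    \<comment> \<open>p1 and p2 are the time derivatives of U and u paired with v, as read off from
      the two equations; in this form their integrability in time follows from that of the
      data.\<close>
    define p1 where "p1 t = L2_inner \<Omega> (P0 (f t)) v - energy \<Omega> (\<omega> t) v" for t
    define p2 where "p2 t = L2_inner \<Omega> (f t) v - energy \<Omega> (u t) v" for t
    have v': "v \<in> L2 \<Omega>" "v \<in> H1 \<Omega>" using v H10_L2 H10_H1 by auto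
    have int1: "integrable ?M p1"
      unfolding p1_def[abs_def]
      by (intro Bochner_Integration.integrable_diff L2.inner_const_integrable[OF sP NP_int]
          energy.inner_const_integrable[OF s\<omega> N\<omega>_int] v')
    have int2: "integrable ?M p2"
      unfolding p2_def[abs_def]
      by (intro Bochner_Integration.integrable_diff L2.inner_const_integrable[OF sf Nf_int]
          energy.inner_const_integrable[OF approximable_H10_energy[OF su] Eu_int] v')
    note \<eta>p_int = integrable_test_function_mult[OF \<eta> int1] integrable_test_function_mult[OF \<eta> int2]
    have eq1: "AE t in ?M. \<eta> t * p1 t = \<eta> t * L2_inner \<Omega> (U' t) v"
      using good U'(2) Bochner_L2_AE[OF U'_B]
    proof eventually_elim
      case (elim t)
      then have t: "t \<in> {0..T}" "f t \<in> L2 \<Omega>" by auto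
      note UtV = UV[OF t(1)]
      \<comment> \<open>The residual of the scheme as an element of V. It is orthogonal to V, so it
        may be tested with v from H10; the defining equation of R then turns the pairing of A (U t)
        with v into the energy of \<omega> t and v.\<close>
      define Z where "Z x = U' t x + A (U t) x - P0 (f t) x" for x
      have mem: "U' t \<in> V" "A (U t) \<in> V" "P0 (f t) \<in> V"
        using elim(3) AV[OF UtV] PV[OF t(2)] by auto
      have Z: "Z \<in> V"
        unfolding Z_def[abs_def] using mem by (intro V.diff_closed V.add_closed)
      have Z_inner: "L2_inner \<Omega> Z \<phi> = L2_inner \<Omega> (U' t) \<phi> + L2_inner \<Omega> (A (U t)) \<phi> - L2_inner \<Omega> (P0 (f t)) \<phi>"
        if "\<phi> \<in> L2 \<Omega>" for \<phi>
        unfolding Z_def[abs_def] using mem that by (simp add: L2.diff_left L2.add_left L2.add_closed V_memD)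
      have "L2_inner \<Omega> Z v = 0"
      proof (rule L2_inner_eq_0[OF Z _ v'(1)])
        fix \<Phi> assume \<Phi>: "\<Phi> \<in> V"
        show "L2_inner \<Omega> Z \<Phi> = 0"
          using elim(2) \<Phi> UtV t(2) by (simp add: Z_inner V_memD A_eq P_eq)
      qed
      then have "L2_inner \<Omega> (U' t) v = p1 t"
        unfolding p1_def \<omega>_def using v v' UtV by (simp add: Z_inner R_eq)
      then show ?case by simp
    qed
    have eq2: "AE t in ?M. \<eta> t * p2 t = \<eta> t * u' t v"
      using u'(2) by eventually_elim (use v in \<open>simp add: p2_def algebra_simps flip: distrib_left\<close>)
    have cont_inner: "continuous_on {0..T} (\<lambda>t. L2_inner \<Omega> (U t) v)" "continuous_on {0..T} (\<lambda>t. L2_inner \<Omega> (u t) v)"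
      using Umem(4) U_cont uL2 u_cont v' by (auto intro: L2.inner_continuous_on)
    have deriv_int: "integrable ?M (\<lambda>t. deriv \<eta> t * g t)" if "continuous_on {0..T} g" for g
      unfolding integrable_lebesgue_on_Ioo_iff deriv_test_function[OF \<eta>]
      by (intro continuous_imp_integrable_real continuous_intros that
          test_function_continuous_derivative[OF \<eta>]) simp
    have "(LINT t|?M. deriv \<eta> t * L2_inner \<Omega> (e t) v)
        = (LINT t|?M. deriv \<eta> t * L2_inner \<Omega> (U t) v - deriv \<eta> t * L2_inner \<Omega> (u t) v)"
    proof (rule Bochner_Integration.integral_cong[OF refl])
      fix t assume "t \<in> space ?M"
      then have "t \<in> {0..T}" by simp
      then have "L2_inner \<Omega> (e t) v = L2_inner \<Omega> (U t) v - L2_inner \<Omega> (u t) v"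
        unfolding e_def using v' by (intro L2.diff_left Umem uL2)
      then show "deriv \<eta> t * L2_inner \<Omega> (e t) v = deriv \<eta> t * L2_inner \<Omega> (U t) v - deriv \<eta> t * L2_inner \<Omega> (u t) v"
        by (simp add: right_diff_distrib)
    qed
    also have "\<dots> = (LINT t|?M. deriv \<eta> t * L2_inner \<Omega> (U t) v) - (LINT t|?M. deriv \<eta> t * L2_inner \<Omega> (u t) v)"
      by (intro Bochner_Integration.integral_diff deriv_int cont_inner)
    also have "(LINT t|?M. deriv \<eta> t * L2_inner \<Omega> (U t) v) = - (LINT t|?M. \<eta> t * L2_inner \<Omega> (U' t) v)"
      using U'(1) \<eta> v by (simp add: weak_time_derivative_def)
    \<comment> \<open>\<open>integral_cong_AE\<close> asks for measurability of both integrands; the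
      one with U' inherits it from p1 through the a.e. equality, and below the one with u' from
      p2.\<close>
    also have "(LINT t|?M. \<eta> t * L2_inner \<Omega> (U' t) v) = (LINT t|?M. \<eta> t * p1 t)"
      by (rule sym, rule integral_cong_AE[OF _ _ eq1])
        (auto intro: borel_measurable_integrable[OF \<eta>p_int(1)]
          borel_measurable_lebesgue_on_AE_eq[OF borel_measurable_integrable[OF \<eta>p_int(1)] eq1])
    also have "(LINT t|?M. deriv \<eta> t * L2_inner \<Omega> (u t) v) = - (LINT t|?M. \<eta> t * u' t v)"
      using u'(1) \<eta> v by (simp add: weak_time_derivative_def)
    also have "(LINT t|?M. \<eta> t * u' t v) = (LINT t|?M. \<eta> t * p2 t)"
      by (rule sym, rule integral_cong_AE[OF _ _ eq2])
        (auto intro: borel_measurable_integrable[OF \<eta>p_int(2)]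
          borel_measurable_lebesgue_on_AE_eq[OF borel_measurable_integrable[OF \<eta>p_int(2)] eq2])
    also have "- (LINT t|?M. \<eta> t * p1 t) - - (LINT t|?M. \<eta> t * p2 t)
        = - (LINT t|?M. \<eta> t * p1 t - \<eta> t * p2 t)"
      using \<eta>p_int by simp
    also have "(LINT t|?M. \<eta> t * p1 t - \<eta> t * p2 t) = (LINT t|?M. \<eta> t * q t v)"
    proof (rule integral_cong_AE)
      show "(\<lambda>t. \<eta> t * p1 t - \<eta> t * p2 t) \<in> borel_measurable ?M"
        using \<eta>p_int by (intro borel_measurable_integrable) simp
      show eq: "AE t in ?M. \<eta> t * p1 t - \<eta> t * p2 t = \<eta> t * q t v"
        using good
      proof eventually_elim
        case (elim t)
        have "q t v = p1 t - p2 t"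
          unfolding q_def p1_def p2_def F_def[abs_def] using elim v'
          by (simp add: L2.diff_left energy.diff_left)
        then show ?case by (simp add: right_diff_distrib)
      qed
      show "(\<lambda>t. \<eta> t * q t v) \<in> borel_measurable ?M"
        by (rule borel_measurable_lebesgue_on_AE_eq[OF _ eq])
          (use \<eta>p_int in \<open>auto intro: borel_measurable_integrable\<close>)
    qed
    finally show ?thesis .
  qed

  \<comment> \<open>2 q t (e t) contains -2 ||e||_a^2 and the mixed term -2 a(\<epsilon>, e).
    Young's inequality spends one ||e||_a^2 on the mixed term, besides ||\<epsilon>||_a^2, and
    leaves the one subtracted here.\<close>
  define H where "H t = ((energy_norm \<Omega> (\<epsilon> t))\<^sup>2 + 2 * L2_inner \<Omega> (F t) (e t)) - (energy_norm \<Omega> (e t))\<^sup>2" for t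
  have rhs_int: "integrable ?M (\<lambda>t. (energy_norm \<Omega> (\<epsilon> t))\<^sup>2 + 2 * L2_inner \<Omega> (F t) (e t))"
    using N\<epsilon>_int Fe_int by simp
  have H_int: "integrable ?M H"
    unfolding H_def[abs_def] using rhs_int Ee_int by (rule Bochner_Integration.integrable_diff)
  have H: "AE t in ?M. 2 * q t (e t) \<le> H t"
    using good
  proof eventually_elim
    case (elim t)
    have m: "\<epsilon> t \<in> H1 \<Omega>" "e t \<in> H1 \<Omega>"
      using elim \<epsilon>H10 H10_H1 by auto
    have "(\<lambda>x. \<omega> t x - u t x) = (\<lambda>x. \<epsilon> t x + e t x)"
      by (simp add: \<omega>_def \<epsilon>_def e_def)
    then have eq: "energy \<Omega> (\<lambda>x. \<omega> t x - u t x) (e t) = energy \<Omega> (\<epsilon> t) (e t) + (energy_norm \<Omega> (e t))\<^sup>2"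
      using m by (simp add: energy.add_left energy.norm_sq)
    have "- (2 * energy \<Omega> (\<epsilon> t) (e t)) \<le> (energy_norm \<Omega> (\<epsilon> t))\<^sup>2 + (energy_norm \<Omega> (e t))\<^sup>2"
      using energy.Cauchy_Schwarz[OF m] sum_squares_bound[of "energy_norm \<Omega> (\<epsilon> t)" "energy_norm \<Omega> (e t)"]
      by (simp add: mult.assoc)
    then show ?case
      unfolding q_def H_def eq by (simp add: algebra_simps)
  qed
  have e_L2: "e t \<in> L2 \<Omega>" if "t \<in> {0..T}" for t
    unfolding e_def using that by (intro L2.diff_closed Umem uL2)
  have e_cont: "((\<lambda>r. L2_norm \<Omega> (\<lambda>x. e r x - e t x)) \<longlongrightarrow> 0) (at t within {0..T})" if t: "t \<in> {0..T}" for t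
  proof (rule tendsto_0_of_le_mult[where C = 1])
    show "((\<lambda>r. L2_norm \<Omega> (\<lambda>x. U r x - U t x) + L2_norm \<Omega> (\<lambda>x. u r x - u t x)) \<longlongrightarrow> 0) (at t within {0..T})"
      using tendsto_add[OF U_cont[OF t] u_cont[OF t]] by simp
    show "L2_norm \<Omega> (\<lambda>x. e r x - e t x)
        \<le> 1 * (L2_norm \<Omega> (\<lambda>x. U r x - U t x) + L2_norm \<Omega> (\<lambda>x. u r x - u t x))" if r: "r \<in> {0..T}" for r
    proof -
      have "L2_norm \<Omega> (\<lambda>x. (U r x - U t x) - (u r x - u t x))
          \<le> L2_norm \<Omega> (\<lambda>x. U r x - U t x) + L2_norm \<Omega> (\<lambda>x. u r x - u t x)"
        using r t by (intro L2.norm_triangle_diff L2.diff_closed Umem uL2)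
      moreover have "(\<lambda>x. (U r x - U t x) - (u r x - u t x)) = (\<lambda>x. e r x - e t x)"
        by (simp add: e_def algebra_simps)
      ultimately show ?thesis by simp
    qed
  qed (rule L2.norm_nonneg)
  have sub: "integrable (lebesgue_on {0..b}) g" if "integrable ?M g" for g :: "real \<Rightarrow> real"
    using that b integrable_on_of_lebesgue_on(1)[of 0 T g 0 b] by (simp add: integrable_lebesgue_on_Ioo_iff)
  have "(L2_norm \<Omega> (e b))\<^sup>2 - (L2_norm \<Omega> (e 0))\<^sup>2 \<le> integral {0..b} H"
    by (rule energy_inequality[OF T e_L2 e_cont se Ne_int \<gamma>_int \<gamma>_nonneg q_bound q_diff q_meas weak H_int H b])
  also have "integral {0..b} H = integral\<^sup>L (lebesgue_on {0..b}) H"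
    using H_int b unfolding integrable_lebesgue_on_Ioo_iff
    by (intro integrable_on_of_lebesgue_on(3)[symmetric]) auto
  also have "\<dots> = (LINT s|lebesgue_on {0..b}. (energy_norm \<Omega> (\<epsilon> s))\<^sup>2 + 2 * L2_inner \<Omega> (F s) (e s))
      - (LINT s|lebesgue_on {0..b}. (energy_norm \<Omega> (e s))\<^sup>2)"
    unfolding H_def[abs_def] by (rule Bochner_Integration.integral_diff[OF sub[OF rhs_int] sub[OF Ee_int]])
  finally show ?thesis
    by (simp add: F_def[abs_def])
qed

end

theorem lemma3p3:
  fixes \<Omega> :: "'a::euclidean_space set" and \<T> :: "'a set set" and p :: nat and T :: real
    and u0 U0 :: "'a \<Rightarrow> real" and f u U \<omega> e \<epsilon> :: "real \<Rightarrow> 'a \<Rightarrow> real"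
    and V :: "('a \<Rightarrow> real) set" and A P0 R :: "('a \<Rightarrow> real) \<Rightarrow> ('a \<Rightarrow> real)"
  assumes "polyhedral_domain \<Omega>"
    and "conforming_triangulation \<Omega> \<T>"
    and "p \<ge> 1"
    and "V = fe_space \<Omega> \<T> p"
    and "T > 0"
    and "u0 \<in> L2 \<Omega>"
    and "f \<in> Bochner_L2 T (L2 \<Omega>) (L2_norm \<Omega>)"
    and "heat_solution \<Omega> T u0 f u"
    and "U0 \<in> V"
    and "semidiscrete_solution \<Omega> T V U0 f U"
    and "discrete_laplacian \<Omega> V A"
    and "L2_projection \<Omega> V P0"
    and "elliptic_reconstruction \<Omega> V A R"
    and "\<omega> = (\<lambda>t. R (U t))"
    and "e = (\<lambda>t x. U t x - u t x)"
    and "\<epsilon> = (\<lambda>t x. \<omega> t x - U t x)"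
  shows "\<forall>t\<in>{0..T}.
    (L2_norm \<Omega> (e t))\<^sup>2 + (LINT s|lebesgue_on {0..t}. (energy_norm \<Omega> (e s))\<^sup>2)
      \<le> (L2_norm \<Omega> (e 0))\<^sup>2 + (LINT s|lebesgue_on {0..t}.
            (energy_norm \<Omega> (\<epsilon> s))\<^sup>2 + 2 * L2_inner \<Omega> (\<lambda>x. P0 (f s) x - f s x) (e s))"
proof
  fix t assume t: "t \<in> {0..T}"
  interpret open_domain \<Omega>
    using assms(1) by unfold_locales (auto simp: polyhedral_domain_def)
  have "finite \<T>" "\<Omega> \<subseteq> \<Union>\<T>"
    using assms(2) closure_subset[of \<Omega>] by (auto simp: conforming_triangulation_def triangulation_def)
  \<comment> \<open>The membership of U0 in V shows that the finite element space is
    nonempty.\<close>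
  from fe_space_orthonormal_generators[OF this, of p] obtain k :: nat and w where
    "\<forall>j<k. w j \<in> V" "\<forall>i<k. \<forall>j<k. L2_inner \<Omega> (w i) (w j) = of_bool (i = j)"
    "\<forall>v\<in>V. AE x in lebesgue_on \<Omega>. v x = (\<Sum>j<k. L2_inner \<Omega> v (w j) * w j x)"
    using assms(4,9) by blast
  then interpret discrete_space \<Omega> V k w
    using assms(4) by unfold_locales (auto intro: fe_space_H10 fe_space_add fe_space_scale)
  show "(L2_norm \<Omega> (e t))\<^sup>2 + (LINT s|lebesgue_on {0..t}. (energy_norm \<Omega> (e s))\<^sup>2)
      \<le> (L2_norm \<Omega> (e 0))\<^sup>2 + (LINT s|lebesgue_on {0..t}.
            (energy_norm \<Omega> (\<epsilon> s))\<^sup>2 + 2 * L2_inner \<Omega> (\<lambda>x. P0 (f s) x - f s x) (e s))"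
    unfolding assms(14-16)
    by (rule semidiscrete_error_estimate[OF assms(5,7,8,10-13) t])
qed

end
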